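(* Let $X,\Gamma,\mathscr C,\Gamma_0$ satisfy the standing assumptions in the context, fix a base point $o\in X$ with its polynomial $Q$, and let $\mu$ be the unique Patterson--Sullivan measure for $\Gamma$ of dimension $\delta(\Gamma)$. For any $\epsilon>0$ there exists $C>1$ such that for all $T\ge0$ and $\alpha\in\Gamma$, $$\frac1C\,Q(T)\,e^{-\delta(\Gamma)(\operatorname{dist}(o,\alpha\mathscr C)+T)+\delta(\Gamma_0)T}\le\mu(\mathcal S_{T,\epsilon}(\alpha\mathscr C))\le C\,Q(T)\,e^{-\delta(\Gamma)(\operatorname{dist}(o,\alpha\mathscr C)+T)+\delta(\Gamma_0)T}.$$
   Context: Standing assumptions. $X$ is a proper $\mathrm{CAT}(0)$ space with geodesic boundary $\partial X$; geodesics are unit speed. $\delta(G)=\limsup_{t\to\infty}\frac1t\log\#\{g\in G:\operatorname{dist}(o,go)\le t\}$ is the critical exponent. $\Gamma<\mathrm{Isom}(X)$ is discrete, $\delta(\Gamma)<\infty$, and $\Gamma$ is rank one (contains an isometry translating along a geodesic line that does not bound an isometrically embedded half plane $\mathbb R\times[0,\infty)$). $\mathscr C\subset X$ is nonempty and convex, $\Gamma_0<\Gamma$ acts cocompactly on $\mathscr C$, and: (1) $\mathscr C$ is Morse: for all $A\ge1,B\ge0$ there is $D>0$ such that every $(A,B)$-quasi-geodesic $[a,b]\to X$ with endpoints in $\mathscr C$ lies in the open $D$-neighborhood of $\mathscr C$; (2) $\mathscr C$ contains every geodesic line in $X$ parallel to (i.e. at bounded distance, under some unit speed parametrizations, from)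 a geodesic line in $\mathscr C$; (3) $\Gamma_0$ has infinite index in $\Gamma$ and is almost malnormal: $g\Gamma_0g^{-1}\cap\Gamma_0$ is finite for all $g\in\Gamma\smallsetminus\Gamma_0$; (4) for any $o\in X$ there are a positive-valued polynomial $Q:\mathbb R\to(0,\infty)$, $C_1>1$, $n_0>0$ with $C_1^{-1}Q(n)e^{\delta(\Gamma_0)n}\le\#\{\gamma\in\Gamma_0:n\le\operatorname{dist}(o,\gamma o)\le n+n_0\}\le C_1Q(n)e^{\delta(\Gamma_0)n}$ for all $n\ge1$; (5) for any $o\in X$ there is $C_2>1$ with $C_2^{-1}e^{\delta(\Gamma)n}\le\#\{\gamma\in\Gamma:\operatorname{dist}(o,\gamma o)\le n\}\le C_2e^{\delta(\Gamma)n}$ for all $n\ge1$. Patterson--Sullivan measure. For $\xi\in\partial X$ let $\ell_\xi:[0,\infty)\to X$ be the geodesic ray from $o$ to $\xi$ and $b_\xi(x)=\lim_{t\to\infty}(\operatorname{dist}(\ell_\xi(t),x)-t)$. A Patterson--Sullivan measure of dimension $\delta$ is a Borel probability measure $\mu$ on $\partial X$ such that for every $\gamma\in\Gamma$ the measures $\mu,\gamma_*\mu$ are mutually absolutely continuous with $\frac{d\gamma_*\mu}{d\mu}(\xi)=e^{-\delta b_\xi(\gamma o)}$ for $\mu$-a.e. $\xi$. Under the standing assumptions there is exactly one of dimension $\delta(\Gamma)$. Shadows. $\mathcal N_\epsilon(K)$ is the open $\epsilon$-neighborhood of $K\subset X$, and $\mathcal S_{T,\epsilon}(K)=\{\eta\in\partial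 X:\ell_\eta([a,b])\subset\mathcal N_\epsilon(K)\text{ for some }a,b\in[0,\infty)\text{ with }b-a\ge T\}$ (for $T=0$, $a,b$ are required to satisfy $b\geq a$). *)

theory Defs
  imports "HOL-Algebra.Coset" "HOL-Computational_Algebra.Polynomial" "HOL-Probability.Probability"
begin

section \<open>CAT(0) spaces\<close>

definition isometric_on :: "'a::metric_space set \<Rightarrow> ('a \<Rightarrow> 'b::metric_space) \<Rightarrow> bool" where
  "isometric_on S f \<longleftrightarrow> (\<forall>x\<in>S. \<forall>y\<in>S. dist (f x) (f y) = dist x y)"

text \<open>Geodesic space satisfying the comparison inequality.  Any two sides of a geodesic triangle
  share a vertex \<open>p\<close>, and \<open>p\<close>, \<open>q\<close>, \<open>r\<close> are arbitrary, so it suffices to compare points on the sides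
  \<open>[p,q]\<close> and \<open>[p,r]\<close>.  Here \<open>x'\<close> and \<open>y'\<close> are the comparison points of \<open>c s\<close> and \<open>d t\<close> in a comparison
  triangle \<open>p'\<close>, \<open>q'\<close>, \<open>r'\<close> in the Euclidean plane.  Properness is the library class
  \<open>heine_borel\<close>.\<close>

class cat0_space = metric_space +
  assumes geodesic_segment_exists:
      "\<exists>c. isometric_on {0..dist x y} c \<and> c 0 = x \<and> c (dist x y) = y"
    and cat0_comparison:
      "\<lbrakk>isometric_on {0..dist p q} c; c 0 = p; c (dist p q) = q;
        isometric_on {0..dist p r} d; d 0 = p; d (dist p r) = r;
        dist p' q' = dist p q; dist q' r' = dist q r; dist p' r' = dist p r;
        s \<in> {0..dist p q}; x' \<in> closed_segment p' q'; dist p' x' = s;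
        t \<in> {0..dist p r}; y' \<in> closed_segment p' r'; dist p' y' = t\<rbrakk>
       \<Longrightarrow> dist (c s) (d t) \<le> dist x' (y' :: real ^ 2)"

definition geodesic_line :: "(real \<Rightarrow> 'a::metric_space) \<Rightarrow> bool" where
  "geodesic_line c \<longleftrightarrow> isometric_on UNIV c"

definition geodesically_convex :: "'a::metric_space set \<Rightarrow> bool" where
  "geodesically_convex C \<longleftrightarrow>
     (\<forall>c. \<forall>l::real. 0 \<le> l \<longrightarrow> isometric_on {0..l} c \<longrightarrow> c 0 \<in> C \<longrightarrow> c l \<in> C \<longrightarrow> c ` {0..l} \<subseteq> C)"

definition nbhd :: "real \<Rightarrow> 'a::metric_space set \<Rightarrow> 'a set" where
  "nbhd e K = (\<Union>x\<in>K. ball x e)"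

definition quasi_geodesic :: "real \<Rightarrow> real \<Rightarrow> real \<Rightarrow> real \<Rightarrow> (real \<Rightarrow> 'a::metric_space) \<Rightarrow> bool" where
  "quasi_geodesic A B a b f \<longleftrightarrow>
     (\<forall>s\<in>{a..b}. \<forall>t\<in>{a..b}.
        \<bar>s - t\<bar> / A - B \<le> dist (f s) (f t) \<and> dist (f s) (f t) \<le> A * \<bar>s - t\<bar> + B)"

definition Morse_subset :: "'a::metric_space set \<Rightarrow> bool" where
  "Morse_subset C \<longleftrightarrow>
     (\<forall>A\<ge>1. \<forall>B\<ge>0. \<exists>D>0. \<forall>a b f. a \<le> b \<longrightarrow> quasi_geodesic A B a b f \<longrightarrow>
        f a \<in> C \<longrightarrow> f b \<in> C \<longrightarrow> f ` {a..b} \<subseteq> nbhd D C)"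

definition parallel_lines :: "(real \<Rightarrow> 'a::metric_space) \<Rightarrow> (real \<Rightarrow> 'a) \<Rightarrow> bool" where
  "parallel_lines c c' \<longleftrightarrow> (\<exists>K. \<forall>t. dist (c t) (c' t) \<le> K)"

text \<open>All parametrizations of a geodesic line are themselves geodesic lines, so quantifying over
  \<open>c\<close> and \<open>c'\<close> includes the choice of parametrizations.\<close>

definition contains_parallel_lines :: "'a::metric_space set \<Rightarrow> bool" where
  "contains_parallel_lines C \<longleftrightarrow>
     (\<forall>c c'. geodesic_line c \<longrightarrow> range c \<subseteq> C \<longrightarrow> geodesic_line c' \<longrightarrow> parallel_lines c c' \<longrightarrow>
        range c' \<subseteq> C)"


section \<open>Groups of isometries\<close>

definition isometries :: "('a::metric_space \<Rightarrow> 'a) set" where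
  "isometries = {g. bij g \<and> isometric_on UNIV g}"

definition isom_group :: "('a::metric_space \<Rightarrow> 'a) monoid" where
  "isom_group = \<lparr>carrier = isometries, monoid.mult = (\<circ>), monoid.one = id\<rparr>"

lemma group_isom_group: "group isom_group"
proof (rule groupI)
  fix x :: "'a \<Rightarrow> 'a" assume "x \<in> carrier isom_group"
  then have x: "bij x" "\<And>a b. dist (x a) (x b) = dist a b"
    by (auto simp: isom_group_def isometries_def isometric_on_def)
  let ?y = "the_inv x"
  have xy: "x (?y a) = a" for a
    using x(1) by (simp add: bij_def f_the_inv_into_f)
  have yx: "?y (x a) = a" for a
    using x(1) by (simp add: bij_def the_inv_f_f)
  have "bij ?y"
    by (rule bij_betw_the_inv_into[OF x(1)])
  moreover have "dist (?y a) (?y b) = dist a b" for a b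
    using x(2)[of "?y a" "?y b"] by (simp add: xy)
  ultimately have "?y \<in> carrier isom_group"
    by (simp add: isom_group_def isometries_def isometric_on_def)
  moreover have "?y \<otimes>\<^bsub>isom_group\<^esub> x = \<one>\<^bsub>isom_group\<^esub>"
    by (auto simp: isom_group_def yx)
  ultimately show "\<exists>y\<in>carrier isom_group. y \<otimes>\<^bsub>isom_group\<^esub> x = \<one>\<^bsub>isom_group\<^esub>"
    by blast
qed (auto simp: isom_group_def isometries_def isometric_on_def intro: bij_comp)

text \<open>The compact-open topology on the isometry group.\<close>

definition isom_topology :: "('a::metric_space \<Rightarrow> 'a) topology" where
  "isom_topology =
     topology_generated_by {{g \<in> isometries. g ` K \<subseteq> U} | K U. compact K \<and> open U}"

definition discrete_isometries :: "('a::metric_space \<Rightarrow> 'a) set \<Rightarrow> bool" where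
  "discrete_isometries G \<longleftrightarrow> subtopology isom_topology G = discrete_topology G"

definition acts_cocompactly :: "('a::metric_space \<Rightarrow> 'a) set \<Rightarrow> 'a set \<Rightarrow> bool" where
  "acts_cocompactly G C \<longleftrightarrow> (\<exists>K. compact K \<and> (\<Union>g\<in>G. g ` K) = C)"

text \<open>The product \<open>real \<times> real\<close> carries the Euclidean metric.\<close>

definition bounds_half_plane :: "(real \<Rightarrow> 'a::metric_space) \<Rightarrow> bool" where
  "bounds_half_plane c \<longleftrightarrow>
     (\<exists>F :: real \<times> real \<Rightarrow> 'a. isometric_on (UNIV \<times> {0..}) F \<and> (\<forall>t. F (t, 0) = c t))"

definition rank_one_isometry :: "('a::metric_space \<Rightarrow> 'a) \<Rightarrow> bool" where
  "rank_one_isometry g \<longleftrightarrow>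
     (\<exists>c \<tau>. geodesic_line c \<and> \<not> bounds_half_plane c \<and> \<tau> > 0 \<and> (\<forall>t. g (c t) = c (t + \<tau>)))"

definition infinite_index :: "('a::metric_space \<Rightarrow> 'a) set \<Rightarrow> ('a \<Rightarrow> 'a) set \<Rightarrow> bool" where
  "infinite_index H G \<longleftrightarrow> infinite (rcosets\<^bsub>isom_group\<lparr>carrier := G\<rparr>\<^esub> H)"

definition almost_malnormal :: "('a::metric_space \<Rightarrow> 'a) set \<Rightarrow> ('a \<Rightarrow> 'a) set \<Rightarrow> bool" where
  "almost_malnormal H G \<longleftrightarrow>
     (\<forall>g\<in>G - H. finite ((g <#\<^bsub>isom_group\<^esub> H #>\<^bsub>isom_group\<^esub> inv\<^bsub>isom_group\<^esub> g) \<inter> H))"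

text \<open>The critical exponent does not depend on the base point \<open>p\<close>.  The case distinction is there
  because \<open>card\<close> is \<open>0\<close> on infinite sets.\<close>

definition critical_exponent :: "'a::metric_space \<Rightarrow> ('a \<Rightarrow> 'a) set \<Rightarrow> ereal" where
  "critical_exponent p G =
     Limsup at_top (\<lambda>t::real. let N = {g \<in> G. dist p (g p) \<le> t} in
       if finite N then ereal (ln (real (card N)) / t) else \<infinity>)"

abbreviation critexp :: "'a::metric_space \<Rightarrow> ('a \<Rightarrow> 'a) set \<Rightarrow> real" where
  "critexp p G \<equiv> real_of_ereal (critical_exponent p G)"

definition growth_polynomial :: "'a::metric_space \<Rightarrow> ('a \<Rightarrow> 'a) set \<Rightarrow> real poly \<Rightarrow> bool" where
  "growth_polynomial p G Q \<longleftrightarrow> (\<forall>x. poly Q x > 0) \<and>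
     (\<exists>C>1. \<exists>n0::nat. n0 > 0 \<and> (\<forall>n::nat. n \<ge> 1 \<longrightarrow>
        (let N = real (card {g \<in> G. real n \<le> dist p (g p) \<and> dist p (g p) \<le> real n + real n0});
             B = poly Q (real n) * exp (critexp p G * real n)
         in 1 / C * B \<le> N \<and> N \<le> C * B)))"

definition purely_exponential_growth :: "'a::metric_space \<Rightarrow> ('a \<Rightarrow> 'a) set \<Rightarrow> bool" where
  "purely_exponential_growth p G \<longleftrightarrow>
     (\<exists>C>1. \<forall>n::nat. n \<ge> 1 \<longrightarrow>
        (let N = real (card {g \<in> G. dist p (g p) \<le> real n}); B = exp (critexp p G * real n)
         in 1 / C * B \<le> N \<and> N \<le> C * B))"


section \<open>The geodesic boundary\<close>

text \<open>Geodesic rays are encoded as functions on all of \<open>real\<close>; only their values on \<open>[0,\<infinity>)\<close> matter,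
  and each class of asymptotic rays contains all extensions of its members to negative times.\<close>

definition geodesic_ray :: "(real \<Rightarrow> 'a::metric_space) \<Rightarrow> bool" where
  "geodesic_ray c \<longleftrightarrow> isometric_on {0..} c"

definition asymptotic :: "((real \<Rightarrow> 'a::metric_space) \<times> (real \<Rightarrow> 'a)) set" where
  "asymptotic =
     {(c, c'). geodesic_ray c \<and> geodesic_ray c' \<and> (\<exists>K. \<forall>t\<ge>0. dist (c t) (c' t) \<le> K)}"

definition boundary :: "(real \<Rightarrow> 'a::metric_space) set set" where
  "boundary = {c. geodesic_ray c} // asymptotic"

text \<open>In a proper CAT(0) space the ray from \<open>p\<close> representing \<open>\<xi>\<close> exists and is unique on \<open>[0,\<infinity>)\<close>.\<close>

definition ray_to :: "'a::metric_space \<Rightarrow> (real \<Rightarrow> 'a) set \<Rightarrow> real \<Rightarrow> 'a" where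
  "ray_to p \<xi> = (SOME c. c \<in> \<xi> \<and> c 0 = p)"

definition cone_topology :: "'a::metric_space \<Rightarrow> (real \<Rightarrow> 'a) set topology" where
  "cone_topology p = topology_generated_by
     {{\<eta> \<in> boundary. dist (ray_to p \<eta> r) (ray_to p \<xi> r) < e} | \<xi> r e. \<xi> \<in> boundary \<and> r > 0 \<and> e > 0}"

definition boundary_action :: "('a::metric_space \<Rightarrow> 'a) \<Rightarrow> (real \<Rightarrow> 'a) set \<Rightarrow> (real \<Rightarrow> 'a) set" where
  "boundary_action g \<xi> = (\<lambda>c. g \<circ> c) ` \<xi>"

definition busemann :: "'a::metric_space \<Rightarrow> (real \<Rightarrow> 'a) set \<Rightarrow> 'a \<Rightarrow> real" where
  "busemann p \<xi> x = Lim at_top (\<lambda>t. dist (ray_to p \<xi> t) x - t)"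

definition Patterson_Sullivan ::
    "'a::metric_space \<Rightarrow> ('a \<Rightarrow> 'a) set \<Rightarrow> real \<Rightarrow> (real \<Rightarrow> 'a) set measure \<Rightarrow> bool" where
  "Patterson_Sullivan p G \<delta> \<mu> \<longleftrightarrow>
     space \<mu> = boundary \<and> sets \<mu> = sigma_sets boundary {U. openin (cone_topology p) U} \<and>
     prob_space \<mu> \<and>
     (\<forall>g\<in>G. let \<nu> = distr \<mu> \<mu> (boundary_action g) in
        absolutely_continuous \<mu> \<nu> \<and> absolutely_continuous \<nu> \<mu> \<and>
        (AE \<xi> in \<mu>. RN_deriv \<mu> \<nu> \<xi> = ennreal (exp (- \<delta> * busemann p \<xi> (g p)))))"

definition shadow :: "'a::metric_space \<Rightarrow> real \<Rightarrow> real \<Rightarrow> 'a set \<Rightarrow> (real \<Rightarrow> 'a) set set" where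
  "shadow p T e K =
     {\<eta> \<in> boundary. \<exists>a b. 0 \<le> a \<and> a \<le> b \<and> b - a \<ge> T \<and> ray_to p \<eta> ` {a..b} \<subseteq> nbhd e K}"

end

(* A ray that comes close to \<alpha> C for a time T passes near the projection of p to \<alpha> C and near an
   orbit point \<alpha> g p, with g in \<Gamma>\<^sub>0, at distance about infdist p (\<alpha> C) + T from p; conversely the
   rays that leave \<alpha> C near such a point form a set \<alpha> g V of measure at least
   exp (- \<delta> d(p, \<alpha> g p)) \<mu>(V) in the shadow, and these sets overlap with bounded multiplicity.  So the
   measure of the shadow is comparable to the number of such g times exp (- \<delta> (infdist p (\<alpha> C) + T)),
   and the growth of \<Gamma>\<^sub>0 concludes.  The geometry comes from the Morse property, which makes the
   projection to C strongly contracting; the small \<epsilon> in the lower bound comes from the flat strip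
   argument, as C contains all parallel lines.  Positivity of \<mu>(V) is the fact that \<mu> cannot live on
   the limit set of C, which by almost malnormality is disjoint from some translate. *)

theory Submission
  imports Defs
begin

section \<open>Geodesics and comparison\<close>

text \<open>The lower mass bound rests on the trivial inequality b_\<xi> (g p) \<ge> - dist p (g p),
  which holds for every \<xi>; so it is available for any measurable \<open>V\<close>. What has to
  be arranged is that the translates lie in the shadow and seldom overlap. Therefore
  \<open>V\<close> is described by projections and not by balls: it consists of the rays whose
  projection to \<open>C\<close> finally stays near \<open>p\<close>. Up to multiples of
  \<open>D\<close> this does not depend on the origin of the ray, and the translates of
  \<open>V\<close> under the countable group \<open>G\<close> cover everything outside the limit
  set. The Morse property is applied to a single pair of constants, (4, 0), with gauge
  \<open>D\<close>. The contraction obtained from it does not depend on the length of a geodesic: as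
  long as the geodesic stays at distance at least \<open>240 * D\<close> from \<open>C\<close>, its
  projection moves by less than \<open>48 * D\<close>. This also covers the unbounded ends of
  rays.\<close>

definition geodesic_between :: "'a::metric_space \<Rightarrow> 'a \<Rightarrow> (real \<Rightarrow> 'a) \<Rightarrow> bool" where
  "geodesic_between x y c \<longleftrightarrow> isometric_on {0..dist x y} c \<and> c 0 = x \<and> c (dist x y) = y"

lemma isometric_onD: "isometric_on S c \<Longrightarrow> s \<in> S \<Longrightarrow> t \<in> S \<Longrightarrow> dist (c s) (c t) = dist s t"
  by (auto simp: isometric_on_def)

lemma isometric_on_subset: "isometric_on S c \<Longrightarrow> T \<subseteq> S \<Longrightarrow> isometric_on T c"
  by (auto simp: isometric_on_def)

lemma geodesic_between_exists:
  fixes x y :: "'a::cat0_space"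
  obtains c where "geodesic_between x y c"
  using geodesic_segment_exists[of x y] by (auto simp: geodesic_between_def)

lemma geodesic_between_dist:
  assumes "geodesic_between x y c" "0 \<le> s" "s \<le> dist x y" "0 \<le> t" "t \<le> dist x y"
  shows "dist (c s) (c t) = \<bar>s - t\<bar>"
  using assms by (auto simp: geodesic_between_def isometric_on_def dist_real_def)

lemma geodesic_between_dist_left:
  assumes "geodesic_between x y c" "0 \<le> t" "t \<le> dist x y"
  shows "dist x (c t) = t"
  using geodesic_between_dist[OF assms(1), of 0 t] assms by (auto simp: geodesic_between_def)

lemma geodesic_between_dist_right:
  assumes "geodesic_between x y c" "0 \<le> t" "t \<le> dist x y"
  shows "dist (c t) y = dist x y - t"
  using geodesic_between_dist[OF assms(1), of t "dist x y"] assms by (auto simp: geodesic_between_def)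

lemma geodesic_between_ends:
  assumes "geodesic_between x y c"
  shows "c 0 = x" "c (dist x y) = y"
  using assms by (auto simp: geodesic_between_def)

lemma geodesic_between_segment:
  assumes "isometric_on S c" "{s..t} \<subseteq> S" "s \<le> t"
  shows "geodesic_between (c s) (c t) (\<lambda>u. c (s + u))"
proof -
  have d: "dist (c s) (c t) = t - s"
    using assms isometric_onD[OF assms(1), of s t] by (auto simp: dist_real_def subset_iff)
  have "isometric_on {0..t - s} (\<lambda>u. c (s + u))"
    using assms by (auto simp: isometric_on_def subset_iff dist_real_def)
  then show ?thesis
    unfolding geodesic_between_def d by simp
qed

lemma geodesic_between_reverse:
  assumes "geodesic_between x y c"
  shows "geodesic_between y x (\<lambda>t. c (dist x y - t))"
  using assms by (auto simp: geodesic_between_def isometric_on_def dist_commute dist_real_def)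

lemma geodesic_between_convex:
  assumes "geodesically_convex C" "geodesic_between x y c" "x \<in> C" "y \<in> C" "0 \<le> t" "t \<le> dist x y"
  shows "c t \<in> C"
  using assms unfolding geodesically_convex_def geodesic_between_def
  by (metis atLeastAtMost_iff image_subset_iff zero_le_dist)

text \<open>With a, b the sides at \<open>p\<close> and e the opposite side, the comparison angle at
  \<open>p\<close> has cosine (a^2 + b^2 - e^2) / (2 a b). Multiplying by a b avoids the division;
  in a degenerate triangle \<open>s\<close> or \<open>t\<close> is 0 and so are both sides.\<close>

lemma comparison_formula:
  fixes p q r :: "'a::cat0_space"
  assumes c: "geodesic_between p q c" and d: "geodesic_between p r d"
    and s: "0 \<le> s" "s \<le> dist p q" and t: "0 \<le> t" "t \<le> dist p r"
  shows "dist p q * dist p r * (dist (c s) (d t))\<^sup>2 \<le>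
         dist p q * dist p r * (s\<^sup>2 + t\<^sup>2) - s * t * ((dist p q)\<^sup>2 + (dist p r)\<^sup>2 - (dist q r)\<^sup>2)"
proof (cases "dist p q = 0 \<or> dist p r = 0")
  case True
  then show ?thesis using s t by auto
next
  case False
  define a b e where "a = dist p q" and "b = dist p r" and "e = dist q r"
  have pos: "a > 0" "b > 0"
    using False unfolding a_def b_def by auto
  have tri: "e \<le> a + b" "a \<le> b + e" "b \<le> a + e"
    unfolding a_def b_def e_def
    using dist_triangle[of q r p] dist_triangle[of p q r] dist_triangle[of p r q]
    by (auto simp: dist_commute)
  \<comment> \<open>\<open>u\<close> and, below, \<open>v\<close> are the cosine and sine of the
    comparison angle; the triangle inequalities put \<open>u\<close> into [-1, 1].\<close>
  define u where "u = (a\<^sup>2 + b\<^sup>2 - e\<^sup>2) / (2 * a * b)"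
  have "e\<^sup>2 \<le> (a + b)\<^sup>2"
    using tri by (intro power_mono) (auto simp: e_def)
  then have "-1 \<le> u"
    using pos unfolding u_def by (simp add: field_simps power2_eq_square)
  moreover have "\<bar>a - b\<bar>\<^sup>2 \<le> e\<^sup>2"
    using tri by (intro power_mono) auto
  then have "u \<le> 1"
    using pos unfolding u_def by (simp add: field_simps power2_eq_square)
  ultimately have u: "u\<^sup>2 \<le> 1"
    by (simp add: abs_square_le_1 abs_le_iff)
  define v where "v = sqrt (1 - u\<^sup>2)"
  have uv: "u\<^sup>2 + v\<^sup>2 = 1"
    unfolding v_def using u by simp
  define V :: "real \<Rightarrow> real \<Rightarrow> real ^ 2" where "V = (\<lambda>x y. vector [x, y])"
  have dV: "dist (V x y) (V x' y') = sqrt ((x - x')\<^sup>2 + (y - y')\<^sup>2)" for x y x' y'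
    unfolding V_def dist_vec_def L2_set_def by (simp add: sum_2 dist_real_def)
  have abu: "2 * a * b * u = a\<^sup>2 + b\<^sup>2 - e\<^sup>2"
    unfolding u_def using pos by simp
  have scale: "(x * u - 0)\<^sup>2 + (x * v - 0)\<^sup>2 = x\<^sup>2" for x
    using uv by (simp add: power_mult_distrib flip: distrib_left)
  have law: "(x - y * u)\<^sup>2 + (0 - y * v)\<^sup>2 = x\<^sup>2 + y\<^sup>2 - 2 * x * y * u" for x y
  proof -
    have "(x - y * u)\<^sup>2 + (0 - y * v)\<^sup>2 = x\<^sup>2 + y\<^sup>2 * (u\<^sup>2 + v\<^sup>2) - 2 * x * y * u"
      by (simp add: power2_eq_square algebra_simps)
    then show ?thesis using uv by simp
  qed
  have seg1: "V s 0 \<in> closed_segment (V 0 0) (V a 0)"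
  proof -
    have "V s 0 = (1 - s / a) *\<^sub>R V 0 0 + (s / a) *\<^sub>R V a 0"
      unfolding V_def using pos by (simp add: vec_eq_iff forall_2)
    then show ?thesis
      unfolding in_segment using s pos by (intro exI[of _ "s / a"]) (auto simp: a_def)
  qed
  have seg2: "V (t * u) (t * v) \<in> closed_segment (V 0 0) (V (b * u) (b * v))"
  proof -
    have "V (t * u) (t * v) = (1 - t / b) *\<^sub>R V 0 0 + (t / b) *\<^sub>R V (b * u) (b * v)"
      unfolding V_def using pos by (simp add: vec_eq_iff forall_2)
    then show ?thesis
      unfolding in_segment using t pos by (intro exI[of _ "t / b"]) (auto simp: b_def)
  qed
  have "dist (V 0 0) (V (x * u) (x * v)) = \<bar>x\<bar>" for x
    using scale[of x] unfolding dV by (simp add: power2_eq_square)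
  note norm2 = this
  have e2: "dist (V a 0) (V (b * u) (b * v)) = e"
    unfolding dV law using abu by (simp add: e_def)
  have "dist (c s) (d t) \<le> dist (V s 0) (V (t * u) (t * v))"
    by (rule cat0_comparison[of p q c r d "V 0 0" "V a 0" "V (b * u) (b * v)" s _ t])
       (use c d s t pos seg1 seg2 norm2 e2 in
         \<open>auto simp: geodesic_between_def a_def[symmetric] b_def[symmetric] e_def[symmetric]
            dV[of 0 0 _ 0]\<close>)
  then have "(dist (c s) (d t))\<^sup>2 \<le> (dist (V s 0) (V (t * u) (t * v)))\<^sup>2"
    by (intro power_mono) auto
  also have "\<dots> = s\<^sup>2 + t\<^sup>2 - 2 * s * t * u"
  proof -
    have "0 \<le> (s - t * u)\<^sup>2 + (0 - t * v)\<^sup>2" by simp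
    then show ?thesis unfolding dV law by simp
  qed
  finally have "a * b * (dist (c s) (d t))\<^sup>2 \<le> a * b * (s\<^sup>2 + t\<^sup>2 - 2 * s * t * u)"
    using pos by (intro mult_left_mono) auto
  also have "\<dots> = a * b * (s\<^sup>2 + t\<^sup>2) - s * t * (2 * a * b * u)"
    by (simp add: algebra_simps)
  finally show ?thesis
    unfolding abu by (simp add: a_def b_def e_def)
qed

text \<open>Stewart's theorem, with an inequality.\<close>

lemma cat0_stewart:
  fixes x u v :: "'a::cat0_space"
  assumes c: "geodesic_between u v c" and t: "0 \<le> t" "t \<le> dist u v"
  shows "dist u v * (dist x (c t))\<^sup>2 \<le>
         (dist u v - t) * (dist x u)\<^sup>2 + t * (dist x v)\<^sup>2 - t * (dist u v - t) * dist u v"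
proof (cases "x = u")
  case True
  then show ?thesis
    using geodesic_between_dist_left[OF c t] by (simp add: power2_eq_square algebra_simps)
next
  case False
  obtain d where d: "geodesic_between u x d" by (rule geodesic_between_exists)
  let ?a = "dist u x" let ?L = "dist u v"
  have pos: "?a > 0" using False by simp
  have "?a * ?L * (dist x (c t))\<^sup>2 \<le> ?a * ?L * (?a\<^sup>2 + t\<^sup>2) - ?a * t * (?a\<^sup>2 + ?L\<^sup>2 - (dist x v)\<^sup>2)"
    using comparison_formula[OF d c, of ?a t] t d by (simp add: geodesic_between_def)
  also have "\<dots> = ?a * (?L * (?a\<^sup>2 + t\<^sup>2) - t * (?a\<^sup>2 + ?L\<^sup>2 - (dist x v)\<^sup>2))"
    by (simp add: algebra_simps)
  finally have "?L * (dist x (c t))\<^sup>2 \<le> ?L * (?a\<^sup>2 + t\<^sup>2) - t * (?a\<^sup>2 + ?L\<^sup>2 - (dist x v)\<^sup>2)"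
    using pos by (simp add: mult.assoc)
  then show ?thesis
    by (simp add: dist_commute[of x u] power2_eq_square algebra_simps)
qed

text \<open>In the plane equality holds by similarity of triangles; at proportional parameters the
  comparison formula collapses to it.\<close>

lemma fan_contraction:
  fixes p q r :: "'a::cat0_space"
  assumes c: "geodesic_between p q c" and d: "geodesic_between p r d"
    and l: "0 \<le> l" "l \<le> 1"
  shows "dist (c (l * dist p q)) (d (l * dist p r)) \<le> l * dist q r"
proof (cases "p = q \<or> p = r")
  case True
  then show ?thesis
  proof
    assume "p = q"
    then show ?thesis
      using geodesic_between_dist_left[OF d, of "l * dist p r"] geodesic_between_ends[OF c] l
      by (auto simp: mult_left_le_one_le)
  next
    assume "p = r"
    then show ?thesis
      using geodesic_between_dist_left[OF c, of "l * dist p q"] geodesic_between_ends[OF d] l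
      by (auto simp: mult_left_le_one_le dist_commute)
  qed
next
  case False
  let ?a = "dist p q" let ?b = "dist p r" let ?D = "dist (c (l * ?a)) (d (l * ?b))"
  have "?a * ?b * ?D\<^sup>2 \<le> ?a * ?b * ((l * ?a)\<^sup>2 + (l * ?b)\<^sup>2)
      - (l * ?a) * (l * ?b) * (?a\<^sup>2 + ?b\<^sup>2 - (dist q r)\<^sup>2)"
    using l by (intro comparison_formula[OF c d]) (auto simp: mult_left_le_one_le)
  also have "\<dots> = ?a * ?b * (l * dist q r)\<^sup>2"
    by (simp add: power2_eq_square algebra_simps)
  finally have "?D\<^sup>2 \<le> (l * dist q r)\<^sup>2"
    using False by (simp add: mult_le_cancel_left)
  then show ?thesis
    using l by (simp add: power2_le_iff_abs_le)
qed

text \<open>The diagonal from \<open>x\<close> to \<open>y'\<close> cuts the quadrilateral into two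
  triangles, each of which is a fan.\<close>

lemma cat0_convexity:
  fixes x y x' y' :: "'a::cat0_space"
  assumes c: "geodesic_between x y c" and d: "geodesic_between x' y' d"
    and l: "0 \<le> l" "l \<le> 1"
  shows "dist (c (l * dist x y)) (d (l * dist x' y')) \<le> (1 - l) * dist x x' + l * dist y y'"
proof -
  obtain e where e: "geodesic_between x y' e" by (rule geodesic_between_exists)
  have "dist (c (l * dist x y)) (e (l * dist x y')) \<le> l * dist y y'"
    by (rule fan_contraction[OF c e l])
  moreover have "dist (e (l * dist x y')) (d (l * dist x' y')) \<le> (1 - l) * dist x x'"
    using fan_contraction[OF geodesic_between_reverse[OF e] geodesic_between_reverse[OF d], of "1 - l"] l
    by (simp add: algebra_simps dist_commute)
  ultimately show ?thesis
    using dist_triangle[of "c (l * dist x y)" "d (l * dist x' y')" "e (l * dist x y')"] by linarith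
qed

text \<open>The factor \<open>2\<close> pays for unit speed instead of speed proportional to length.\<close>

lemma geodesics_fellow_travel:
  fixes x y x' y' :: "'a::cat0_space"
  assumes c: "geodesic_between x y c" and d: "geodesic_between x' y' d"
    and t: "0 \<le> t" "t \<le> dist x y" "t \<le> dist x' y'"
  shows "dist (c t) (d t) \<le> 2 * (dist x x' + dist y y')"
proof (cases "dist x y = 0")
  case True
  then have "t = 0" using t by simp
  then show ?thesis
    using geodesic_between_ends[OF c] geodesic_between_ends[OF d] zero_le_dist[of y y'] by auto
next
  case False
  let ?l = "dist x y" let ?m = "dist x' y'"
  have pos: "?l > 0" using False by simp
  \<comment> \<open>The point of \<open>d\<close> at the same proportion \<open>k\<close> is
    controlled by convexity; moving from there to time \<open>t\<close> costs at most the difference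
    of the lengths.\<close>
  define k where "k = t / ?l"
  have k: "0 \<le> k" "k \<le> 1" "k * ?l = t"
    using t pos by (auto simp: k_def)
  have lm: "\<bar>?l - ?m\<bar> \<le> dist x x' + dist y y'"
    using dist_triangle[of x y x'] dist_triangle[of x' y y'] dist_triangle[of x' y' x]
      dist_triangle[of x y' y] by (simp add: dist_commute abs_le_iff)
  have 1: "dist (c t) (d (k * ?m)) \<le> (1 - k) * dist x x' + k * dist y y'"
    using cat0_convexity[OF c d k(1,2)] k(3) by simp
  have 2: "(1 - k) * dist x x' + k * dist y y' \<le> dist x x' + dist y y'"
    using k by (intro add_mono mult_left_le_one_le) auto
  have "dist (d (k * ?m)) (d t) = \<bar>k * ?m - t\<bar>"
    using k t by (intro geodesic_between_dist[OF d]) (auto simp: mult_left_le_one_le)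
  also have "\<dots> = k * \<bar>?l - ?m\<bar>"
  proof -
    have "k * ?m - t = k * (?m - ?l)" using k(3) by (simp add: algebra_simps)
    then show ?thesis using k by (simp add: abs_mult abs_minus_commute)
  qed
  also have "\<dots> \<le> \<bar>?l - ?m\<bar>" using k by (simp add: mult_left_le_one_le)
  finally have "dist (d (k * ?m)) (d t) \<le> dist x x' + dist y y'"
    using lm by (rule order_trans)
  moreover note order_trans[OF 1 2] dist_triangle[of "c t" "d t" "d (k * ?m)"]
  ultimately show ?thesis by simp
qed

text \<open>A common starting point saves the factor 2: the formula leaves t^2 (e^2 - (a - b)^2),
  and t^2 \<le> a b.\<close>

lemma fan_unit_speed:
  fixes p q r :: "'a::cat0_space"
  assumes c: "geodesic_between p q c" and d: "geodesic_between p r d"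
    and t: "0 \<le> t" "t \<le> dist p q" "t \<le> dist p r"
  shows "dist (c t) (d t) \<le> dist q r"
proof (cases "dist p q = 0 \<or> dist p r = 0")
  case True
  then have "t = 0" using t by auto
  then show ?thesis using geodesic_between_ends[OF c] geodesic_between_ends[OF d] by simp
next
  case False
  let ?a = "dist p q" let ?b = "dist p r" let ?e = "dist q r"
  have pos: "?a > 0" "?b > 0" using False by auto
  have "?a * ?b * (dist (c t) (d t))\<^sup>2 \<le> ?a * ?b * (t\<^sup>2 + t\<^sup>2) - t * t * (?a\<^sup>2 + ?b\<^sup>2 - ?e\<^sup>2)"
    by (rule comparison_formula[OF c d]) (use t in auto)
  also have "\<dots> = t * t * (?e\<^sup>2 - (?a - ?b)\<^sup>2)"
    by (simp add: power2_eq_square algebra_simps)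
  also have "\<dots> \<le> t * t * ?e\<^sup>2"
    by (intro mult_left_mono) auto
  also have "\<dots> \<le> ?a * ?b * ?e\<^sup>2"
    using t by (intro mult_right_mono mult_mono) auto
  finally have "(dist (c t) (d t))\<^sup>2 \<le> ?e\<^sup>2"
    using pos by (simp add: mult_le_cancel_left)
  then show ?thesis by (simp add: power2_le_iff_abs_le)
qed

text \<open>\<open>c r\<close> is the point nearest to \<open>q\<close> in the ball of radius
  \<open>r\<close> around \<open>p\<close>, so passing to it cannot increase the distance to a point
  \<open>v\<close> of that ball. The proof is Stewart's inequality at \<open>v\<close>.\<close>

lemma radial_projection:
  fixes p q v :: "'a::cat0_space"
  assumes c: "geodesic_between p q c" and r: "0 \<le> r" "r \<le> dist p q" and v: "dist p v \<le> r"
  shows "dist (c r) v \<le> dist q v"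
proof (cases "dist p q = 0")
  case True
  then show ?thesis using geodesic_between_ends[OF c] r by auto
next
  case False
  let ?L = "dist p q" let ?b = "dist p v"
  have pos: "?L > 0" using False by simp
  have "?L * (dist v (c r))\<^sup>2 \<le> (?L - r) * ?b\<^sup>2 + r * (dist v q)\<^sup>2 - r * (?L - r) * ?L"
    using cat0_stewart[OF c r, of v] by (simp add: dist_commute)
  also have "(?L - r) * ?b\<^sup>2 \<le> (?L - r) * (r * r)"
    using r v by (intro mult_left_mono) (auto simp: power2_eq_square intro!: mult_mono)
  finally have 1: "?L * (dist v (c r))\<^sup>2 \<le> r * (dist v q)\<^sup>2 - r * (?L - r) * (?L - r)"
    by (simp add: algebra_simps)
  have 2: "0 \<le> r * (?L - r) * (?L - r)" using r by simp
  have 3: "r * (dist v q)\<^sup>2 \<le> ?L * (dist v q)\<^sup>2" using r by (intro mult_right_mono) auto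
  have "?L * (dist v (c r))\<^sup>2 \<le> ?L * (dist v q)\<^sup>2"
    using 1 2 3 by linarith
  then have "(dist v (c r))\<^sup>2 \<le> (dist v q)\<^sup>2" using pos by simp
  then show ?thesis by (simp add: power2_le_iff_abs_le dist_commute)
qed

text \<open>Berg and Nikolaev: cut the diagonal \<open>[x,w]\<close> in the ratio of the sides \<open>[x,y]\<close> and \<open>[z,w]\<close>.\<close>

lemma quadrilateral_inequality:
  fixes x y z w :: "'a::cat0_space"
  shows "(dist x w)\<^sup>2 + (dist y z)\<^sup>2 \<le> (dist x z)\<^sup>2 + (dist y w)\<^sup>2 + 2 * dist z w * dist x y"
proof -
  consider "x = y" | "z = w" | "x = w" | "x \<noteq> y" "z \<noteq> w" "x \<noteq> w" by blast
  then show ?thesis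
  proof cases
    case 1 then show ?thesis by simp
  next
    case 2 then show ?thesis by simp
  next
    case 3
    have "(dist y z)\<^sup>2 \<le> (dist y w + dist w z)\<^sup>2"
      by (intro power_mono dist_triangle) auto
    then show ?thesis using 3 by (simp add: power2_eq_square algebra_simps dist_commute)
  next
    case 4
    define a b L where "a = dist z w" and "b = dist x y" and "L = dist x w"
    have pos: "a > 0" "b > 0" "L > 0" using 4 by (auto simp: a_def b_def L_def)
    obtain c where c: "geodesic_between x w c" by (rule geodesic_between_exists)
    \<comment> \<open>This ratio makes \<open>a * k\<close> and \<open>b * (1 - k)\<close> equal, so
      their squares add up to k (1 - k) 2 a b.\<close>
    define k where "k = b / (a + b)"
    have k: "0 < k" "k < 1" "a * k = b * (1 - k)"
      using pos by (auto simp: k_def field_simps)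
    have kL: "0 \<le> k * L" "k * L \<le> dist x w"
      using k pos by (auto simp: L_def[symmetric])
    define e where "e = c (k * L)"
    have st: "(dist v e)\<^sup>2 \<le> (1 - k) * (dist v x)\<^sup>2 + k * (dist v w)\<^sup>2 - k * (1 - k) * L\<^sup>2" for v
    proof -
      have "L * (dist v e)\<^sup>2 \<le> (L - k * L) * (dist v x)\<^sup>2 + k * L * (dist v w)\<^sup>2 - k * L * (L - k * L) * L"
        using cat0_stewart[OF c kL, of v] by (simp add: e_def L_def[symmetric])
      also have "\<dots> = L * ((1 - k) * (dist v x)\<^sup>2 + k * (dist v w)\<^sup>2 - k * (1 - k) * L\<^sup>2)"
        by (simp add: power2_eq_square algebra_simps)
      finally show ?thesis using pos by simp
    qed
    define A B where "A = dist z e" and "B = dist y e"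
    \<comment> \<open>A weighted Cauchy--Schwarz inequality; the difference of the two sides is a
      square.\<close>
    have sq: "k * (1 - k) * (A + B)\<^sup>2 \<le> k * A\<^sup>2 + (1 - k) * B\<^sup>2"
    proof -
      have "k * A\<^sup>2 + (1 - k) * B\<^sup>2 - k * (1 - k) * (A + B)\<^sup>2 = (k * A - (1 - k) * B)\<^sup>2"
        by (simp add: power2_eq_square algebra_simps)
      then show ?thesis by (smt (verit) zero_le_power2)
    qed
    have "(dist y z)\<^sup>2 \<le> (A + B)\<^sup>2"
      unfolding A_def B_def using dist_triangle[of y z e]
      by (intro power_mono) (auto simp: dist_commute)
    then have "k * (1 - k) * (dist y z)\<^sup>2 \<le> k * (1 - k) * (A + B)\<^sup>2"
      using k by (intro mult_left_mono) auto
    also have "\<dots> \<le> k * A\<^sup>2 + (1 - k) * B\<^sup>2" by (rule sq)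
    also have "\<dots> \<le> k * ((1 - k) * (dist z x)\<^sup>2 + k * a\<^sup>2 - k * (1 - k) * L\<^sup>2)
        + (1 - k) * ((1 - k) * b\<^sup>2 + k * (dist y w)\<^sup>2 - k * (1 - k) * L\<^sup>2)"
      using st[of z] st[of y] k
      by (intro add_mono mult_left_mono) (auto simp: A_def B_def a_def b_def dist_commute)
    also have "\<dots> = k * (1 - k) * ((dist x z)\<^sup>2 + (dist y w)\<^sup>2 - L\<^sup>2) + ((a * k)\<^sup>2 + (b * (1 - k))\<^sup>2)"
      by (simp add: power2_eq_square algebra_simps dist_commute)
    also have "(a * k)\<^sup>2 + (b * (1 - k))\<^sup>2 = k * (1 - k) * (2 * a * b)"
      using k(3) by (simp add: power2_eq_square) (simp add: algebra_simps)
    finally have "k * (1 - k) * (dist y z)\<^sup>2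
        \<le> k * (1 - k) * ((dist x z)\<^sup>2 + (dist y w)\<^sup>2 - L\<^sup>2 + 2 * a * b)"
      unfolding distrib_left[of "k * (1 - k)" _ "2 * a * b"] by simp
    then have "(dist y z)\<^sup>2 \<le> (dist x z)\<^sup>2 + (dist y w)\<^sup>2 - L\<^sup>2 + 2 * a * b"
      using k by simp
    then show ?thesis by (simp add: a_def b_def L_def)
  qed
qed


section \<open>Projection to a closed convex set\<close>

text \<open>If \<open>u\<close> is the point of the geodesic \<open>[u,v]\<close> nearest to \<open>x\<close>, the angle at \<open>u\<close> is not acute.\<close>

lemma obtuse_at_nearest_point:
  fixes x u v :: "'a::cat0_space"
  assumes c: "geodesic_between u v c"
    and near: "\<And>t. 0 \<le> t \<Longrightarrow> t \<le> dist u v \<Longrightarrow> dist x u \<le> dist x (c t)"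
  shows "(dist x u)\<^sup>2 + (dist u v)\<^sup>2 \<le> (dist x v)\<^sup>2"
proof (rule ccontr)
  let ?L = "dist u v"
  define g where "g = (dist x u)\<^sup>2 + ?L\<^sup>2 - (dist x v)\<^sup>2"
  assume "\<not> ?thesis"
  then have g: "g > 0" by (simp add: g_def)
  then have L: "?L > 0" by (cases "u = v") (auto simp: g_def)
  \<comment> \<open>Moving by \<open>t\<close> from \<open>u\<close> towards \<open>v\<close> brings
    the point closer to \<open>x\<close> while t L < g, the gain being linear and the loss quadratic
    in \<open>t\<close>. Half of g / L makes the inequality strict.\<close>
  define t where "t = min ?L (g / (2 * ?L))"
  have t: "0 < t" "t \<le> ?L" using g L by (auto simp: t_def)
  have "t * ?L \<le> g / (2 * ?L) * ?L" using L by (intro mult_right_mono) (auto simp: t_def)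
  also have "\<dots> < g" using g L by simp
  finally have tL: "t * ?L < g" .
  have "(dist x u)\<^sup>2 \<le> (dist x (c t))\<^sup>2"
    using near[of t] t by (intro power_mono) auto
  then have "?L * (dist x u)\<^sup>2 \<le> ?L * (dist x (c t))\<^sup>2"
    by (intro mult_left_mono) auto
  also have "\<dots> \<le> (?L - t) * (dist x u)\<^sup>2 + t * (dist x v)\<^sup>2 - t * (?L - t) * ?L"
    using t by (intro cat0_stewart[OF c]) auto
  finally have "t * (g - t * ?L) \<le> 0"
    by (simp add: g_def power2_eq_square algebra_simps)
  then show False using t tL by (simp add: mult_le_0_iff)
qed

lemma ball_convex_on_geodesic:
  fixes x u v :: "'a::cat0_space"
  assumes c: "geodesic_between u v c" and t: "0 \<le> t" "t \<le> dist u v"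
    and r: "dist x u \<le> r" "dist x v \<le> r"
  shows "dist x (c t) \<le> r"
proof (cases "dist u v = 0")
  case True
  then show ?thesis using geodesic_between_ends[OF c] r t by auto
next
  case False
  let ?L = "dist u v"
  have r0: "0 \<le> r" using r(1) zero_le_dist[of x u] by linarith
  have "?L * (dist x (c t))\<^sup>2 \<le> (?L - t) * (dist x u)\<^sup>2 + t * (dist x v)\<^sup>2 - t * (?L - t) * ?L"
    by (rule cat0_stewart[OF c t])
  also have "\<dots> \<le> (?L - t) * r\<^sup>2 + t * r\<^sup>2 - 0"
    using t r by (intro diff_mono add_mono mult_left_mono power_mono) auto
  also have "\<dots> = ?L * r\<^sup>2" by (simp add: algebra_simps)
  finally have "(dist x (c t))\<^sup>2 \<le> r\<^sup>2" using False by simp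
  then show ?thesis using r0 by (simp add: power2_le_iff_abs_le)
qed

definition nearest :: "'a::metric_space set \<Rightarrow> 'a \<Rightarrow> 'a" where
  "nearest C x = (SOME z. z \<in> C \<and> dist x z = infdist x C)"

locale closed_convex =
  fixes C :: "'a::{heine_borel, cat0_space} set"
  assumes closed_C: "closed C" and nonempty_C: "C \<noteq> {}" and convex_C: "geodesically_convex C"
begin

abbreviation proj :: "'a \<Rightarrow> 'a" where "proj \<equiv> nearest C"
abbreviation height :: "'a \<Rightarrow> real" where "height x \<equiv> infdist x C"

lemma proj_in: "proj x \<in> C" and dist_proj: "dist x (proj x) = height x"
proof -
  obtain z where "z \<in> C" "height x = dist x z"
    using infdist_attains_inf[OF closed_C nonempty_C] by blast
  then have "\<exists>z. z \<in> C \<and> dist x z = height x" by auto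
  then have "proj x \<in> C \<and> dist x (proj x) = height x"
    unfolding nearest_def by (rule someI_ex)
  then show "proj x \<in> C" "dist x (proj x) = height x" by auto
qed

lemma height_lipschitz: "height x \<le> height y + dist x y"
  using infdist_triangle[of x C y] by simp

lemma height_le_dist: "v \<in> C \<Longrightarrow> height x \<le> dist x v"
  by (rule infdist_le)

lemma proj_obtuse:
  assumes "v \<in> C"
  shows "(height x)\<^sup>2 + (dist (proj x) v)\<^sup>2 \<le> (dist x v)\<^sup>2"
proof -
  obtain c where c: "geodesic_between (proj x) v c" by (rule geodesic_between_exists)
  show ?thesis
    using obtuse_at_nearest_point[OF c, of x]
      height_le_dist[OF geodesic_between_convex[OF convex_C c proj_in assms]]
    by (simp add: dist_proj)
qed

lemma proj_unique:
  assumes "v \<in> C" "dist x v = height x"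
  shows "proj x = v"
  using proj_obtuse[OF assms(1), of x] assms(2) by simp

text \<open>Add the inequalities for the obtuse angles at the two feet and compare with the
  quadrilateral inequality: the squared heights cancel, and M^2 \<le> M dist x y is left.\<close>

lemma proj_lipschitz: "dist (proj x) (proj y) \<le> dist x y"
proof -
  let ?M = "dist (proj x) (proj y)"
  have "(height x)\<^sup>2 + ?M\<^sup>2 \<le> (dist x (proj y))\<^sup>2" "(height y)\<^sup>2 + ?M\<^sup>2 \<le> (dist y (proj x))\<^sup>2"
    using proj_obtuse[OF proj_in, of x y] proj_obtuse[OF proj_in, of y x]
    by (auto simp: dist_commute)
  moreover have "(dist x (proj y))\<^sup>2 + (dist y (proj x))\<^sup>2
      \<le> (height x)\<^sup>2 + (height y)\<^sup>2 + 2 * ?M * dist x y"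
    using quadrilateral_inequality[of x "proj y" y "proj x"] by (simp add: dist_proj)
  ultimately have "?M * ?M \<le> ?M * dist x y"
    by (simp add: power2_eq_square)
  then show ?thesis by (cases "?M = 0") (auto simp: mult_le_cancel_left)
qed

lemma continuous_on_proj: "continuous_on S proj"
  unfolding continuous_on_iff using proj_lipschitz by (metis le_less_trans)

text \<open>Convexity of the metric, compared with the geodesic joining the two feet, which stays in
  \<open>C\<close>.\<close>

lemma height_convex:
  assumes c: "geodesic_between x y c" and l: "0 \<le> l" "l \<le> 1"
  shows "height (c (l * dist x y)) \<le> (1 - l) * height x + l * height y"
proof -
  obtain e where e: "geodesic_between (proj x) (proj y) e" by (rule geodesic_between_exists)
  have "e (l * dist (proj x) (proj y)) \<in> C"
    using l by (intro geodesic_between_convex[OF convex_C e proj_in proj_in])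
      (auto simp: mult_left_le_one_le)
  then have "height (c (l * dist x y)) \<le> dist (c (l * dist x y)) (e (l * dist (proj x) (proj y)))"
    by (rule height_le_dist)
  also have "\<dots> \<le> (1 - l) * height x + l * height y"
    using cat0_convexity[OF c e l] by (simp add: dist_proj)
  finally show ?thesis .
qed

lemma height_bounded_on_geodesic:
  assumes c: "geodesic_between x y c" and t: "0 \<le> t" "t \<le> dist x y"
    and B: "height x \<le> B" "height y \<le> B"
  shows "height (c t) \<le> B"
proof (cases "dist x y = 0")
  case True
  then show ?thesis using geodesic_between_ends[OF c] t B by auto
next
  case False
  define l where "l = t / dist x y"
  have l: "0 \<le> l" "l \<le> 1" "l * dist x y = t"
    using t False by (auto simp: l_def)
  have "height (c t) \<le> (1 - l) * height x + l * height y"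
    using height_convex[OF c l(1,2)] l(3) by simp
  also have "\<dots> \<le> (1 - l) * B + l * B"
    using l B by (intro add_mono mult_left_mono) auto
  finally show ?thesis by (simp add: algebra_simps)
qed

end


section \<open>Contraction by a Morse convex set\<close>

text \<open>The pair (4, 0) is dictated by the broken path in
  \<open>geodesic_to_set_near_proj\<close>, where the worst pairs of points lie on the first and the
  last piece.\<close>

locale morse_convex = closed_convex +
  fixes D :: real
  assumes D_pos: "D > 0"
    and morse: "\<And>a b f. a \<le> b \<Longrightarrow> quasi_geodesic 4 0 a b f \<Longrightarrow> f a \<in> C \<Longrightarrow> f b \<in> C \<Longrightarrow>
                  f ` {a..b} \<subseteq> nbhd D C"
begin

lemma quasi_geodesic_4I:
  fixes f :: "real \<Rightarrow> 'a"
  assumes "\<And>s t. a \<le> s \<Longrightarrow> s \<le> t \<Longrightarrow> t \<le> b \<Longrightarrow>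
             t - s \<le> 4 * dist (f s) (f t) \<and> dist (f s) (f t) \<le> t - s"
  shows "quasi_geodesic 4 0 a b f"
  unfolding quasi_geodesic_def
proof (intro ballI)
  fix s t assume st: "s \<in> {a..b}" "t \<in> {a..b}"
  show "\<bar>s - t\<bar> / 4 - 0 \<le> dist (f s) (f t) \<and> dist (f s) (f t) \<le> 4 * \<bar>s - t\<bar> + 0"
  proof (cases "s \<le> t")
    case True
    then show ?thesis using assms[of s t] st by auto
  next
    case False
    then show ?thesis using assms[of t s] st by (auto simp: dist_commute)
  qed
qed

text \<open>Follow the geodesic from the projection of \<open>x\<close> towards \<open>x\<close> for a length \<open>D\<close>, move along a chord
  of the ball of radius \<open>height x - D\<close> around \<open>x\<close>, then move away from \<open>x\<close> towards \<open>y\<close>.  Unless the chord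
  is shorter than \<open>D\<close> this is a quasi-geodesic, by radial projection to that ball, and it leaves the
  \<open>D\<close>-neighbourhood of \<open>C\<close>.\<close>

lemma geodesic_to_set_near_proj:
  assumes c: "geodesic_between x y c" and y: "y \<in> C"
  shows "dist (proj x) (c (max (height x - D) 0)) \<le> 2 * D"
proof (cases "height x \<le> D")
  case True
  then show ?thesis
    using dist_proj[of x] geodesic_between_ends[OF c] D_pos by (simp add: dist_commute)
next
  case False
  define R L where "R = height x" and "L = dist x y"
  have R: "R > D" "R \<le> L" using False height_le_dist[OF y, of x] by (auto simp: R_def L_def)
  define z where "z = proj x"
  have xz: "dist x z = R" "z \<in> C" by (auto simp: z_def R_def dist_proj proj_in)
  obtain g where g: "geodesic_between x z g" by (rule geodesic_between_exists)
  define xs w where "xs = g (R - D)" and "w = c (R - D)"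
  define A where "A = dist xs w"
  obtain k where k: "geodesic_between xs w k" by (rule geodesic_between_exists)
  have dg: "dist (g s) (g t) = \<bar>s - t\<bar>" if "0 \<le> s" "s \<le> R" "0 \<le> t" "t \<le> R" for s t
    using geodesic_between_dist[OF g] that xz by simp
  have dk: "dist (k s) (k t) = \<bar>s - t\<bar>" if "0 \<le> s" "s \<le> A" "0 \<le> t" "t \<le> A" for s t
    using geodesic_between_dist[OF k] that by (simp add: A_def)
  have dc: "dist (c s) (c t) = \<bar>s - t\<bar>" if "0 \<le> s" "s \<le> L" "0 \<le> t" "t \<le> L" for s t
    using geodesic_between_dist[OF c] that by (simp add: L_def)
  have xg: "dist x (g t) = t" if "0 \<le> t" "t \<le> R" for t
    using geodesic_between_dist_left[OF g] that xz by simp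
  have xc: "dist x (c t) = t" if "0 \<le> t" "t \<le> L" for t
    using geodesic_between_dist_left[OF c] that by (simp add: L_def)
  have xk: "dist x (k t) \<le> R - D" if "0 \<le> t" "t \<le> A" for t
    using that R xg[of "R - D"] xc[of "R - D"] D_pos
    by (intro ball_convex_on_geodesic[OF k]) (auto simp: A_def xs_def w_def)
  have k_ends: "k 0 = xs" "k A = w" using geodesic_between_ends[OF k] by (auto simp: A_def)
  have gseg: "geodesic_between x (g t) g" if "0 \<le> t" "t \<le> R" for t
    using geodesic_between_segment[of "{0..R}" g 0 t] g that xz
    by (auto simp: geodesic_between_def)
  have cseg: "geodesic_between x (c t) c" if "0 \<le> t" "t \<le> L" for t
    using geodesic_between_segment[of "{0..L}" c 0 t] c that
    by (auto simp: geodesic_between_def L_def)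
  have "A < D"
  proof (rule ccontr)
    assume "\<not> A < D"
    then have AD: "D \<le> A" by simp
    define b where "b = D + A + (L - (R - D))"
    define f where "f t = (if t \<le> D then g (R - t) else if t \<le> D + A then k (t - D)
                            else c (R - D + (t - D - A)))" for t
    have f1: "f t = g (R - t)" if "t \<le> D" for t using that by (simp add: f_def)
    have f2: "f t = k (t - D)" if "D \<le> t" "t \<le> D + A" for t
      using that k_ends by (cases "t = D") (auto simp: f_def xs_def)
    have f3: "f t = c (R - D + (t - D - A))" if "D + A \<le> t" for t
      using that k_ends AD D_pos by (cases "t = D + A") (auto simp: f_def w_def)
    have qg: "quasi_geodesic 4 0 0 b f"
    proof (rule quasi_geodesic_4I)
      fix s t assume st: "0 \<le> s" "s \<le> t" "t \<le> b"
      consider "t \<le> D" | "s \<le> D" "D \<le> t" "t \<le> D + A" | "s \<le> D" "D + A \<le> t"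
        | "D \<le> s" "t \<le> D + A" | "D \<le> s" "s \<le> D + A" "D + A \<le> t" | "D + A \<le> s"
        by linarith
      then show "t - s \<le> 4 * dist (f s) (f t) \<and> dist (f s) (f t) \<le> t - s"
      proof cases
        case 1
        then show ?thesis using st R dg[of "R - s" "R - t"] by (simp add: f1)
      next
        case 2
        let ?P = "g (R - s)" let ?V = "k (t - D)"
        \<comment> \<open>Comparing distances to \<open>x\<close> bounds the radial leg, and radial
          projection bounds the leg on the chord; together they give the factor 2.\<close>
        have "dist xs ?V \<le> dist ?P ?V"
          unfolding xs_def using 2 st R xg[of "R - s"] xk[of "t - D"]
          by (intro radial_projection[OF gseg[of "R - s"]]) auto
        moreover have "dist xs ?V = t - D" using dk[of 0 "t - D"] 2 k_ends by simp
        moreover have "dist ?P ?V \<ge> D - s"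
          using dist_triangle[of x ?P ?V] xg[of "R - s"] xk[of "t - D"] 2 st R
          by (simp add: dist_commute)
        moreover have "dist ?P ?V \<le> (D - s) + (t - D)"
          using dist_triangle[of ?P ?V xs] dg[of "R - s" "R - D"] 2 st R D_pos
            \<open>dist xs ?V = t - D\<close> by (simp add: xs_def)
        moreover have "f s = ?P" "f t = ?V" using 2 f1[of s] f2[of t] by auto
        ultimately show ?thesis by simp
      next
        case 3
        define u where "u = t - D - A"
        have u: "0 \<le> u" "R - D + u \<le> L" using 3 st by (auto simp: u_def b_def)
        let ?P = "g (R - s)" let ?V = "c (R - D + u)"
        \<comment> \<open>Here the factor 4 is used: D - s \<le> A \<le> dist and u \<le> dist + D
          \<le> 2 dist, so the length (D - s) + A + u is at most 4 dist.\<close>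
        have "A \<le> dist ?P ?V"
          unfolding A_def xs_def w_def
          using 3 st R u D_pos xg[of "R - s"] xc[of "R - D + u"]
          by (intro fan_unit_speed[OF gseg[of "R - s"] cseg[of "R - D + u"]]) auto
        moreover have "dist ?P ?V \<ge> u - D"
          using dist_triangle[of x ?V ?P] xg[of "R - s"] xc[of "R - D + u"] 3 st R u D_pos
          by (simp add: dist_commute)
        moreover have "dist ?P ?V \<le> (D - s) + A + u"
          using dist_triangle[of ?P ?V xs] dist_triangle[of xs ?V w]
            dg[of "R - s" "R - D"] dc[of "R - D" "R - D + u"] 3 st R u D_pos
          by (simp add: xs_def w_def A_def)
        moreover have "f s = ?P" "f t = ?V" using 3 f1[of s] f3[of t] by (auto simp: u_def)
        ultimately show ?thesis using AD st unfolding u_def by simp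
      next
        case 4
        then show ?thesis using st dk[of "s - D" "t - D"] by (simp add: f2)
      next
        case 5
        define u where "u = t - D - A"
        have u: "0 \<le> u" "R - D + u \<le> L" using 5 st by (auto simp: u_def b_def)
        let ?V = "k (s - D)" let ?P = "c (R - D + u)"
        have "dist w ?V \<le> dist ?P ?V"
          unfolding w_def using 5 st R u D_pos xc[of "R - D + u"] xk[of "s - D"]
          by (intro radial_projection[OF cseg[of "R - D + u"]]) auto
        moreover have wV: "dist w ?V = D + A - s" using dk[of A "s - D"] 5 k_ends by simp
        moreover have "dist ?P ?V \<ge> u"
          using dist_triangle[of x ?P ?V] xc[of "R - D + u"] xk[of "s - D"] 5 st R u D_pos
          by (simp add: dist_commute)
        moreover have "dist ?P ?V \<le> (D + A - s) + u"
          using dist_triangle[of ?P ?V w] dc[of "R - D" "R - D + u"] 5 st R u D_pos wV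
          by (simp add: w_def dist_commute)
        moreover have "f s = ?V" "f t = ?P" using 5 f2[of s] f3[of t] by (auto simp: u_def)
        ultimately show ?thesis unfolding u_def by (simp add: dist_commute)
      next
        case 6
        then show ?thesis
          using st R D_pos AD dc[of "R - D + (s - D - A)" "R - D + (t - D - A)"]
          by (simp add: f3 b_def)
      qed
    qed
    have b: "D + A \<le> b" using R D_pos by (simp add: b_def)
    have "f 0 = z" using geodesic_between_ends[OF g] xz D_pos by (simp add: f1)
    moreover have "f b = y" using geodesic_between_ends[OF c] f3[OF b] by (simp add: b_def L_def)
    ultimately have "f ` {0..b} \<subseteq> nbhd D C"
      using morse[OF _ qg] xz y b D_pos AD by simp
    moreover have "f D = xs" by (simp add: f1 xs_def)
    ultimately have "xs \<in> nbhd D C"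
      using b D_pos AD by (force intro: image_eqI[of _ f D])
    then obtain v where v: "v \<in> C" "dist xs v < D" by (auto simp: nbhd_def dist_commute)
    \<comment> \<open>\<open>xs\<close> has distance \<open>R - D\<close> from \<open>x\<close>, so
      a point of \<open>C\<close> at distance less than \<open>D\<close> from it would be nearer to
      \<open>x\<close> than the projection is.\<close>
    have "R \<le> dist x v" unfolding R_def by (rule height_le_dist[OF v(1)])
    then show False
      using v dist_triangle[of x v xs] xg[of "R - D"] R D_pos by (simp add: xs_def)
  qed
  moreover have "dist z xs = D"
    using geodesic_between_dist_right[OF g, of "R - D"] xz R D_pos
    by (simp add: xs_def dist_commute)
  ultimately have "dist z w \<le> 2 * D"
    using dist_triangle[of z w xs] unfolding A_def by simp
  then show ?thesis using R by (simp add: R_def z_def w_def)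
qed

text \<open>A geodesic from \<open>x\<close> into \<open>C\<close> is within \<open>2 * D\<close> of
  \<open>proj x\<close> at time \<open>height x - D\<close> (or 0), so the detour over the foot
  loses at most \<open>2 * D + D\<close>.\<close>

lemma dist_to_set_ge:
  assumes "y \<in> C"
  shows "height x + dist (proj x) y - 3 * D \<le> dist x y"
proof -
  obtain c where c: "geodesic_between x y c" by (rule geodesic_between_exists)
  let ?t = "max (height x - D) 0"
  have t: "0 \<le> ?t" "?t \<le> dist x y" using height_le_dist[OF assms, of x] D_pos by auto
  have "dist (c ?t) y = dist x y - ?t" by (rule geodesic_between_dist_right[OF c t])
  then show ?thesis
    using geodesic_to_set_near_proj[OF c assms] dist_triangle[of "proj x" y "c ?t"] by linarith
qed

text \<open>If the projection moved by \<open>24 * D\<close> while the height stays above its large initial value, the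
  quadrilateral inequality would make \<open>q\<close> and the point of equal height over the new projection
  almost twice the height apart, and Stewart's inequality would make them only about \<open>sqrt 2\<close> times
  the height apart.\<close>

lemma proj_of_rising_geodesic:
  assumes c: "geodesic_between q y c"
    and high: "240 * D \<le> height q"
    and rising: "\<And>t. 0 \<le> t \<Longrightarrow> t \<le> dist q y \<Longrightarrow> height q \<le> height (c t)"
  shows "dist (proj q) (proj y) < 24 * D"
proof (rule ccontr)
  assume far: "\<not> ?thesis"
  have cont_c: "continuous_on {0..dist q y} c"
    unfolding continuous_on_iff
    using isometric_onD[of "{0..dist q y}" c] c unfolding geodesic_between_def by (metis)
  \<comment> \<open>Stopping when the projection has moved by exactly \<open>24 * D\<close> keeps
    the displacement small against the height, which is at least ten times as large.\<close>
  have "\<exists>t\<ge>0. t \<le> dist q y \<and> dist (proj q) (proj (c t)) = 24 * D"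
  proof (rule IVT'[of "\<lambda>t. dist (proj q) (proj (c t))"])
    show "continuous_on {0..dist q y} (\<lambda>t. dist (proj q) (proj (c t)))"
      by (intro continuous_intros continuous_on_compose2[OF continuous_on_proj[of UNIV] cont_c]) auto
  qed (use far geodesic_between_ends[OF c] D_pos in auto)
  then obtain t1 where t1: "0 \<le> t1" "t1 \<le> dist q y" "dist (proj q) (proj (c t1)) = 24 * D"
    by blast
  define y1 a w where "y1 = c t1" and "a = proj q" and "w = proj y1"
  define h f L where "h = height q" and "f = height y1" and "L = dist q y1"
  have c1: "geodesic_between q y1 c"
    using geodesic_between_segment[of "{0..dist q y}" c 0 t1] c t1
    by (auto simp: geodesic_between_def y1_def)
  have L: "L = t1" unfolding L_def y1_def by (rule geodesic_between_dist_left[OF c t1(1,2)])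
  have hf: "h \<le> f" unfolding h_def f_def y1_def by (rule rising[OF t1(1,2)])
  have h: "240 * D \<le> h" "h > 0" using high D_pos by (auto simp: h_def)
  have aw: "dist a w = 24 * D" using t1 by (simp add: a_def w_def y1_def)
  have inC: "a \<in> C" "w \<in> C" by (auto simp: a_def w_def proj_in)
  have qa: "dist q a = h" and y1w: "dist y1 w = f"
    by (auto simp: a_def w_def h_def f_def dist_proj)
  \<comment> \<open>\<open>a\<close> lies in \<open>C\<close> at distance \<open>h\<close> from
    \<open>q\<close>, and heights do not fall below \<open>h\<close>, so \<open>q\<close> is the
    point of the geodesic nearest to \<open>a\<close>.\<close>
  have "(dist a q)\<^sup>2 + L\<^sup>2 \<le> (dist a y1)\<^sup>2"
    unfolding L_def
  proof (rule obtuse_at_nearest_point[OF c1])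
    fix t assume t: "0 \<le> t" "t \<le> dist q y1"
    have "height q \<le> height (c t)" using t t1 L by (intro rising) (auto simp: L_def)
    also have "\<dots> \<le> dist (c t) a" by (rule height_le_dist[OF inC(1)])
    finally show "dist a q \<le> dist a (c t)" using qa by (simp add: h_def dist_commute)
  qed
  moreover have "dist a y1 \<le> f + 24 * D"
    using dist_triangle[of a y1 w] aw y1w by (simp add: dist_commute)
  then have "(dist a y1)\<^sup>2 \<le> (f + 24 * D)\<^sup>2" by (intro power_mono) auto
  ultimately have L2: "L\<^sup>2 \<le> (f + 24 * D)\<^sup>2 - h\<^sup>2" using qa by (simp add: dist_commute)
  obtain g where g: "geodesic_between w y1 g" by (rule geodesic_between_exists)
  have wy1: "dist w y1 = f" using y1w by (simp add: dist_commute)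
  \<comment> \<open>The point over \<open>w\<close> at the height of \<open>q\<close>: now
    \<open>q\<close>, \<open>a\<close>, \<open>w\<close>, \<open>Y\<close> span a quadrilateral with
    two sides \<open>h\<close> and base \<open>24 * D\<close>.\<close>
  define Y where "Y = g h"
  have Yw: "dist Y w = h"
    using geodesic_between_dist_left[OF g, of h] hf h wy1 by (simp add: Y_def dist_commute)
  have Yy1: "dist Y y1 = f - h"
    using geodesic_between_dist_right[OF g, of h] hf h wy1 by (simp add: Y_def)
  have hY: "height Y = h"
    using height_le_dist[OF inC(2), of Y] height_lipschitz[of y1 Y] Yw Yy1
    by (simp add: f_def[symmetric] dist_commute)
  have pY: "proj Y = w" by (rule proj_unique[OF inC(2)]) (simp add: Yw hY)
  have qw: "h + 21 * D \<le> dist q w"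
    using dist_to_set_ge[OF inC(2), of q] aw by (simp add: h_def[symmetric] a_def[symmetric])
  have Ya: "h + 21 * D \<le> dist Y a"
    using dist_to_set_ge[OF inC(1), of Y] aw by (simp add: hY pY dist_commute)
  \<comment> \<open>Each diagonal is at least h + 24 D - 3 D long. As the base is 24 D, the
    quadrilateral inequality gives dist q Y \<ge> (42 / 24) h = (7 / 4) h.\<close>
  have "(h + 21 * D)\<^sup>2 + (h + 21 * D)\<^sup>2 \<le> (dist q w)\<^sup>2 + (dist Y a)\<^sup>2"
    using qw Ya h D_pos by (intro add_mono power_mono) auto
  also have "\<dots> \<le> h\<^sup>2 + h\<^sup>2 + 2 * (24 * D) * dist q Y"
    using quadrilateral_inequality[of q w Y a] qa Yw aw by simp
  finally have "D * (42 * h + 441 * D) \<le> D * (24 * dist q Y)"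
    by (simp add: power2_eq_square algebra_simps)
  then have "42 * h + 441 * D \<le> 24 * dist q Y"
    using D_pos by simp
  then have "7 / 4 * h \<le> dist q Y" using D_pos by simp
  then have "(7 / 4 * h)\<^sup>2 \<le> (dist q Y)\<^sup>2" using h by (intro power_mono) auto
  then have lower: "f * (49 / 16 * h\<^sup>2) \<le> f * (dist q Y)\<^sup>2"
    using hf h by (intro mult_left_mono) (auto simp: power2_eq_square)
  have "dist q w \<le> h + 24 * D" using dist_triangle[of q w a] qa aw by simp
  then have qw2: "(dist q w)\<^sup>2 \<le> (h + 24 * D)\<^sup>2" by (intro power_mono) auto
  have "f * (dist q Y)\<^sup>2 \<le> (f - h) * (dist q w)\<^sup>2 + h * L\<^sup>2 - h * (f - h) * f"
    using cat0_stewart[OF g, of h q] hf h wy1 by (simp add: Y_def L_def)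
  also have "\<dots> \<le> (f - h) * (h + 24 * D)\<^sup>2 + h * ((f + 24 * D)\<^sup>2 - h\<^sup>2) - h * (f - h) * f"
    using qw2 L2 hf h by (intro diff_mono add_mono mult_left_mono) auto
  \<comment> \<open>Without the terms in \<open>D\<close> the left side is 2 f h^2 - 2 h^3. Raising
    2 to 5 / 2 absorbs the terms in 24 D \<le> h / 10, and 5 / 2 is still below (7 / 4)^2 = 49 /
    16.\<close>
  also have "\<dots> \<le> f * (5 / 2 * h\<^sup>2)"
  proof -
    define m where "m = 24 * D"
    have m: "0 \<le> m" "10 * m \<le> h" using D_pos h by (auto simp: m_def)
    have f: "0 \<le> f" using hf h by simp
    have 1: "h * m \<le> h * (h / 10)" using m h by (intro mult_left_mono) auto
    have 2: "m * m \<le> h / 10 * (h / 10)" using m h by (intro mult_mono) auto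
    have "(h + m)\<^sup>2 \<le> (11 / 10 * h)\<^sup>2" using m h by (intro power_mono) auto
    then have 3: "(f - h) * (h + m)\<^sup>2 \<le> (f - h) * (11 / 10 * h)\<^sup>2"
      using hf by (intro mult_left_mono) auto
    have 4: "h * (2 * f * m) \<le> f * h\<^sup>2 / 5"
      using mult_left_mono[OF 1 f] by (simp add: power2_eq_square algebra_simps)
    have 5: "h * m\<^sup>2 \<le> h * h\<^sup>2 / 100"
      using mult_left_mono[OF 2, of h] h by (simp add: power2_eq_square)
    have 6: "h * ((f + m)\<^sup>2 - h\<^sup>2) - h * (f - h) * f = h * (2 * f * m) + h * m\<^sup>2 - h * h\<^sup>2 + f * h\<^sup>2"
      by (simp add: power2_eq_square algebra_simps)
    have "(11 / 10 * h)\<^sup>2 = 121 / 100 * h\<^sup>2" by (simp add: power2_eq_square)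
    then have 7: "(f - h) * (11 / 10 * h)\<^sup>2 = 121 / 100 * (f * h\<^sup>2) - 121 / 100 * (h * h\<^sup>2)"
      by (simp only: left_diff_distrib)
    have 8: "0 \<le> h * h\<^sup>2" "0 \<le> f * h\<^sup>2" using h f by auto
    show ?thesis unfolding m_def[symmetric] using 3 4 5 6 7 8 by linarith
  qed
  finally have "f * (49 / 16 * h\<^sup>2) \<le> f * (5 / 2 * h\<^sup>2)" using lower by linarith
  then show False using hf h by (simp add: mult_le_cancel_left)
qed

text \<open>Cut at the lowest point: in both directions the height stays at least as large as there,
  so each half contributes less than \<open>24 * D\<close>.\<close>

lemma proj_of_high_geodesic:
  assumes c: "geodesic_between x y c"
    and high: "\<And>t. 0 \<le> t \<Longrightarrow> t \<le> dist x y \<Longrightarrow> 240 * D \<le> height (c t)"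
  shows "dist (proj x) (proj y) < 48 * D"
proof -
  let ?L = "dist x y"
  have cont_c: "continuous_on {0..?L} c"
    unfolding continuous_on_iff
    using isometric_onD[of "{0..?L}" c] c unfolding geodesic_between_def by metis
  have "\<exists>t\<in>{0..?L}. \<forall>s\<in>{0..?L}. height (c t) \<le> height (c s)"
    by (intro continuous_attains_inf continuous_on_infdist cont_c) auto
  then obtain t where t: "0 \<le> t" "t \<le> ?L" and
    min: "\<And>s. 0 \<le> s \<Longrightarrow> s \<le> ?L \<Longrightarrow> height (c t) \<le> height (c s)" by auto
  have iso: "isometric_on {0..?L} c" using c by (simp add: geodesic_between_def)
  have "dist (proj (c t)) (proj y) < 24 * D"
  proof (rule proj_of_rising_geodesic)
    show "geodesic_between (c t) y (\<lambda>u. c (t + u))"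
      using geodesic_between_segment[OF iso, of t ?L] t geodesic_between_ends[OF c] by simp
  qed (use t high min geodesic_between_dist_right[OF c t] in auto)
  moreover have "dist (proj (c t)) (proj x) < 24 * D"
  proof (rule proj_of_rising_geodesic)
    have "geodesic_between x (c t) c"
      using geodesic_between_segment[OF iso, of 0 t] t geodesic_between_ends[OF c] by simp
    from geodesic_between_reverse[OF this]
    show "geodesic_between (c t) x (\<lambda>u. c (t - u))"
      using geodesic_between_dist_left[OF c t] by simp
  qed (use t high min geodesic_between_dist_left[OF c t] in \<open>auto simp: dist_commute\<close>)
  ultimately show ?thesis
    using dist_triangle[of "proj x" "proj y" "proj (c t)"] by (simp add: dist_commute)
qed

text \<open>The geodesic must dip below \<open>240 * D\<close>, at \<open>c s\<close>. Up to there
  it stays within \<open>240 * D\<close> of the geodesic from \<open>x\<close> to the foot of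
  \<open>c s\<close>, which passes within \<open>2 * D\<close> of \<open>proj x\<close>; adjusting
  the time costs at most another \<open>240 * D\<close>.\<close>

lemma geodesic_near_proj:
  assumes c: "geodesic_between x y c" and far: "48 * D \<le> dist (proj x) (proj y)"
  shows "\<exists>t\<ge>0. t \<le> dist x y \<and> dist (proj x) (c t) \<le> 482 * D"
proof -
  obtain s where s: "0 \<le> s" "s \<le> dist x y" "height (c s) < 240 * D"
    using proj_of_high_geodesic[OF c] far by force
  define v where "v = proj (c s)"
  have v: "v \<in> C" "dist (c s) v < 240 * D"
    using s by (auto simp: v_def proj_in dist_proj)
  have xs: "dist x (c s) = s" by (rule geodesic_between_dist_left[OF c s(1,2)])
  obtain e where e: "geodesic_between x v e" by (rule geodesic_between_exists)
  define \<tau> where "\<tau> = max (height x - D) 0"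
  have \<tau>: "0 \<le> \<tau>" "\<tau> \<le> dist x v" using height_le_dist[OF v(1), of x] D_pos by (auto simp: \<tau>_def)
  define t where "t = min \<tau> s"
  have t: "0 \<le> t" "t \<le> s" "t \<le> dist x v" using \<tau> s by (auto simp: t_def)
  have cs: "geodesic_between x (c s) c"
    using geodesic_between_segment[of "{0..dist x y}" c 0 s] c s
    by (auto simp: geodesic_between_def)
  have "dist (c t) (e t) \<le> dist (c s) v"
    using t xs by (intro fan_unit_speed[OF cs e]) auto
  moreover have "dist (e \<tau>) (e t) = \<tau> - t"
    using geodesic_between_dist[OF e \<tau>] t by (simp add: t_def)
  moreover have "\<tau> - t \<le> 240 * D"
  proof -
    have "height x \<le> s + dist (c s) v"
      using height_le_dist[OF v(1), of x] dist_triangle[of x v "c s"] xs by simp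
    then show ?thesis using v D_pos s by (auto simp: t_def \<tau>_def)
  qed
  moreover have "dist (proj x) (e \<tau>) \<le> 2 * D"
    using geodesic_to_set_near_proj[OF e v(1)] by (simp add: \<tau>_def)
  ultimately have "dist (proj x) (c t) \<le> 482 * D"
    using v dist_triangle[of "proj x" "c t" "e \<tau>"] dist_triangle[of "e \<tau>" "c t" "e t"]
    by (simp add: dist_commute)
  then show ?thesis using t s by (intro exI[of _ t]) auto
qed

end


section \<open>Isometries\<close>

lemma isometries_dist: "g \<in> isometries \<Longrightarrow> dist (g x) (g y) = dist x y"
  by (auto simp: isometries_def isometric_on_def)

lemma isometries_bij: "g \<in> isometries \<Longrightarrow> bij g"
  by (auto simp: isometries_def)

text \<open>The notation \<open>inv\<close> is taken by HOL-Algebra.\<close>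

abbreviation inv_map :: "('a \<Rightarrow> 'b) \<Rightarrow> 'b \<Rightarrow> 'a" where
  "inv_map g \<equiv> inv_into UNIV g"

lemma isometries_inv_f: "g \<in> isometries \<Longrightarrow> inv_map g (g x) = x"
  and isometries_f_inv: "g \<in> isometries \<Longrightarrow> g (inv_map g x) = x"
  by (auto dest!: isometries_bij simp: bij_def surj_f_inv_f)

lemma subgroup_isometries: "subgroup G isom_group \<Longrightarrow> g \<in> G \<Longrightarrow> g \<in> isometries"
  using subgroup.subset by (fastforce simp: isom_group_def)

lemma subgroup_id: "subgroup G isom_group \<Longrightarrow> id \<in> G"
  using subgroup.one_closed by (fastforce simp: isom_group_def)

lemma subgroup_comp: "subgroup G isom_group \<Longrightarrow> g \<in> G \<Longrightarrow> h \<in> G \<Longrightarrow> g \<circ> h \<in> G"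
  using subgroup.m_closed by (fastforce simp: isom_group_def)

lemma m_inv_isom_group:
  fixes g :: "'a::metric_space \<Rightarrow> 'a"
  assumes "g \<in> isometries"
  shows "inv\<^bsub>isom_group\<^esub> g = inv_map g"
proof -
  interpret group "isom_group :: ('a \<Rightarrow> 'a) monoid" by (rule group_isom_group)
  have "g \<in> carrier isom_group" using assms by (simp add: isom_group_def)
  then have "inv\<^bsub>isom_group\<^esub> g \<circ> g = id" using l_inv by (fastforce simp: isom_group_def)
  then have *: "(inv\<^bsub>isom_group\<^esub> g) (g x) = x" for x by (metis comp_apply id_apply)
  show ?thesis
  proof
    show "(inv\<^bsub>isom_group\<^esub> g) x = inv_map g x" for x
      using *[of "inv_map g x"] by (simp add: isometries_f_inv[OF assms])
  qed
qed

lemma subgroup_inv: "subgroup G isom_group \<Longrightarrow> g \<in> G \<Longrightarrow> inv_map g \<in> G"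
  using subgroup.m_inv_closed m_inv_isom_group subgroup_isometries by metis

lemma isometry_geodesic:
  "g \<in> isometries \<Longrightarrow> isometric_on S c \<Longrightarrow> isometric_on S (g \<circ> c)"
  by (auto simp: isometric_on_def isometries_dist)

lemma inj_on_comp_isometry:
  assumes "g \<in> isometries"
  shows "inj_on (\<lambda>f. g \<circ> f) S"
proof (rule inj_onI)
  fix f f' assume "g \<circ> f = g \<circ> f'"
  then have "inv_map g (g (f y)) = inv_map g (g (f' y))" for y by (metis comp_apply)
  then show "f = f'" by (simp add: isometries_inv_f[OF assms] fun_eq_iff)
qed

lemma infdist_isometry:
  fixes g :: "'a::metric_space \<Rightarrow> 'a"
  assumes "g \<in> isometries"
  shows "infdist (g x) (g ` A) = infdist x A"
  unfolding infdist_def by (simp add: image_image isometries_dist[OF assms])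


section \<open>Limits of geodesics\<close>

text \<open>Tychonoff's theorem replaces the Arzela--Ascoli theorem: being isometric on a given set is a
  closed condition in the topology of pointwise convergence.\<close>

lemma isometric_limit:
  fixes f :: "nat \<Rightarrow> real \<Rightarrow> 'a::metric_space"
  assumes iso: "\<And>n. isometric_on (S n) (f n)" and mono: "\<And>m n. m \<le> n \<Longrightarrow> S m \<subseteq> S n"
    and Z: "\<And>t. compact (Z t)" "\<And>n t. t \<in> S n \<Longrightarrow> f n t \<in> Z t"
  shows "\<exists>c. isometric_on (\<Union>n. S n) c \<and> (\<forall>t\<in>(\<Union>n. S n). c t \<in> Z t)"
proof -
  \<comment> \<open>Off the domains \<open>S n\<close> the set \<open>Z t\<close> may be empty; a
    default value then keeps the product nonempty.\<close>
  define W where "W t = (if Z t = {} then {undefined} else Z t)" for t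
  have W: "compact (W t)" "W t \<noteq> {}" for t using Z by (auto simp: W_def)
  define K where "K = Pi\<^sub>E UNIV W"
  have "compactin (product_topology (\<lambda>_. euclidean) UNIV) K"
    unfolding K_def compactin_PiE using W by auto
  then have K: "compact K" by (simp add: euclidean_product_topology)
  define F where "F n = {g :: real \<Rightarrow> 'a. \<forall>s\<in>S n. \<forall>t\<in>S n. dist (g s) (g t) = dist s t}" for n
  have cl: "closed (F n)" for n
  proof -
    have "closed {g :: real \<Rightarrow> 'a. dist (g s) (g t) = dist s t}" for s t
      by (intro closed_Collect_eq continuous_intros continuous_on_product_coordinates)
    then have "closed (\<Inter>s\<in>S n. \<Inter>t\<in>S n. {g :: real \<Rightarrow> 'a. dist (g s) (g t) = dist s t})"
      by blast
    moreover have "F n = (\<Inter>s\<in>S n. \<Inter>t\<in>S n. {g :: real \<Rightarrow> 'a. dist (g s) (g t) = dist s t})"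
      by (auto simp: F_def)
    ultimately show ?thesis by simp
  qed
  have "K \<inter> (\<Inter>n\<in>UNIV. F n) \<noteq> {}"
  proof (rule compact_imp_fip_image[OF K])
    fix I :: "nat set" assume I: "finite I"
    \<comment> \<open>Since the domains increase, any extension of \<open>f N\<close> with values in
      the sets \<open>W t\<close> satisfies all conditions up to \<open>N\<close> at once.\<close>
    define N where "N = Max (insert 0 I)"
    have N: "n \<le> N" if "n \<in> I" for n using I that by (simp add: N_def)
    define g where "g t = (if t \<in> S N then f N t else (SOME x. x \<in> W t))" for t
    have "g t \<in> W t" for t
    proof (cases "t \<in> S N")
      case True
      then show ?thesis using Z(2)[OF True] by (auto simp: g_def W_def)
    next
      case False
      then show ?thesis using W(2)[of t] by (simp add: g_def some_in_eq)
    qed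
    then have "g \<in> K" by (simp add: K_def PiE_iff)
    moreover have "g \<in> F n" if "n \<in> I" for n
      using mono[OF N[OF that]] iso[of N] by (auto simp: F_def g_def isometric_on_def subset_iff)
    ultimately show "K \<inter> (\<Inter>n\<in>I. F n) \<noteq> {}" by auto
  qed (rule cl)
  then obtain g where g: "g \<in> K" "\<And>n. g \<in> F n" by auto
  have "isometric_on (\<Union>n. S n) g"
    unfolding isometric_on_def
  proof (intro ballI)
    fix s t assume "s \<in> (\<Union>n. S n)" "t \<in> (\<Union>n. S n)"
    then obtain m n where "s \<in> S m" "t \<in> S n" by auto
    then have "s \<in> S (max m n)" "t \<in> S (max m n)"
      using mono[of m "max m n"] mono[of n "max m n"] by auto
    then show "dist (g s) (g t) = dist s t" using g(2)[of "max m n"] by (simp add: F_def)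
  qed
  moreover have "g t \<in> Z t" if "t \<in> S n" for n t
  proof -
    have "g t \<in> W t" using g(1) by (simp add: K_def PiE_iff)
    then show ?thesis using Z(2)[OF that] by (auto simp: W_def split: if_splits)
  qed
  ultimately show ?thesis by auto
qed

lemma geodesic_ray_segment:
  assumes "geodesic_ray c" "0 \<le> s" "s \<le> t"
  shows "geodesic_between (c s) (c t) (\<lambda>u. c (s + u))"
  using geodesic_between_segment[of "{0..}" c s t] assms by (auto simp: geodesic_ray_def)

lemma geodesic_ray_dist:
  assumes "geodesic_ray c" "0 \<le> s" "0 \<le> t"
  shows "dist (c s) (c t) = \<bar>s - t\<bar>"
  using assms by (auto simp: geodesic_ray_def isometric_on_def dist_real_def)

context closed_convex
begin

lemma height_convex_ray:
  assumes c: "geodesic_ray c" and st: "0 \<le> s" "s \<le> t" "t > 0"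
  shows "height (c s) \<le> (1 - s / t) * height (c 0) + s / t * height (c t)"
proof -
  have "geodesic_between (c 0) (c t) c" using geodesic_ray_segment[OF c, of 0 t] st by simp
  moreover have "dist (c 0) (c t) = t" using geodesic_ray_dist[OF c] st by simp
  ultimately show ?thesis
    using height_convex[of "c 0" "c t" c "s / t"] st by simp
qed

text \<open>A bounded convex function on a half line cannot increase.\<close>

lemma bounded_ray_height_antimono:
  assumes c: "geodesic_ray c" and B: "\<And>t. 0 \<le> t \<Longrightarrow> height (c t) \<le> B" and s: "0 \<le> s"
  shows "height (c s) \<le> height (c 0)"
proof (rule ccontr)
  assume "\<not> ?thesis"
  then have pos: "height (c s) - height (c 0) > 0" (is "?d > 0") by simp
  have B0: "0 \<le> B" using B[of 0] infdist_nonneg[of "c 0" C] by linarith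
  \<comment> \<open>So large that a chord rising by \<open>?d\<close> over [0, s] has risen by more
    than \<open>B\<close> at time \<open>t\<close>.\<close>
  define t where "t = s + 1 + s * B / ?d"
  have "0 \<le> s * B / ?d" using s pos B0 by simp
  then have t: "s \<le> t" "t > 0" using s by (auto simp: t_def)
  have "height (c s) \<le> (1 - s / t) * height (c 0) + s / t * height (c t)"
    by (rule height_convex_ray[OF c s t])
  also have "\<dots> \<le> 1 * height (c 0) + s / t * B"
    using s t B[of t] by (intro add_mono mult_left_mono mult_right_mono) (auto simp: infdist_nonneg)
  finally have "?d * t \<le> s * B" using t by (simp add: field_simps)
  moreover have "?d * t = ?d * (s + 1) + s * B" using pos by (simp add: t_def field_simps)
  moreover have "?d * (s + 1) > 0" using pos s by (intro mult_pos_pos) auto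
  ultimately show False by linarith
qed

text \<open>A line at bounded distance from \<open>C\<close> is at constant distance from \<open>C\<close>, and its projection to \<open>C\<close>
  is a line parallel to it, as in the flat strip theorem.\<close>

lemma bounded_line_in_set:
  assumes par: "contains_parallel_lines C" and c: "geodesic_line c"
    and B: "\<And>t. height (c t) \<le> B"
  shows "range c \<subseteq> C"
proof -
  have dc: "dist (c s) (c t) = \<bar>s - t\<bar>" for s t
    using c by (auto simp: geodesic_line_def isometric_on_def dist_real_def)
  \<comment> \<open>The estimate for rays, applied in both directions of the line.\<close>
  have const: "height (c t) \<le> height (c s)" for s t
  proof (cases "s \<le> t")
    case True
    have "geodesic_ray (\<lambda>u. c (s + u))" by (auto simp: geodesic_ray_def isometric_on_def dc dist_real_def)
    from bounded_ray_height_antimono[OF this B, of "t - s"] show ?thesis using True by simp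
  next
    case False
    have "geodesic_ray (\<lambda>u. c (s - u))" by (auto simp: geodesic_ray_def isometric_on_def dc dist_real_def)
    from bounded_ray_height_antimono[OF this B, of "s - t"] show ?thesis using False by simp
  qed
  define h where "h = height (c 0)"
  have h: "height (c t) = h" for t using const[of 0 t] const[of t 0] by (simp add: h_def)
  define q where "q t = proj (c t)" for t
  have qc: "dist (c t) (q t) = h" for t by (simp add: q_def dist_proj h)
  have q1: "dist (q s) (q t) \<le> \<bar>s - t\<bar>" for s t
    using proj_lipschitz[of "c s" "c t"] by (simp add: q_def dc)
  \<comment> \<open>The point at proportion \<open>l\<close> between the feet lies in
    \<open>C\<close> at distance at most \<open>h\<close> from the line, so it is itself the foot:
    \<open>q\<close> runs proportionally along geodesics.\<close>
  have aff: "dist (q s) (q (s + l * (t - s))) = l * dist (q s) (q t)"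
    if "s \<le> t" "0 \<le> l" "l \<le> 1" for s t l
  proof -
    have seg: "geodesic_between (c s) (c t) (\<lambda>u. c (s + u))"
      using geodesic_between_segment[of UNIV c s t] c that by (simp add: geodesic_line_def)
    obtain e where e: "geodesic_between (q s) (q t) e" by (rule geodesic_between_exists)
    let ?M = "dist (q s) (q t)"
    have lM: "0 \<le> l * ?M" "l * ?M \<le> ?M" using that by (auto simp: mult_left_le_one_le)
    have inC: "e (l * ?M) \<in> C"
      by (rule geodesic_between_convex[OF convex_C e _ _ lM]) (auto simp: q_def proj_in)
    have "dist (c (s + l * (t - s))) (e (l * ?M)) \<le> (1 - l) * h + l * h"
      using cat0_convexity[OF seg e that(2,3)] that by (simp add: dc qc)
    then have "dist (c (s + l * (t - s))) (e (l * ?M)) \<le> h" by (simp add: algebra_simps)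
    moreover have "h \<le> dist (c (s + l * (t - s))) (e (l * ?M))"
      using height_le_dist[OF inC] h by metis
    ultimately have "dist (c (s + l * (t - s))) (e (l * ?M)) = height (c (s + l * (t - s)))"
      using h by (intro antisym) auto
    with inC have "q (s + l * (t - s)) = e (l * ?M)"
      unfolding q_def[of "s + l * (t - s)"] by (rule proj_unique)
    then show ?thesis using geodesic_between_dist_left[OF e lM] by simp
  qed
  \<comment> \<open>\<open>q\<close> stays within \<open>h\<close> of \<open>c\<close>, so its
    average speed over long intervals tends to 1; by proportionality short intervals have the same
    speed.\<close>
  have q2: "u - s \<le> dist (q s) (q u)" if "s < u" for s u
  proof (rule field_le_epsilon)
    fix e :: real assume e: "e > 0"
    have h0: "0 \<le> h" using infdist_nonneg[of "c 0" C] by (simp add: h_def)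
    define t where "t = u + 2 * h * (u - s) / e"
    have t: "u \<le> t" using h0 e that by (simp add: t_def)
    define l where "l = (u - s) / (t - s)"
    have l: "0 \<le> l" "l \<le> 1" "l * (t - s) = u - s" using t that by (auto simp: l_def)
    have "dist (q s) (q u) = l * dist (q s) (q t)"
      using aff[of s t l] l t that by simp
    moreover have "t - s - 2 * h \<le> dist (q s) (q t)"
      using dist_triangle[of "c s" "c t" "q s"] dist_triangle[of "q s" "c t" "q t"] dc[of s t] qc t that
      by (simp add: dist_commute[of "q t"])
    ultimately have "l * (t - s - 2 * h) \<le> dist (q s) (q u)"
      using l by (simp add: mult_left_mono)
    moreover have "l * (t - s - 2 * h) = u - s - l * (2 * h)"
      using l(3) by (simp add: algebra_simps)
    moreover have "l * (2 * h) \<le> e"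
    proof -
      have "2 * h * (u - s) = e * (t - u)" using e by (simp add: t_def)
      also have "\<dots> \<le> e * (t - s)" using e that by (intro mult_left_mono) auto
      finally show ?thesis using t that by (simp add: l_def field_simps)
    qed
    ultimately show "u - s \<le> dist (q s) (q u) + e" by linarith
  qed
  have "geodesic_line q"
    unfolding geodesic_line_def isometric_on_def dist_real_def
  proof (intro ballI)
    fix s t :: real
    show "dist (q s) (q t) = \<bar>s - t\<bar>"
      using q1[of s t] q2[of s t] q2[of t s]
      by (cases s t rule: linorder_cases) (auto simp: dist_commute)
  qed
  moreover have "range q \<subseteq> C" by (auto simp: q_def proj_in)
  moreover have "parallel_lines q c"
    unfolding parallel_lines_def using qc by (intro exI[of _ h]) (simp add: dist_commute)
  ultimately show ?thesis
    using par c unfolding contains_parallel_lines_def by blast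
qed

end

section \<open>Cocompact actions and limits of translated geodesics\<close>

locale cocompact_convex = closed_convex +
  fixes G :: "('a \<Rightarrow> 'a) set" and p :: 'a and d :: real
  assumes subgroup_G: "subgroup G isom_group"
    and G_preserves: "\<And>g. g \<in> G \<Longrightarrow> g ` C = C"
    and cobounded: "\<And>y. y \<in> C \<Longrightarrow> \<exists>g\<in>G. dist (g p) y \<le> d"
begin

lemma G_isometry: "g \<in> G \<Longrightarrow> g \<in> isometries"
  by (rule subgroup_isometries[OF subgroup_G])

lemma d_nonneg: "0 \<le> d"
proof -
  obtain g where "dist (g p) (proj p) \<le> d" using cobounded[OF proj_in] by blast
  then show ?thesis using zero_le_dist[of "g p" "proj p"] by linarith
qed

lemma height_equivariant: "g \<in> G \<Longrightarrow> height (g x) = height x"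
  using infdist_isometry[OF G_isometry, of g x C] G_preserves[of g] by simp

lemma proj_equivariant:
  assumes "g \<in> G"
  shows "proj (g x) = g (proj x)"
proof (rule proj_unique)
  show "g (proj x) \<in> C" using G_preserves[OF assms] proj_in[of x] by blast
  show "dist (g x) (g (proj x)) = height (g x)"
    using assms by (simp add: isometries_dist[OF G_isometry] dist_proj height_equivariant)
qed

text \<open>Take counterexamples on [-n, n] and translate them by \<open>G\<close> so that their
  midpoints are near \<open>p\<close>. A limit line would have bounded height but height at least
  \<open>e\<close> at time 0, whereas lines of bounded height lie in \<open>C\<close>.\<close>

lemma long_bounded_geodesic_near_set:
  assumes par: "contains_parallel_lines C" and e: "e > 0"
  shows "\<exists>L::real. L \<ge> 0 \<and> (\<forall>c. isometric_on {-L..L} c \<longrightarrow> (\<forall>t\<in>{-L..L}. height (c t) \<le> B) \<longrightarrow> height (c 0) < e)"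
proof (rule ccontr)
  let ?T = ?thesis
  assume neg: "\<not> ?T"
  define P where "P n c \<longleftrightarrow> isometric_on {-real n..real n} c \<and>
    (\<forall>t\<in>{-real n..real n}. height (c t) \<le> B) \<and> e \<le> height (c 0)" for n c
  have "\<exists>c. P n c" for n
  proof -
    have "\<not> (\<forall>c. isometric_on {-real n..real n} c \<longrightarrow> (\<forall>t\<in>{-real n..real n}. height (c t) \<le> B)
            \<longrightarrow> height (c 0) < e)" (is "\<not> ?A")
    proof
      assume ?A
      then have "0 \<le> real n \<and> ?A" by simp
      then have ?T by (rule exI[where x = "real n"])
      with neg show False by contradiction
    qed
    then show ?thesis unfolding P_def by (simp only: not_all not_imp not_less conj_assoc)
  qed
  then have "\<forall>n. \<exists>c. P n c" by blast
  from choice[OF this] obtain c where P: "\<And>n. P n (c n)" by blast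
  have c: "isometric_on {-real n..real n} (c n)" "t \<in> {-real n..real n} \<Longrightarrow> height (c n t) \<le> B"
    "e \<le> height (c n 0)" for n t
    using P[of n] by (auto simp: P_def)
  have "\<forall>n. \<exists>h. h \<in> G \<and> dist (h p) (proj (c n 0)) \<le> d"
    using cobounded[OF proj_in] by blast
  from choice[OF this] obtain g where g: "\<And>n. g n \<in> G" "\<And>n. dist (g n p) (proj (c n 0)) \<le> d"
    by blast
  define f where "f n = inv_map (g n) \<circ> c n" for n
  have ig: "inv_map (g n) \<in> G" for n by (rule subgroup_inv[OF subgroup_G g(1)])
  have f: "isometric_on {-real n..real n} (f n)" for n
    unfolding f_def by (rule isometry_geodesic[OF G_isometry[OF ig] c(1)])
  have hf: "height (f n t) = height (c n t)" for n t
    by (simp add: f_def height_equivariant[OF ig])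
  have f0: "dist p (f n 0) \<le> d + B" for n
  proof -
    have "dist p (f n 0) = dist (g n p) (c n 0)"
      using isometries_dist[OF G_isometry[OF ig[of n]], of "g n p" "c n 0"]
      by (simp add: f_def isometries_inv_f[OF G_isometry[OF g(1)]])
    also have "\<dots> \<le> d + B"
      using g(2)[of n] c(2)[of 0 n] dist_triangle[of "g n p" "c n 0" "proj (c n 0)"]
      by (simp add: dist_commute[of _ "c n 0"] dist_proj)
    finally show ?thesis .
  qed
  \<comment> \<open>\<open>Z t\<close> collects the closed conditions that survive the limit; the
    lower bound on the height is imposed at time 0 only.\<close>
  define Z where "Z t = cball p (d + B + \<bar>t\<bar>) \<inter> ({x. height x \<le> B} \<inter> {x. t = 0 \<longrightarrow> e \<le> height x})"
    for t :: real
  have cont: "continuous_on UNIV height" by (intro continuous_intros)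
  have "closed {x. height x \<le> B}" "closed {x. t = 0 \<longrightarrow> e \<le> height x}" for t :: real
    using closed_Collect_le[OF cont continuous_on_const] closed_Collect_le[OF continuous_on_const cont]
    by (cases "t = 0"; simp)+
  then have Zc: "compact (Z t)" for t
    unfolding Z_def by (intro compact_Int_closed compact_cball closed_Int)
  have Zf: "f n t \<in> Z t" if "t \<in> {-real n..real n}" for n t
  proof -
    have "dist (f n 0) (f n t) = \<bar>t\<bar>"
      using f[of n] that by (auto simp: isometric_on_def dist_real_def)
    then show ?thesis
      using f0[of n] c(2)[OF that] c(3)[of n] dist_triangle[of p "f n t" "f n 0"]
      by (simp add: Z_def hf)
  qed
  have U: "(\<Union>n. {-real n..real n}) = UNIV"
  proof -
    have "\<exists>n. x \<in> {-real n..real n}" for x :: real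
      using real_arch_simple[of "\<bar>x\<bar>"] by (auto simp: abs_le_iff minus_le_iff)
    then show ?thesis by blast
  qed
  obtain c0 where c0: "isometric_on UNIV c0" "\<And>t. c0 t \<in> Z t"
    using isometric_limit[of "\<lambda>n. {-real n..real n}" f Z] f Zc Zf unfolding U by auto
  have "range c0 \<subseteq> C"
    by (rule bounded_line_in_set[OF par, of c0 B]) (use c0 in \<open>auto simp: geodesic_line_def Z_def\<close>)
  then have "height (c0 0) = 0" by (auto intro: infdist_zero)
  then show False using c0(2)[of 0] e by (simp add: Z_def)
qed

end


section \<open>The boundary\<close>

lemma isometry_ray: "g \<in> isometries \<Longrightarrow> geodesic_ray c \<Longrightarrow> geodesic_ray (g \<circ> c)"
  unfolding geodesic_ray_def by (rule isometry_geodesic)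

lemma asymptotic_refl: "geodesic_ray c \<Longrightarrow> (c, c) \<in> asymptotic"
  by (auto simp: asymptotic_def intro!: exI[of _ 0])

lemma asymptotic_sym: "(c, c') \<in> asymptotic \<Longrightarrow> (c', c) \<in> asymptotic"
  by (auto simp: asymptotic_def dist_commute)

lemma asymptotic_trans:
  assumes "(a, b) \<in> asymptotic" "(b, c) \<in> asymptotic"
  shows "(a, c) \<in> asymptotic"
proof -
  obtain K L where "\<forall>t\<ge>0. dist (a t) (b t) \<le> K" "\<forall>t\<ge>0. dist (b t) (c t) \<le> L"
    using assms by (auto simp: asymptotic_def)
  then have "\<forall>t\<ge>0. dist (a t) (c t) \<le> K + L"
    by (metis add_mono dist_triangle order_trans)
  then show ?thesis using assms by (auto simp: asymptotic_def)
qed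

lemma asymptotic_isometry:
  "g \<in> isometries \<Longrightarrow> (c, c') \<in> asymptotic \<Longrightarrow> (g \<circ> c, g \<circ> c') \<in> asymptotic"
  by (auto simp: asymptotic_def isometry_ray isometries_dist)

lemma boundary_eq_class:
  assumes "\<xi> \<in> boundary" "c \<in> \<xi>"
  shows "\<xi> = asymptotic `` {c}"
  using assms unfolding boundary_def quotient_def
  by (auto intro: asymptotic_trans asymptotic_sym)

lemma boundaryI: "geodesic_ray c \<Longrightarrow> asymptotic `` {c} \<in> boundary"
  by (auto simp: boundary_def quotient_def)

lemma boundary_asymptotic:
  assumes "\<xi> \<in> boundary" "c \<in> \<xi>"
  shows "c' \<in> \<xi> \<longleftrightarrow> (c, c') \<in> asymptotic"
  using boundary_eq_class[OF assms] by auto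

lemma boundary_ray: "\<xi> \<in> boundary \<Longrightarrow> c \<in> \<xi> \<Longrightarrow> geodesic_ray c"
  using boundary_asymptotic[of \<xi> c c] by (auto simp: asymptotic_def)

lemma boundary_nonempty: "\<xi> \<in> boundary \<Longrightarrow> \<exists>c. c \<in> \<xi>"
  by (auto simp: boundary_def quotient_def intro: asymptotic_refl)

lemma Union_atLeastAtMost_nat: "(\<Union>n. {0..real n}) = {0..}"
proof -
  have "\<exists>n. x \<le> real n" for x by (rule real_arch_simple)
  then show ?thesis by auto
qed

text \<open>The ray is a limit of geodesics from \<open>p\<close> to distant points of
  \<open>c\<close>, which fellow-travel with \<open>c\<close>.\<close>

lemma asymptotic_ray_exists:
  fixes p :: "'a::{heine_borel, cat0_space}"
  assumes c: "geodesic_ray c"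
  shows "\<exists>c'. (c, c') \<in> asymptotic \<and> c' 0 = p"
proof -
  define d0 where "d0 = dist p (c 0)"
  define P where "P n f \<longleftrightarrow> isometric_on {0..real n} f \<and>
    (\<forall>t\<in>{0..real n}. dist (c t) (f t) \<le> 2 * d0) \<and> f 0 = p" for n and f :: "real \<Rightarrow> 'a"
  have "\<forall>n. \<exists>f. P n f"
  proof
    fix n :: nat
    \<comment> \<open>The endpoint is taken \<open>d0\<close> further out so that the geodesic from
      \<open>p\<close> has length at least \<open>n\<close>.\<close>
    define m where "m = real n + d0"
    have m: "0 \<le> m" "real n \<le> m" by (auto simp: m_def d0_def)
    obtain f where f: "geodesic_between p (c m) f" by (rule geodesic_between_exists)
    have dm: "dist (c 0) (c m) = m" using geodesic_ray_dist[OF c, of 0 m] m by simp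
    have len: "real n \<le> dist p (c m)"
      using dist_triangle[of "c 0" "c m" p] dm by (simp add: m_def d0_def dist_commute)
    have "geodesic_between (c 0) (c m) c" using geodesic_ray_segment[OF c, of 0 m] m by simp
    from geodesics_fellow_travel[OF this f]
    have "\<forall>t\<in>{0..real n}. dist (c t) (f t) \<le> 2 * d0"
      using len m dm by (simp add: d0_def dist_commute)
    moreover have "isometric_on {0..real n} f"
      using f len by (auto simp: geodesic_between_def intro: isometric_on_subset)
    ultimately have "P n f" using geodesic_between_ends[OF f] by (simp add: P_def)
    then show "\<exists>f. P n f" by (rule exI[where x = f])
  qed
  from choice[OF this] obtain f where P: "\<And>n. P n (f n)" by blast
  have f: "isometric_on {0..real n} (f n)"
    "t \<in> {0..real n} \<Longrightarrow> dist (c t) (f n t) \<le> 2 * d0" "f n 0 = p" for n t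
    using P[of n] by (auto simp: P_def)
  define Z where "Z t = (if t = 0 then {p} else cball (c t) (2 * d0))" for t
  have "\<exists>c'. isometric_on (\<Union>n. {0..real n}) c' \<and> (\<forall>t\<in>(\<Union>n. {0..real n}). c' t \<in> Z t)"
    by (rule isometric_limit[of _ f]) (use f in \<open>auto simp: Z_def\<close>)
  then obtain c' where c': "isometric_on {0..} c'" "\<And>t. 0 \<le> t \<Longrightarrow> c' t \<in> Z t"
    unfolding Union_atLeastAtMost_nat by auto
  have c'0: "c' 0 = p" using c'(2)[of 0] by (simp add: Z_def)
  have "dist (c t) (c' t) \<le> 2 * d0" if "0 \<le> t" for t
    using c'(2)[OF that] c'0 by (auto simp: Z_def d0_def dist_commute split: if_splits)
  then have "(c, c') \<in> asymptotic"
    using c c'(1) by (auto simp: asymptotic_def geodesic_ray_def)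
  with c'0 show ?thesis by blast
qed

text \<open>Again a bounded convex function on a half line; in the proof \<open>s\<close> is so
  large that the far end contributes at most \<open>e\<close>.\<close>

lemma asymptotic_dist_le:
  fixes c c' :: "real \<Rightarrow> 'a::cat0_space"
  assumes "(c, c') \<in> asymptotic" and t: "0 \<le> t"
  shows "dist (c t) (c' t) \<le> dist (c 0) (c' 0)"
proof (rule field_le_epsilon)
  fix e :: real assume e: "e > 0"
  obtain K where rays: "geodesic_ray c" "geodesic_ray c'" and K: "\<And>t. t \<ge> 0 \<Longrightarrow> dist (c t) (c' t) \<le> K"
    using assms by (auto simp: asymptotic_def)
  have K0: "0 \<le> K" using K[of 0] zero_le_dist[of "c 0" "c' 0"] by linarith
  define s where "s = t + 1 + t * K / e"
  have "0 \<le> t * K / e" using t K0 e by simp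
  then have s: "t \<le> s" "0 < s" using t by (auto simp: s_def)
  have seg: "geodesic_between (c 0) (c s) c" "geodesic_between (c' 0) (c' s) c'"
    using geodesic_ray_segment[OF rays(1), of 0 s] geodesic_ray_segment[OF rays(2), of 0 s] s by auto
  have len: "dist (c 0) (c s) = s" "dist (c' 0) (c' s) = s"
    using geodesic_ray_dist[OF rays(1), of 0 s] geodesic_ray_dist[OF rays(2), of 0 s] s by auto
  have "dist (c t) (c' t) \<le> (1 - t / s) * dist (c 0) (c' 0) + t / s * dist (c s) (c' s)"
    using cat0_convexity[OF seg, of "t / s"] s t len by simp
  also have "\<dots> \<le> 1 * dist (c 0) (c' 0) + t / s * K"
    using s t K[of s] by (intro add_mono mult_left_mono mult_right_mono) auto
  also have "t / s * K \<le> e"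
  proof -
    have "t * K = e * (s - t - 1)" using e by (simp add: s_def)
    also have "\<dots> \<le> e * s" using e t by (intro mult_left_mono) auto
    finally show ?thesis using s by (simp add: field_simps)
  qed
  finally show "dist (c t) (c' t) \<le> dist (c 0) (c' 0) + e" by simp
qed

lemma ray_contraction:
  fixes c c' :: "real \<Rightarrow> 'a::cat0_space"
  assumes rays: "geodesic_ray c" "geodesic_ray c'" "c 0 = c' 0" and s: "0 \<le> s" "s \<le> t" "0 < t"
  shows "dist (c s) (c' s) \<le> s / t * dist (c t) (c' t)"
proof -
  have seg: "geodesic_between (c 0) (c t) c" "geodesic_between (c 0) (c' t) c'"
    using geodesic_ray_segment[OF rays(1), of 0 t] geodesic_ray_segment[OF rays(2), of 0 t] s rays(3)
    by auto
  have len: "dist (c 0) (c t) = t" "dist (c 0) (c' t) = t"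
    using geodesic_ray_dist[OF rays(1), of 0 t] geodesic_ray_dist[OF rays(2), of 0 t] s rays(3) by auto
  show ?thesis using fan_contraction[OF seg, of "s / t"] s len by simp
qed

lemma ray_dist_mono:
  fixes c c' :: "real \<Rightarrow> 'a::cat0_space"
  assumes rays: "geodesic_ray c" "geodesic_ray c'" "c 0 = c' 0" and s: "0 \<le> s" "s \<le> t"
  shows "dist (c s) (c' s) \<le> dist (c t) (c' t)"
proof (cases "t = 0")
  case True
  then show ?thesis using s by simp
next
  case False
  then have "dist (c s) (c' s) \<le> s / t * dist (c t) (c' t)"
    using s by (intro ray_contraction[OF rays]) auto
  also have "\<dots> \<le> dist (c t) (c' t)" using s False by (intro mult_left_le_one_le) auto
  finally show ?thesis .
qed

section \<open>Rays from \<open>p\<close>, the action on the boundary, the cone topology, Busemann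
  functions\<close>

context
  fixes p :: "'a::{heine_borel, cat0_space}"
begin

lemma ray_to:
  assumes "\<xi> \<in> boundary"
  shows "ray_to p \<xi> \<in> \<xi>" "ray_to p \<xi> 0 = p" "geodesic_ray (ray_to p \<xi>)"
proof -
  obtain c where c: "c \<in> \<xi>" using boundary_nonempty[OF assms] by blast
  obtain c' where "(c, c') \<in> asymptotic" "c' 0 = p"
    using asymptotic_ray_exists[OF boundary_ray[OF assms c]] by blast
  then have "\<exists>c. c \<in> \<xi> \<and> c 0 = p" using boundary_asymptotic[OF assms c] by blast
  then have "ray_to p \<xi> \<in> \<xi> \<and> ray_to p \<xi> 0 = p" unfolding ray_to_def by (rule someI_ex)
  then show "ray_to p \<xi> \<in> \<xi>" "ray_to p \<xi> 0 = p" "geodesic_ray (ray_to p \<xi>)"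
    using boundary_ray[OF assms] by auto
qed

lemma ray_to_dist:
  assumes "\<xi> \<in> boundary" "0 \<le> t"
  shows "dist p (ray_to p \<xi> t) = t"
  using geodesic_ray_dist[OF ray_to(3)[OF assms(1)], of 0 t] ray_to(2)[OF assms(1)] assms by simp

lemma ray_to_asymptotic:
  assumes "\<xi> \<in> boundary" "c \<in> \<xi>" "0 \<le> t"
  shows "dist (ray_to p \<xi> t) (c t) \<le> dist p (c 0)"
  using asymptotic_dist_le[of "ray_to p \<xi>" c t] boundary_asymptotic[OF assms(1) ray_to(1)[OF assms(1)]]
    assms ray_to(2)[OF assms(1)] by simp

lemma boundary_action_class:
  assumes g: "g \<in> isometries" and c: "geodesic_ray c"
  shows "boundary_action g (asymptotic `` {c}) = asymptotic `` {g \<circ> c :: real \<Rightarrow> 'a}"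
proof
  show "boundary_action g (asymptotic `` {c}) \<subseteq> asymptotic `` {g \<circ> c}"
    using asymptotic_isometry[OF g] by (auto simp: boundary_action_def)
  show "asymptotic `` {g \<circ> c} \<subseteq> boundary_action g (asymptotic `` {c})"
  proof
    fix c' assume c': "c' \<in> asymptotic `` {g \<circ> c}"
    have ig: "inv_map g \<in> isometries"
      using g by (simp add: isometries_def isometric_on_def bij_imp_bij_inv)
        (metis bij_inv_eq_iff)
    have "(inv_map g \<circ> (g \<circ> c), inv_map g \<circ> c') \<in> asymptotic"
      using c' by (intro asymptotic_isometry[OF ig]) auto
    moreover have "inv_map g \<circ> (g \<circ> c) = c" by (rule ext) (simp add: isometries_inv_f[OF g])
    moreover have "g \<circ> (inv_map g \<circ> c') = c'" by (rule ext) (simp add: isometries_f_inv[OF g])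
    ultimately show "c' \<in> boundary_action g (asymptotic `` {c})"
      unfolding boundary_action_def by (metis ImageI image_eqI singletonI)
  qed
qed

lemma boundary_action_in:
  assumes g: "g \<in> isometries" and \<xi>: "\<xi> \<in> boundary"
  shows "boundary_action g \<xi> \<in> (boundary :: (real \<Rightarrow> 'a) set set)"
proof -
  obtain c where c: "c \<in> \<xi>" using boundary_nonempty[OF \<xi>] by blast
  have "geodesic_ray c" by (rule boundary_ray[OF \<xi> c])
  then show ?thesis
    using boundary_action_class[OF g] boundary_eq_class[OF \<xi> c] boundaryI[OF isometry_ray[OF g]]
    by metis
qed

lemma boundary_action_mem: "c \<in> \<xi> \<Longrightarrow> g \<circ> c \<in> boundary_action g \<xi>"
  by (auto simp: boundary_action_def)

lemma boundary_action_comp: "boundary_action g (boundary_action h \<xi>) = boundary_action (g \<circ> h) \<xi>"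
  by (simp add: boundary_action_def image_image comp_assoc)

lemma boundary_action_id: "boundary_action id \<xi> = \<xi>"
  by (simp add: boundary_action_def)

lemma boundary_action_inverse:
  assumes "g \<in> isometries"
  shows "boundary_action (inv_map g) (boundary_action g \<xi>) = \<xi>"
    and "boundary_action g (boundary_action (inv_map g) \<xi>) = \<xi>"
proof -
  have "inv_map g \<circ> g = id" "g \<circ> inv_map g = id"
    by (auto simp: fun_eq_iff isometries_inv_f[OF assms] isometries_f_inv[OF assms])
  then show "boundary_action (inv_map g) (boundary_action g \<xi>) = \<xi>"
    "boundary_action g (boundary_action (inv_map g) \<xi>) = \<xi>"
    by (simp_all add: boundary_action_comp boundary_action_id)
qed

lemma openin_cone_topologyI:
  assumes "U \<subseteq> boundary"
    and "\<And>\<xi>. \<xi> \<in> U \<Longrightarrow> \<exists>r>0. \<exists>e>0. {\<eta> \<in> boundary. dist (ray_to p \<eta> r) (ray_to p \<xi> r) < e} \<subseteq> U"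
  shows "openin (cone_topology p) U"
proof (subst openin_subopen, intro ballI)
  fix \<xi> assume \<xi>: "\<xi> \<in> U"
  then obtain r e where re: "r > 0" "e > 0" "{\<eta> \<in> boundary. dist (ray_to p \<eta> r) (ray_to p \<xi> r) < e} \<subseteq> U"
    using assms(2) by blast
  have "openin (cone_topology p) {\<eta> \<in> boundary. dist (ray_to p \<eta> r) (ray_to p \<xi> r) < e}"
    unfolding cone_topology_def using \<xi> assms(1) re
    by (intro topology_generated_by_Basis CollectI exI[of _ \<xi>] exI[of _ r] exI[of _ e]) auto
  then show "\<exists>T. openin (cone_topology p) T \<and> \<xi> \<in> T \<and> T \<subseteq> U"
    using re \<xi> assms(1) by (intro exI[of _ "{\<eta> \<in> boundary. dist (ray_to p \<eta> r) (ray_to p \<xi> r) < e}"]) auto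
qed

lemma topspace_cone_topology: "topspace (cone_topology p) = boundary"
proof -
  have "\<xi> \<in> topspace (cone_topology p)" if "\<xi> \<in> boundary" for \<xi>
  proof -
    have "openin (cone_topology p) {\<eta> \<in> boundary. dist (ray_to p \<eta> 1) (ray_to p \<xi> 1) < 1}"
      unfolding cone_topology_def
      using that by (intro topology_generated_by_Basis CollectI exI[of _ \<xi>] exI[of _ 1]) auto
    moreover have "\<xi> \<in> {\<eta> \<in> boundary. dist (ray_to p \<eta> 1) (ray_to p \<xi> 1) < 1}"
      using that by simp
    ultimately show ?thesis using openin_subset by blast
  qed
  then have "boundary \<subseteq> topspace (cone_topology p)" by blast
  moreover have "topspace (cone_topology p) \<subseteq> boundary"
    unfolding cone_topology_def topology_generated_by_topspace by blast
  ultimately show ?thesis by blast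
qed

lemma openin_ray_to_vimage:
  assumes W: "open W" and t: "0 \<le> t"
  shows "openin (cone_topology p) {\<eta> \<in> boundary. ray_to p \<eta> t \<in> W}"
proof (rule openin_cone_topologyI)
  fix \<xi> assume "\<xi> \<in> {\<eta> \<in> boundary. ray_to p \<eta> t \<in> W}"
  then have \<xi>: "\<xi> \<in> boundary" "ray_to p \<xi> t \<in> W" by auto
  then obtain e where e: "e > 0" "ball (ray_to p \<xi> t) e \<subseteq> W" using W openE by blast
  \<comment> \<open>Basic open sets have positive radius, so \<open>t + 1\<close> takes the place of
    \<open>t\<close>, which may be 0; rays from \<open>p\<close> that are close at
    \<open>t + 1\<close> are close at \<open>t\<close>.\<close>
  have "ray_to p \<eta> t \<in> W"
    if "\<eta> \<in> boundary" "dist (ray_to p \<eta> (t + 1)) (ray_to p \<xi> (t + 1)) < e" for \<eta>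
  proof -
    have "dist (ray_to p \<eta> t) (ray_to p \<xi> t) < e"
      using ray_dist_mono[OF ray_to(3)[OF that(1)] ray_to(3)[OF \<xi>(1)], of t "t + 1"] that t
        ray_to(2) \<xi> by simp
    then show ?thesis using e by (auto simp: dist_commute)
  qed
  then show "\<exists>r>0. \<exists>e>0. {\<eta> \<in> boundary. dist (ray_to p \<eta> r) (ray_to p \<xi> r) < e}
      \<subseteq> {\<eta> \<in> boundary. ray_to p \<eta> t \<in> W}"
    using e t by (intro exI[of _ "t + 1"] conjI exI[of _ e]) auto
qed auto

text \<open>Two rays that are close at a large time \<open>R\<close> have images at distance at most \<open>2 * dist p (g p) + 1\<close>
  from each other at time \<open>R\<close>, hence close at time \<open>r\<close>.\<close>

lemma boundary_action_continuous:
  assumes g: "g \<in> isometries" and U: "openin (cone_topology p) U"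
  shows "openin (cone_topology p) {\<xi> \<in> boundary. boundary_action g \<xi> \<in> U}"
proof -
  have "continuous_map (cone_topology p) (cone_topology p) (boundary_action g)"
    unfolding cone_topology_def[of p]
  proof (rule continuous_on_generated_topo, unfold cone_topology_def[symmetric] topspace_cone_topology)
    show "boundary_action g ` boundary \<subseteq> \<Union>{{\<eta> \<in> boundary. dist (ray_to p \<eta> r) (ray_to p \<xi> r) < e} |\<xi> r e.
        \<xi> \<in> boundary \<and> 0 < r \<and> 0 < e}"
      unfolding topology_generated_by_topspace[symmetric] cone_topology_def[symmetric]
        topspace_cone_topology using boundary_action_in[OF g] by (rule image_subsetI)
  next
    fix V assume "V \<in> {{\<eta> \<in> boundary. dist (ray_to p \<eta> r) (ray_to p \<xi> r) < e} |\<xi> r e.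
        \<xi> \<in> boundary \<and> 0 < r \<and> 0 < e}"
    then obtain \<zeta> r e where V: "V = {\<eta> \<in> boundary. dist (ray_to p \<eta> r) (ray_to p \<zeta> r) < e}"
      and \<zeta>: "\<zeta> \<in> boundary" "0 < r" "0 < e" by blast
    show "openin (cone_topology p) (boundary_action g -` V \<inter> boundary)"
    proof (rule openin_cone_topologyI)
      fix \<xi> assume "\<xi> \<in> boundary_action g -` V \<inter> boundary"
      then have \<xi>: "\<xi> \<in> boundary" and near: "dist (ray_to p (boundary_action g \<xi>) r) (ray_to p \<zeta> r) < e"
        by (auto simp: V)
      define e' where "e' = e - dist (ray_to p (boundary_action g \<xi>) r) (ray_to p \<zeta> r)"
      have e': "e' > 0" using near by (simp add: e'_def)
      define M where "M = 2 * dist p (g p) + 1"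
      have M: "M > 0" by (simp add: M_def add_nonneg_pos)
      \<comment> \<open>Fans from \<open>p\<close> shrink by \<open>r / R\<close>, so a gap of at
        most \<open>M\<close> at time \<open>R\<close> becomes less than \<open>e'\<close> at time
        \<open>r\<close>; the factor 2 makes this strict.\<close>
      define R where "R = max r (2 * r * M / e')"
      have R: "r \<le> R" "0 < R" "r / R * M < e'"
      proof -
        show "r \<le> R" "0 < R" using \<zeta> by (auto simp: R_def)
        have "2 * r * M / e' \<le> R" by (simp add: R_def)
        then have "2 * (r * M) \<le> R * e'" using e' by (simp add: field_simps)
        moreover have "0 < r * M" using \<zeta> M by simp
        ultimately have "r * M < R * e'" by linarith
        then show "r / R * M < e'" using \<open>0 < R\<close> by (simp add: field_simps)
      qed
      have move: "dist (ray_to p (boundary_action g \<eta>) R) (g (ray_to p \<eta> R)) \<le> dist p (g p)"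
        if "\<eta> \<in> boundary" for \<eta>
        using ray_to_asymptotic[OF boundary_action_in[OF g that] boundary_action_mem[OF ray_to(1)[OF that]], of R]
          R ray_to(2)[OF that] by simp
      have "boundary_action g \<eta> \<in> V"
        if \<eta>: "\<eta> \<in> boundary" "dist (ray_to p \<eta> R) (ray_to p \<xi> R) < 1" for \<eta>
      proof -
        let ?a = "ray_to p (boundary_action g \<eta>)" and ?b = "ray_to p (boundary_action g \<xi>)"
        have bd: "boundary_action g \<eta> \<in> boundary" "boundary_action g \<xi> \<in> boundary"
          using boundary_action_in[OF g] \<eta> \<xi> by auto
        have "dist (?a R) (?b R) \<le> M"
          using move[OF \<eta>(1)] move[OF \<xi>] \<eta>(2) isometries_dist[OF g, of "ray_to p \<eta> R" "ray_to p \<xi> R"]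
            dist_triangle[of "?a R" "?b R" "g (ray_to p \<eta> R)"]
            dist_triangle[of "g (ray_to p \<eta> R)" "?b R" "g (ray_to p \<xi> R)"]
          by (simp add: M_def dist_commute)
        have "dist (?a r) (?b r) \<le> r / R * dist (?a R) (?b R)"
          using R \<zeta> by (intro ray_contraction ray_to(3) bd) (auto simp: ray_to(2) bd)
        also have "\<dots> \<le> r / R * M"
          using \<open>dist (?a R) (?b R) \<le> M\<close> R \<zeta> by (intro mult_left_mono) auto
        also have "\<dots> < e'" by (rule R)
        finally have "dist (?a r) (ray_to p \<zeta> r) < e"
          using dist_triangle[of "?a r" "ray_to p \<zeta> r" "?b r"] by (simp add: e'_def)
        then show ?thesis using bd by (simp add: V)
      qed
      then show "\<exists>r>0. \<exists>e>0. {\<eta> \<in> boundary. dist (ray_to p \<eta> r) (ray_to p \<xi> r) < e}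
          \<subseteq> boundary_action g -` V \<inter> boundary"
        using R by (intro exI[of _ R] conjI exI[of _ 1]) auto
    qed auto
  qed
  from openin_continuous_map_preimage[OF this U] show ?thesis
    by (simp add: topspace_cone_topology)
qed

text \<open>Along the ray, distance minus time is nonincreasing and at least
  \<open>- dist p x\<close>. So the limit exists and is an infimum, and the value at any single time
  is an upper bound.\<close>

lemma busemann_limit:
  assumes "\<xi> \<in> boundary"
  shows "((\<lambda>t. dist (ray_to p \<xi> t) x - t) \<longlongrightarrow> busemann p \<xi> x) at_top"
    and "- dist p x \<le> busemann p \<xi> x"
    and "0 \<le> t \<Longrightarrow> busemann p \<xi> x \<le> dist (ray_to p \<xi> t) x - t"
proof -
  define f where "f t = dist (ray_to p \<xi> t) x - t" for t
  define l where "l = (INF t\<in>{0..}. f t)"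
  note ray = ray_to[OF assms]
  have anti: "f t \<le> f s" if "0 \<le> s" "s \<le> t" for s t
    using geodesic_ray_dist[OF ray(3), of t s] dist_triangle[of "ray_to p \<xi> t" x "ray_to p \<xi> s"] that
    by (simp add: f_def)
  have lower: "- dist p x \<le> f t" if "0 \<le> t" for t
    using ray_to_dist[OF assms that] dist_triangle[of p "ray_to p \<xi> t" x]
    by (simp add: f_def dist_commute)
  have bdd: "bdd_below (f ` {0..})" using lower by (intro bdd_belowI[of _ "- dist p x"]) auto
  have l_le: "l \<le> f t" if "0 \<le> t" for t
    unfolding l_def using bdd that by (intro cINF_lower) auto
  have l_ge: "- dist p x \<le> l" unfolding l_def using lower by (intro cINF_greatest) auto
  have lim: "(f \<longlongrightarrow> l) at_top"
  proof (rule decreasing_tendsto)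
    show "eventually (\<lambda>t. l \<le> f t) at_top"
      using l_le eventually_ge_at_top[of 0] by (rule eventually_mono[rotated])
  next
    fix u assume "l < u"
    then obtain s where s: "0 \<le> s" "f s < u"
      unfolding l_def using cINF_less_iff[OF _ bdd, of u] by auto
    show "eventually (\<lambda>t. f t < u) at_top"
      using eventually_ge_at_top[of s] by (rule eventually_mono) (use s anti in force)
  qed
  then have "busemann p \<xi> x = l"
    unfolding busemann_def f_def by (intro tendsto_Lim) auto
  with lim l_ge l_le show "((\<lambda>t. dist (ray_to p \<xi> t) x - t) \<longlongrightarrow> busemann p \<xi> x) at_top"
    "- dist p x \<le> busemann p \<xi> x" "0 \<le> t \<Longrightarrow> busemann p \<xi> x \<le> dist (ray_to p \<xi> t) x - t"
    unfolding f_def by simp_all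
qed

text \<open>A ray that passes within \<open>r\<close> of \<open>x\<close> does so at a time at least
  \<open>dist p x - r\<close>.\<close>

lemma busemann_shadow:
  assumes "\<xi> \<in> boundary" "0 \<le> t" "dist (ray_to p \<xi> t) x \<le> r"
  shows "busemann p \<xi> x \<le> 2 * r - dist p x"
  using busemann_limit(3)[OF assms(1,2), of x] dist_triangle[of p x "ray_to p \<xi> t"]
    ray_to_dist[OF assms(1,2)] assms(3) by linarith

end


section \<open>Conformal measures\<close>

locale conformal_measure =
  fixes p :: "'a::{heine_borel, cat0_space}" and \<Gamma> :: "('a \<Rightarrow> 'a) set"
    and \<delta> :: real and \<mu> :: "(real \<Rightarrow> 'a) set measure"
  assumes subgroup_\<Gamma>: "subgroup \<Gamma> isom_group"
    and \<delta>_nonneg: "0 \<le> \<delta>"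
    and PS: "Patterson_Sullivan p \<Gamma> \<delta> \<mu>"
begin

lemma \<Gamma>_isometry: "g \<in> \<Gamma> \<Longrightarrow> g \<in> isometries"
  by (rule subgroup_isometries[OF subgroup_\<Gamma>])

lemma space_\<mu>: "space \<mu> = boundary"
  and sets_\<mu>: "sets \<mu> = sigma_sets boundary {U. openin (cone_topology p) U}"
  and prob_\<mu>: "prob_space \<mu>"
  using PS by (auto simp: Patterson_Sullivan_def)

sublocale prob_space \<mu> by (rule prob_\<mu>)

lemma sets_open: "openin (cone_topology p) U \<Longrightarrow> U \<in> sets \<mu>"
  unfolding sets_\<mu> by (rule sigma_sets.Basic) simp

text \<open>The index set may be uncountable, because the union is formed among open sets before
  passing to the \<sigma>-algebra.\<close>

lemma sets_ray_open:
  assumes "\<And>i. i \<in> I \<Longrightarrow> open (W i)" "\<And>i. i \<in> I \<Longrightarrow> 0 \<le> t i"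
  shows "{\<eta> \<in> boundary. \<exists>i\<in>I. ray_to p \<eta> (t i) \<in> W i} \<in> sets \<mu>"
proof -
  have "openin (cone_topology p) (\<Union>i\<in>I. {\<eta> \<in> boundary. ray_to p \<eta> (t i) \<in> W i})"
    using assms by (intro openin_Union) (auto intro: openin_ray_to_vimage)
  then have "(\<Union>i\<in>I. {\<eta> \<in> boundary. ray_to p \<eta> (t i) \<in> W i}) \<in> sets \<mu>" by (rule sets_open)
  moreover have "(\<Union>i\<in>I. {\<eta> \<in> boundary. ray_to p \<eta> (t i) \<in> W i})
      = {\<eta> \<in> boundary. \<exists>i\<in>I. ray_to p \<eta> (t i) \<in> W i}" by blast
  ultimately show ?thesis by simp
qed

lemma sets_ray_closed:
  assumes "\<And>i. i \<in> I \<Longrightarrow> closed (W i)" "\<And>i. i \<in> I \<Longrightarrow> 0 \<le> t i"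
  shows "{\<eta> \<in> boundary. \<forall>i\<in>I. ray_to p \<eta> (t i) \<in> W i} \<in> sets \<mu>"
proof -
  have "{\<eta> \<in> boundary. \<exists>i\<in>I. ray_to p \<eta> (t i) \<in> - W i} \<in> sets \<mu>"
    using assms by (intro sets_ray_open) (auto simp: open_Compl)
  then have "space \<mu> - {\<eta> \<in> boundary. \<exists>i\<in>I. ray_to p \<eta> (t i) \<in> - W i} \<in> sets \<mu>"
    by (rule sets.compl_sets)
  moreover have "space \<mu> - {\<eta> \<in> boundary. \<exists>i\<in>I. ray_to p \<eta> (t i) \<in> - W i}
      = {\<eta> \<in> boundary. \<forall>i\<in>I. ray_to p \<eta> (t i) \<in> W i}"
    by (auto simp: space_\<mu>)
  ultimately show ?thesis by simp
qed

lemma measurable_boundary_action: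
  assumes "g \<in> isometries"
  shows "boundary_action g \<in> measurable \<mu> \<mu>"
proof (rule measurable_sigma_sets[OF sets_\<mu>])
  show "{U. openin (cone_topology p) U} \<subseteq> Pow boundary"
    using openin_subset topspace_cone_topology by blast
  show "boundary_action g \<in> space \<mu> \<rightarrow> boundary"
    using boundary_action_in[OF assms] by (auto simp: space_\<mu>)
  fix U assume "U \<in> {U. openin (cone_topology p) U}"
  then have "openin (cone_topology p) {\<xi> \<in> boundary. boundary_action g \<xi> \<in> U}"
    by (intro boundary_action_continuous[OF assms]) simp
  moreover have "{\<xi> \<in> boundary. boundary_action g \<xi> \<in> U} = boundary_action g -` U \<inter> space \<mu>"
    by (auto simp: space_\<mu>)
  ultimately show "boundary_action g -` U \<inter> space \<mu> \<in> sets \<mu>"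
    by (metis sets_open)
qed

lemma boundary_action_image_eq:
  assumes g: "g \<in> isometries" and A: "A \<subseteq> boundary"
  shows "boundary_action g ` A = boundary_action (inv_map g) -` A \<inter> space \<mu>"
proof (intro subset_antisym subsetI)
  fix \<eta> assume "\<eta> \<in> boundary_action g ` A"
  then obtain \<xi> where \<xi>: "\<xi> \<in> A" "\<eta> = boundary_action g \<xi>" by blast
  then show "\<eta> \<in> boundary_action (inv_map g) -` A \<inter> space \<mu>"
    using boundary_action_inverse(1)[OF g, of \<xi>] boundary_action_in[OF g] A by (auto simp: space_\<mu>)
next
  fix \<eta> assume "\<eta> \<in> boundary_action (inv_map g) -` A \<inter> space \<mu>"
  then show "\<eta> \<in> boundary_action g ` A"
    using boundary_action_inverse(2)[OF g, of \<eta>] by (metis IntD1 image_eqI vimage_eq)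
qed

lemma sets_subset_boundary: "A \<in> sets \<mu> \<Longrightarrow> A \<subseteq> boundary"
  using sets.sets_into_space[of A \<mu>] by (simp add: space_\<mu>)

lemma sets_boundary_action_image:
  assumes g: "g \<in> \<Gamma>" and A: "A \<in> sets \<mu>"
  shows "boundary_action g ` A \<in> sets \<mu>"
  unfolding boundary_action_image_eq[OF \<Gamma>_isometry[OF g] sets_subset_boundary[OF A]]
  using A by (intro measurable_sets[OF measurable_boundary_action])
    (rule \<Gamma>_isometry[OF subgroup_inv[OF subgroup_\<Gamma> g]])

text \<open>The integrated form of conformality, from which both mass estimates below are read
  off.\<close>

lemma emeasure_preimage:
  assumes g: "g \<in> \<Gamma>" and A: "A \<in> sets \<mu>"
  shows "emeasure \<mu> (boundary_action g -` A \<inter> space \<mu>)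
       = (\<integral>\<^sup>+\<xi>. ennreal (exp (- \<delta> * busemann p \<xi> (g p))) * indicator A \<xi> \<partial>\<mu>)"
proof -
  define \<nu> where "\<nu> = distr \<mu> \<mu> (boundary_action g)"
  have ac: "absolutely_continuous \<mu> \<nu>"
    and rn: "AE \<xi> in \<mu>. RN_deriv \<mu> \<nu> \<xi> = ennreal (exp (- \<delta> * busemann p \<xi> (g p)))"
    using PS g by (auto simp: Patterson_Sullivan_def Let_def \<nu>_def)
  have "emeasure \<mu> (boundary_action g -` A \<inter> space \<mu>) = emeasure \<nu> A"
    unfolding \<nu>_def by (rule emeasure_distr[OF measurable_boundary_action[OF \<Gamma>_isometry[OF g]] A, symmetric])
  also have "\<dots> = emeasure (density \<mu> (RN_deriv \<mu> \<nu>)) A"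
    using density_RN_deriv[OF ac] by (simp add: \<nu>_def)
  also have "\<dots> = (\<integral>\<^sup>+\<xi>. RN_deriv \<mu> \<nu> \<xi> * indicator A \<xi> \<partial>\<mu>)"
    by (rule emeasure_density) (use A in auto)
  also have "\<dots> = (\<integral>\<^sup>+\<xi>. ennreal (exp (- \<delta> * busemann p \<xi> (g p))) * indicator A \<xi> \<partial>\<mu>)"
    using rn by (intro nn_integral_cong_AE) auto
  finally show ?thesis .
qed

text \<open>On \<open>A\<close> the density of the pushforward by \<open>g\<close> is at least exp
  (\<delta> (dist p (g p) - 2 r)), and the pushforward has mass at most 1.\<close>

lemma measure_shadow_le:
  assumes g: "g \<in> \<Gamma>" and A: "A \<in> sets \<mu>"
    and sh: "\<And>\<xi>. \<xi> \<in> A \<Longrightarrow> \<exists>t\<ge>0. dist (ray_to p \<xi> t) (g p) \<le> r"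
  shows "measure \<mu> A \<le> exp (2 * r * \<delta>) * exp (- \<delta> * dist p (g p))"
proof -
  define k where "k = exp (- (2 * r * \<delta>)) * exp (\<delta> * dist p (g p))"
  have k: "k > 0" by (simp add: k_def)
  have le: "ennreal k * indicator A \<xi> \<le> ennreal (exp (- \<delta> * busemann p \<xi> (g p))) * indicator A \<xi>" for \<xi>
  proof (cases "\<xi> \<in> A")
    case True
    then have "\<xi> \<in> boundary" using sets_subset_boundary[OF A] by blast
    then have "busemann p \<xi> (g p) \<le> 2 * r - dist p (g p)"
      using sh[OF True] busemann_shadow by blast
    then have "\<delta> * busemann p \<xi> (g p) \<le> \<delta> * (2 * r - dist p (g p))"
      using \<delta>_nonneg by (rule mult_left_mono)
    then have "k \<le> exp (- \<delta> * busemann p \<xi> (g p))"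
      unfolding k_def exp_add[symmetric] by (simp add: algebra_simps)
    then show ?thesis using True by (simp add: ennreal_leI)
  qed simp
  have "ennreal (k * measure \<mu> A) = (\<integral>\<^sup>+\<xi>. ennreal k * indicator A \<xi> \<partial>\<mu>)"
    using A k by (simp add: nn_integral_cmult_indicator emeasure_eq_measure ennreal_mult)
  also have "\<dots> \<le> (\<integral>\<^sup>+\<xi>. ennreal (exp (- \<delta> * busemann p \<xi> (g p))) * indicator A \<xi> \<partial>\<mu>)"
    by (rule nn_integral_mono) (rule le)
  also have "\<dots> \<le> 1"
    using emeasure_preimage[OF g A] by (metis emeasure_le_1)
  finally have "k * measure \<mu> A \<le> 1" by simp
  then have "measure \<mu> A \<le> 1 / k" using k by (simp add: field_simps)
  then show ?thesis by (simp add: k_def exp_minus field_simps)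
qed

text \<open>The density is at most exp (\<delta> dist p (g p)), and the pushforward by
  \<open>g\<close> gives the image of \<open>V\<close> exactly the mass of \<open>V\<close>.\<close>

lemma measure_boundary_action_image_ge:
  assumes g: "g \<in> \<Gamma>" and V: "V \<in> sets \<mu>"
  shows "exp (- \<delta> * dist p (g p)) * measure \<mu> V \<le> measure \<mu> (boundary_action g ` V)"
proof -
  let ?A = "boundary_action g ` V" let ?k = "exp (\<delta> * dist p (g p))"
  have A: "?A \<in> sets \<mu>" by (rule sets_boundary_action_image[OF g V])
  have iso: "g \<in> isometries" by (rule \<Gamma>_isometry[OF g])
  have pre: "boundary_action g -` ?A \<inter> space \<mu> = V"
  proof (intro subset_antisym subsetI)
    fix \<xi> assume "\<xi> \<in> boundary_action g -` ?A \<inter> space \<mu>"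
    then obtain \<zeta> where "\<zeta> \<in> V" "boundary_action g \<xi> = boundary_action g \<zeta>" by auto
    then show "\<xi> \<in> V" using boundary_action_inverse(1)[OF iso] by metis
  qed (use sets_subset_boundary[OF V] in \<open>auto simp: space_\<mu>\<close>)
  have le: "ennreal (exp (- \<delta> * busemann p \<xi> (g p))) * indicator ?A \<xi> \<le> ennreal ?k * indicator ?A \<xi>" for \<xi>
  proof (cases "\<xi> \<in> ?A")
    case True
    then have "\<xi> \<in> boundary" using sets_subset_boundary[OF A] by blast
    then have "- dist p (g p) \<le> busemann p \<xi> (g p)" by (rule busemann_limit(2))
    then have "\<delta> * - dist p (g p) \<le> \<delta> * busemann p \<xi> (g p)"
      using \<delta>_nonneg by (rule mult_left_mono)
    then show ?thesis using True by (simp add: ennreal_leI)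
  qed simp
  have "ennreal (measure \<mu> V) = (\<integral>\<^sup>+\<xi>. ennreal (exp (- \<delta> * busemann p \<xi> (g p))) * indicator ?A \<xi> \<partial>\<mu>)"
    using emeasure_preimage[OF g A] pre by (simp add: emeasure_eq_measure)
  also have "\<dots> \<le> (\<integral>\<^sup>+\<xi>. ennreal ?k * indicator ?A \<xi> \<partial>\<mu>)"
    by (rule nn_integral_mono) (rule le)
  also have "\<dots> = ennreal (?k * measure \<mu> ?A)"
    using A by (simp add: nn_integral_cmult_indicator emeasure_eq_measure ennreal_mult)
  finally have "measure \<mu> V \<le> ?k * measure \<mu> ?A" by (simp add: ennreal_le_iff)
  then show ?thesis by (simp add: exp_minus field_simps)
qed

lemma null_boundary_action_image:
  assumes g: "g \<in> \<Gamma>" and V: "V \<in> null_sets \<mu>"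
  shows "boundary_action g ` V \<in> null_sets \<mu>"
proof -
  let ?A = "boundary_action g ` V"
  have Vs: "V \<in> sets \<mu>" using V by auto
  have A: "?A \<in> sets \<mu>" by (rule sets_boundary_action_image[OF g Vs])
  have "boundary_action (inv_map g) ` ?A = V"
    using boundary_action_inverse(1)[OF \<Gamma>_isometry[OF g]] by (simp add: image_image)
  then have "exp (- \<delta> * dist p (inv_map g p)) * measure \<mu> ?A \<le> measure \<mu> V"
    using measure_boundary_action_image_ge[OF subgroup_inv[OF subgroup_\<Gamma> g] A] by simp
  moreover have "measure \<mu> V = 0" using V by (simp add: measure_eq_0_null_sets)
  ultimately have "measure \<mu> ?A \<le> 0" by (simp add: mult_le_0_iff)
  then have "measure \<mu> ?A = 0" using measure_nonneg[of \<mu> ?A] by linarith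
  then show ?thesis using A by (simp add: null_sets_def emeasure_eq_measure)
qed

lemma sum_measure_le_multiplicity:
  assumes I: "finite I" and A: "\<And>i. i \<in> I \<Longrightarrow> A i \<in> sets \<mu>" "\<And>i. i \<in> I \<Longrightarrow> A i \<subseteq> S" and S: "S \<in> sets \<mu>"
    and mult: "\<And>x. x \<in> S \<Longrightarrow> card {i \<in> I. x \<in> A i} \<le> N"
  shows "(\<Sum>i\<in>I. measure \<mu> (A i)) \<le> real N * measure \<mu> S"
proof -
  have "(\<Sum>i\<in>I. measure \<mu> (A i)) = (\<Sum>i\<in>I. (\<integral>x. indicator (A i) x \<partial>\<mu>))"
    using A sets.sets_into_space by (intro sum.cong) (auto simp: Int_absorb2)
  also have "\<dots> = (\<integral>x. (\<Sum>i\<in>I. indicator (A i) x) \<partial>\<mu>)"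
    using A by (intro Bochner_Integration.integral_sum[symmetric]) (auto simp: emeasure_eq_measure)
  also have "\<dots> \<le> (\<integral>x. real N * indicator S x \<partial>\<mu>)"
  proof (rule integral_mono)
    fix x
    have "(\<Sum>i\<in>I. indicator (A i) x) = real (card {i \<in> I. x \<in> A i})"
      using I by (simp add: indicator_def sum.If_cases Int_def)
    also have "\<dots> \<le> real N * indicator S x"
    proof (cases "x \<in> S")
      case True
      then show ?thesis using mult[OF True] by simp
    next
      case False
      then have "{i \<in> I. x \<in> A i} = {}" using A(2) by blast
      then show ?thesis by (simp only: card.empty) simp
    qed
    finally show "(\<Sum>i\<in>I. indicator (A i) x) \<le> real N * indicator S x" .
  qed (use A S in \<open>auto simp: emeasure_eq_measure\<close>)
  also have "\<dots> = real N * measure \<mu> S" using S sets.sets_into_space by (auto simp: Int_absorb2)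
  finally show ?thesis .
qed

text \<open>The neighbourhood in the definition of shadows is open and \<open>{a..b}\<close> is compact, so shadows are
  open: nearby rays are uniformly close on \<open>[a,b]\<close>.\<close>

lemma sets_shadow:
  assumes T: "0 \<le> T"
  shows "shadow p T e K \<in> sets \<mu>"
proof (rule sets_open, rule openin_cone_topologyI)
  fix \<xi> assume "\<xi> \<in> shadow p T e K"
  then obtain a b where \<xi>: "\<xi> \<in> boundary" and ab: "0 \<le> a" "a \<le> b" "T \<le> b - a"
    and sub: "ray_to p \<xi> ` {a..b} \<subseteq> nbhd e K"
    by (auto simp: shadow_def)
  have "continuous_on {0..} (ray_to p \<xi>)"
    unfolding continuous_on_iff
    using isometric_onD ray_to(3)[OF \<xi>] unfolding geodesic_ray_def by metis
  then have "compact (ray_to p \<xi> ` {a..b})"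
    using ab by (intro compact_continuous_image) (auto intro: continuous_on_subset)
  moreover have "open (nbhd e K)" by (auto simp: nbhd_def)
  ultimately obtain r where r: "r > 0" "(\<Union>x\<in>ray_to p \<xi> ` {a..b}. ball x r) \<subseteq> nbhd e K"
    using compact_subset_open_imp_ball_epsilon_subset[OF _ _ sub] by blast
  have "\<eta> \<in> shadow p T e K"
    if \<eta>: "\<eta> \<in> boundary" "dist (ray_to p \<eta> (b + 1)) (ray_to p \<xi> (b + 1)) < r" for \<eta>
  proof -
    have "ray_to p \<eta> t \<in> nbhd e K" if "t \<in> {a..b}" for t
    proof -
      have "dist (ray_to p \<eta> t) (ray_to p \<xi> t) \<le> dist (ray_to p \<eta> (b + 1)) (ray_to p \<xi> (b + 1))"
        using that ab \<eta> \<xi> by (intro ray_dist_mono ray_to(3)) (auto simp: ray_to(2))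
      then have "ray_to p \<eta> t \<in> ball (ray_to p \<xi> t) r" using \<eta> by (simp add: dist_commute)
      then show ?thesis using r that by blast
    qed
    then show ?thesis
      unfolding shadow_def using \<eta> ab
      by (intro CollectI conjI exI[of _ a] exI[of _ b] image_subsetI) auto
  qed
  then show "\<exists>r>0. \<exists>e'>0. {\<eta> \<in> boundary. dist (ray_to p \<eta> r) (ray_to p \<xi> r) < e'} \<subseteq> shadow p T e K"
    using r ab by (intro exI[of _ "b + 1"] conjI exI[of _ r]) auto
qed (auto simp: shadow_def)

end


section \<open>Counting orbit points\<close>

text \<open>The quotient is controlled at infinity by the leading coefficient, which is positive
  because \<open>Q\<close> is, and on the remaining compact interval by continuity.\<close>

lemma positive_poly_growth:
  fixes Q :: "real poly"
  assumes pos: "\<And>x. poly Q x > 0"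
  shows "\<exists>a>0. \<exists>b>0. \<forall>x\<ge>0. a * (1 + x) ^ degree Q \<le> poly Q x \<and> poly Q x \<le> b * (1 + x) ^ degree Q"
proof -
  define n l where "n = degree Q" and "l = lead_coeff Q"
  have "Q \<noteq> 0" using pos[of 0] by auto
  then have l0: "l \<noteq> 0" by (simp add: l_def)
  have lim: "((\<lambda>x. poly Q x / x ^ n) \<longlongrightarrow> l) at_top"
    unfolding n_def l_def by (rule tendsto_mono[OF at_top_le_at_infinity poly_divide_tendsto_aux])
  have "eventually (\<lambda>x. 0 \<le> poly Q x / x ^ n) at_top"
    using eventually_ge_at_top[of 0] by (rule eventually_mono) (simp add: less_imp_le[OF pos])
  then have "0 \<le> l" by (rule tendsto_lowerbound[OF lim]) simp
  then have l: "l > 0" using l0 by simp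
  have "eventually (\<lambda>x. l / 2 < poly Q x / x ^ n \<and> poly Q x / x ^ n < 2 * l) at_top"
    using l by (intro eventually_conj order_tendstoD[OF lim]) auto
  then obtain X0 where X0: "\<And>x. x \<ge> X0 \<Longrightarrow> l / 2 < poly Q x / x ^ n \<and> poly Q x / x ^ n < 2 * l"
    by (auto simp: eventually_at_top_linorder)
  define X where "X = max X0 1"
  define h where "h x = poly Q x / (1 + x) ^ n" for x
  have "continuous_on {0..X} h"
    unfolding h_def by (intro continuous_intros) auto
  moreover have "{0..X} \<noteq> {}" "compact {0..X}" by (auto simp: X_def)
  ultimately obtain x1 x2 where x1: "x1 \<in> {0..X}" "\<And>x. x \<in> {0..X} \<Longrightarrow> h x1 \<le> h x"
    and x2: "x2 \<in> {0..X}" "\<And>x. x \<in> {0..X} \<Longrightarrow> h x \<le> h x2"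
    using continuous_attains_inf[of "{0..X}" h] continuous_attains_sup[of "{0..X}" h] by blast
  have hpos: "h x > 0" if "x \<ge> 0" for x using that pos by (simp add: h_def)
  define a b where "a = min (h x1) (l / 2 / 2 ^ n)" and "b = max (h x2) (2 * l)"
  have ab: "a > 0" "b > 0" using hpos[of x1] x1(1) l by (auto simp: a_def b_def)
  have "a * (1 + x) ^ n \<le> poly Q x \<and> poly Q x \<le> b * (1 + x) ^ n" if x: "x \<ge> 0" for x
  proof (cases "x \<le> X")
    case True
    then have "a \<le> h x" "h x \<le> b" using x1(2)[of x] x2(2)[of x] x by (auto simp: a_def b_def)
    then show ?thesis using x by (simp add: h_def field_simps)
  next
    case False
    then have x1: "x \<ge> 1" "x \<ge> X0" by (auto simp: X_def)
    then have xn: "0 < x ^ n" by simp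
    have Q: "l / 2 * x ^ n \<le> poly Q x" "poly Q x \<le> 2 * l * x ^ n"
      using X0[OF x1(2)] xn by (auto simp: field_simps)
    have "a * (1 + x) ^ n \<le> l / 2 / 2 ^ n * (2 * x) ^ n"
      using x1 ab l by (intro mult_mono power_mono) (auto simp: a_def)
    also have "\<dots> = l / 2 * x ^ n" by (simp add: power_mult_distrib)
    finally have 1: "a * (1 + x) ^ n \<le> poly Q x" using Q by linarith
    have "2 * l * x ^ n \<le> b * (1 + x) ^ n"
      using x1 l ab by (intro mult_mono power_mono) (auto simp: b_def)
    with 1 Q show ?thesis by linarith
  qed
  then show ?thesis using ab unfolding n_def by blast
qed

text \<open>Up to a constant \<open>Q\<close> is increasing and does not distinguish
  \<open>T\<close> from \<open>T + s\<close>, because 1 + u \<le> (1 + s) (1 + T).\<close>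

lemma positive_poly_compare:
  fixes Q :: "real poly"
  assumes pos: "\<And>x. poly Q x > 0" and s: "s \<ge> 0"
  shows "\<exists>K>0. \<forall>T\<ge>0. \<forall>u\<ge>0. u \<le> T + s \<longrightarrow> poly Q u \<le> K * poly Q T"
proof -
  obtain a b where ab: "a > 0" "b > 0"
    and Q: "\<And>x. x \<ge> 0 \<Longrightarrow> a * (1 + x) ^ degree Q \<le> poly Q x \<and> poly Q x \<le> b * (1 + x) ^ degree Q"
    using positive_poly_growth[OF pos] by blast
  let ?n = "degree Q"
  have "poly Q u \<le> b * (1 + s) ^ ?n / a * poly Q T" if "T \<ge> 0" "u \<ge> 0" "u \<le> T + s" for T u
  proof -
    have "0 \<le> T * s" using that s by simp
    then have "1 + u \<le> (1 + s) * (1 + T)" using that by (simp add: algebra_simps)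
    then have "(1 + u) ^ ?n \<le> ((1 + s) * (1 + T)) ^ ?n" using that by (intro power_mono) auto
    then have "b * (1 + u) ^ ?n \<le> b * ((1 + s) * (1 + T)) ^ ?n" using ab by (intro mult_left_mono) auto
    also have "\<dots> = b * (1 + s) ^ ?n / a * (a * (1 + T) ^ ?n)"
      using ab by (simp add: power_mult_distrib)
    also have "\<dots> \<le> b * (1 + s) ^ ?n / a * poly Q T"
      using Q[OF that(1)] ab s by (intro mult_left_mono) auto
    finally show ?thesis using Q[OF that(2)] by linarith
  qed
  moreover have "b * (1 + s) ^ ?n / a > 0" using ab s by simp
  ultimately show ?thesis by blast
qed

lemma exp_shift_le:
  fixes c :: real
  assumes "\<bar>u - T\<bar> \<le> s"
  shows "exp (c * u) \<le> exp (\<bar>c\<bar> * s) * exp (c * T)"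
proof -
  have "c * (u - T) \<le> \<bar>c\<bar> * \<bar>u - T\<bar>" by (metis abs_ge_self abs_mult)
  also have "\<dots> \<le> \<bar>c\<bar> * s" using assms by (intro mult_left_mono) auto
  finally have "c * u \<le> \<bar>c\<bar> * s + c * T" by (simp add: algebra_simps)
  then show ?thesis by (simp flip: exp_add)
qed

section \<open>From windows at integers to annuli at arbitrary radii\<close>

lemma growth_polynomialE:
  assumes "growth_polynomial p G Q"
  obtains C n0 where "C > 1" "n0 > 0"
    "\<And>n::nat. n \<ge> 1 \<Longrightarrow> 1 / C * (poly Q (real n) * exp (critexp p G * real n))
        \<le> real (card {g \<in> G. real n \<le> dist p (g p) \<and> dist p (g p) \<le> real n + real n0})"
    "\<And>n::nat. n \<ge> 1 \<Longrightarrow> real (card {g \<in> G. real n \<le> dist p (g p) \<and> dist p (g p) \<le> real n + real n0})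
        \<le> C * (poly Q (real n) * exp (critexp p G * real n))"
    "\<And>x. poly Q x > 0"
proof -
  obtain C n0 where "C > 1" "n0 > 0" and "\<forall>n::nat. n \<ge> 1 \<longrightarrow>
        (let N = real (card {g \<in> G. real n \<le> dist p (g p) \<and> dist p (g p) \<le> real n + real n0});
             B = poly Q (real n) * exp (critexp p G * real n)
         in 1 / C * B \<le> N \<and> N \<le> C * B)" "\<forall>x. poly Q x > 0"
    using assms unfolding growth_polynomial_def by auto
  then show ?thesis by (intro that[of C n0]) (simp_all add: Let_def)
qed

text \<open>The hypothesis only counts windows that start at an integer \<ge> 1. Boundedly many of
  them cover the annulus, each with a bound comparable to the one at \<open>T\<close>; orbit points
  at distance less than 1 are treated separately.\<close>

lemma count_annulus_upper:
  fixes p :: "'a::metric_space"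
  assumes growth: "growth_polynomial p G Q"
    and fin: "\<And>r. finite {g \<in> G. dist p (g p) \<le> r}"
    and w: "w \<ge> 0"
  shows "\<exists>C>0. \<forall>T\<ge>0. real (card {g \<in> G. \<bar>dist p (g p) - T\<bar> \<le> w}) \<le> C * (poly Q T * exp (critexp p G * T))"
proof -
  let ?\<delta> = "critexp p G"
  obtain C n0 where C: "C > 1" "n0 > 0" and
    up: "\<And>n::nat. n \<ge> 1 \<Longrightarrow> real (card {g \<in> G. real n \<le> dist p (g p) \<and> dist p (g p) \<le> real n + real n0})
        \<le> C * (poly Q (real n) * exp (?\<delta> * real n))"
    and pos: "\<And>x. poly Q x > 0"
    using growth by (rule growth_polynomialE) blast
  obtain K where K: "K > 0"
    "\<And>T u. T \<ge> 0 \<Longrightarrow> u \<ge> 0 \<Longrightarrow> u \<le> T + (w + 1) \<Longrightarrow> poly Q u \<le> K * poly Q T"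
    using positive_poly_compare[of Q "w + 1"] pos w by auto
  define E where "E = exp (\<bar>?\<delta>\<bar> * (w + 1))"
  have E: "E > 0" by (simp add: E_def)
  have cmp: "poly Q u * exp (?\<delta> * u) \<le> K * E * (poly Q T * exp (?\<delta> * T))"
    if "T \<ge> 0" "u \<ge> 0" "\<bar>u - T\<bar> \<le> w + 1" for T u
  proof -
    have "poly Q u * exp (?\<delta> * u) \<le> (K * poly Q T) * (E * exp (?\<delta> * T))"
      using that K pos E unfolding E_def
      by (intro mult_mono exp_shift_le) (auto simp: less_imp_le)
    then show ?thesis by (simp add: mult_ac)
  qed
  define N1 where "N1 = real (card {g \<in> G. dist p (g p) \<le> 1})"
  define C' where "C' = (2 * w + 3) * (C * K * E) + N1 * (K * E) / poly Q 0"
  have "(2 * w + 3) * (C * K * E) > 0" using w C K E by simp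
  moreover have "N1 * (K * E) / poly Q 0 \<ge> 0" using K E pos[of 0] by (simp add: N1_def)
  ultimately have "C' > 0" unfolding C'_def by linarith
  moreover have "real (card {g \<in> G. \<bar>dist p (g p) - T\<bar> \<le> w}) \<le> C' * (poly Q T * exp (?\<delta> * T))" if T: "T \<ge> 0" for T
  proof -
    define B where "B = poly Q T * exp (?\<delta> * T)"
    define I where "I = {n::nat. 1 \<le> n \<and> \<bar>real n - T\<bar> \<le> w + 1}"
    define A where "A n = {g \<in> G. real n \<le> dist p (g p) \<and> dist p (g p) \<le> real n + real n0}" for n
    \<comment> \<open>The orbit points below the first window. The condition on \<open>T\<close>
      empties the set unless \<open>T\<close> is so small that the target dominates a multiple of
      its value at 0, which is \<open>poly Q 0\<close>.\<close>
    define A0 where "A0 = {g \<in> G. dist p (g p) \<le> 1 \<and> T \<le> w + 1}"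
    have finA: "finite (A n)" for n
      by (rule finite_subset[OF _ fin[of "real n + real n0"]]) (auto simp: A_def)
    have finA0: "finite A0" by (rule finite_subset[OF _ fin[of 1]]) (auto simp: A0_def)
    define lo hi where "lo = nat \<lceil>T - (w + 1)\<rceil>" and "hi = nat \<lfloor>T + (w + 1)\<rfloor>"
    have lo: "T - (w + 1) \<le> real lo" unfolding lo_def by (rule real_nat_ceiling_ge)
    have hi: "real hi \<le> T + (w + 1)" unfolding hi_def using T w by (intro of_nat_floor) simp
    have I_sub: "I \<subseteq> {lo..hi}"
    proof
      fix n assume "n \<in> I"
      then have "T - (w + 1) \<le> real n" "real n \<le> T + (w + 1)" by (auto simp: I_def abs_le_iff)
      then show "n \<in> {lo..hi}" unfolding lo_def hi_def by (simp add: nat_ceiling_le_eq le_nat_floor)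
    qed
    then have finI: "finite I" by (rule finite_subset) simp
    have "card I \<le> Suc hi - lo" using card_mono[OF _ I_sub] by simp
    \<comment> \<open>An interval of length \<open>2 * w + 2\<close> contains at most
      \<open>2 * w + 3\<close> integers.\<close>
    then have cI: "real (card I) \<le> 2 * w + 3"
    proof (cases "lo \<le> Suc hi")
      case True
      have "real (card I) \<le> real (Suc hi - lo)" using \<open>card I \<le> Suc hi - lo\<close> by simp
      also have "\<dots> = real hi + 1 - real lo" using True by (simp add: of_nat_diff)
      finally show ?thesis using lo hi by linarith
    next
      case False
      then have "card I = 0" using \<open>card I \<le> Suc hi - lo\<close> by simp
      then show ?thesis using w by simp
    qed
    have "{g \<in> G. \<bar>dist p (g p) - T\<bar> \<le> w} \<subseteq> A0 \<union> (\<Union>n\<in>I. A n)"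
    proof
      fix g assume g: "g \<in> {g \<in> G. \<bar>dist p (g p) - T\<bar> \<le> w}"
      show "g \<in> A0 \<union> (\<Union>n\<in>I. A n)"
      proof (cases "dist p (g p) < 1")
        case True
        then show ?thesis using g by (auto simp: A0_def)
      next
        case False
        define n where "n = nat \<lfloor>dist p (g p)\<rfloor>"
        have n: "1 \<le> n" using False le_nat_floor[of 1 "dist p (g p)"] by (simp add: n_def)
        have n: "1 \<le> n" "real n \<le> dist p (g p)" "dist p (g p) < real n + 1"
          using n of_nat_floor[of "dist p (g p)"] real_nat_ceiling_ge floor_correct[of "dist p (g p)"]
          by (auto simp: n_def)
        moreover have "dist p (g p) \<le> real n + real n0" using n C(2) by linarith
        ultimately have "n \<in> I" "g \<in> A n" using g by (auto simp: I_def A_def abs_le_iff)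
        then show ?thesis by blast
      qed
    qed
    then have "card {g \<in> G. \<bar>dist p (g p) - T\<bar> \<le> w} \<le> card (A0 \<union> (\<Union>n\<in>I. A n))"
      using finA finA0 finI by (intro card_mono) auto
    also have "\<dots> \<le> card A0 + card (\<Union>n\<in>I. A n)" by (rule card_Un_le)
    also have "\<dots> \<le> card A0 + (\<Sum>n\<in>I. card (A n))" using card_UN_le[OF finI, of A] by simp
    finally have "real (card {g \<in> G. \<bar>dist p (g p) - T\<bar> \<le> w}) \<le> real (card A0) + (\<Sum>n\<in>I. real (card (A n)))"
      by (simp only: of_nat_add[symmetric] of_nat_sum[symmetric] of_nat_le_iff)
    also have "(\<Sum>n\<in>I. real (card (A n))) \<le> (\<Sum>n\<in>I. C * (K * E * B))"
    proof (rule sum_mono)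
      fix n assume n: "n \<in> I"
      have "real (card (A n)) \<le> C * (poly Q (real n) * exp (?\<delta> * real n))"
        using up[of n] n by (simp add: A_def I_def)
      also have "\<dots> \<le> C * (K * E * B)"
        unfolding B_def using n T C by (intro mult_left_mono cmp) (auto simp: I_def)
      finally show "real (card (A n)) \<le> C * (K * E * B)" .
    qed
    also have "\<dots> \<le> (2 * w + 3) * (C * (K * E * B))"
      using cI C K E pos[of T] by (simp add: B_def mult_right_mono)
    also have "real (card A0) \<le> N1 * (K * E) / poly Q 0 * B"
    proof (cases "T \<le> w + 1")
      case True
      have "poly Q 0 \<le> K * E * B" using cmp[OF T, of 0] True T by (simp add: B_def)
      then have "1 \<le> K * E * B / poly Q 0" using pos[of 0] by simp
      then have "N1 * 1 \<le> N1 * (K * E * B / poly Q 0)" by (intro mult_left_mono) (auto simp: N1_def)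
      moreover have "real (card A0) \<le> N1"
        unfolding N1_def A0_def using fin[of 1] by (intro of_nat_mono card_mono) auto
      ultimately show ?thesis by (simp add: mult_ac)
    next
      case False
      then have "A0 = {}" by (auto simp: A0_def)
      then show ?thesis using K E pos[of T] pos[of 0] by (simp add: B_def N1_def)
    qed
    finally show ?thesis unfolding B_def[symmetric] C'_def by (simp add: algebra_simps)
  qed
  ultimately show ?thesis by blast
qed

lemma count_annulus_lower:
  fixes p :: "'a::metric_space"
  assumes growth: "growth_polynomial p G Q"
    and fin: "\<And>r. finite {g \<in> G. dist p (g p) \<le> r}"
    and L: "L \<ge> 0"
  shows "\<exists>c>0. \<exists>M\<ge>0. \<forall>T\<ge>0. c * (poly Q T * exp (critexp p G * T))
            \<le> real (card {g \<in> G. T + L \<le> dist p (g p) \<and> dist p (g p) \<le> T + L + M})"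
proof -
  let ?\<delta> = "critexp p G"
  obtain C n0 where C: "C > 1" "n0 > 0" and
    low: "\<And>n::nat. n \<ge> 1 \<Longrightarrow> 1 / C * (poly Q (real n) * exp (?\<delta> * real n))
       \<le> real (card {g \<in> G. real n \<le> dist p (g p) \<and> dist p (g p) \<le> real n + real n0})"
    and pos: "\<And>x. poly Q x > 0"
    using growth by (rule growth_polynomialE) blast
  obtain K where K: "K > 0"
    "\<And>T u. T \<ge> 0 \<Longrightarrow> u \<ge> 0 \<Longrightarrow> u \<le> T + 0 \<Longrightarrow> poly Q u \<le> K * poly Q T"
    using positive_poly_compare[of Q 0] pos by auto
  define E where "E = exp (\<bar>?\<delta>\<bar> * (L + 2))"
  have E: "E > 0" by (simp add: E_def)
  define c where "c = 1 / (C * (K * E))"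
  have "c > 0" using C K E by (simp add: c_def)
  moreover have "c * (poly Q T * exp (?\<delta> * T))
       \<le> real (card {g \<in> G. T + L \<le> dist p (g p) \<and> dist p (g p) \<le> T + L + (2 + real n0)})"
    if T: "T \<ge> 0" for T
  proof -
    \<comment> \<open>The summand 1 makes the window start at an integer \<ge> 1 even when
      \<open>T + L\<close> is 0, and at most 2 beyond \<open>T + L\<close>.\<close>
    define n where "n = nat \<lceil>T + L\<rceil> + 1"
    have n: "1 \<le> n" "T + L \<le> real n" "real n \<le> T + L + 2"
      using T L by (auto simp: n_def) linarith+
    have "poly Q T * exp (?\<delta> * T) \<le> (K * poly Q (real n)) * (E * exp (?\<delta> * real n))"
      unfolding E_def using n T L K pos by (intro mult_mono exp_shift_le) (auto simp: less_imp_le)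
    then have "c * (poly Q T * exp (?\<delta> * T)) \<le> c * ((K * poly Q (real n)) * (E * exp (?\<delta> * real n)))"
      using \<open>c > 0\<close> by (intro mult_left_mono) auto
    also have "\<dots> = 1 / C * (poly Q (real n) * exp (?\<delta> * real n))"
      using C K E by (simp add: c_def field_simps)
    also have "\<dots> \<le> real (card {g \<in> G. real n \<le> dist p (g p) \<and> dist p (g p) \<le> real n + real n0})"
      by (rule low[OF n(1)])
    also have "\<dots> \<le> real (card {g \<in> G. T + L \<le> dist p (g p) \<and> dist p (g p) \<le> T + L + (2 + real n0)})"
      using n by (intro of_nat_mono card_mono finite_subset[OF _ fin[of "T + L + (2 + real n0)"]]) auto
    finally show ?thesis .
  qed
  ultimately show ?thesis by (intro exI[of _ c] conjI exI[of _ "2 + real n0"]) auto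
qed


section \<open>Rays and Morse convex sets\<close>

context morse_convex
begin

text \<open>Both rays leave every neighbourhood of \<open>C\<close>, so the bounded geodesics joining them are contracted.\<close>

lemma proj_asymptotic_ray:
  assumes asy: "(c, c') \<in> asymptotic"
    and ev: "eventually (\<lambda>t. dist (proj (c' t)) y \<le> r) at_top"
  shows "eventually (\<lambda>t. dist (proj (c t)) y \<le> r + 48 * D) at_top"
proof -
  obtain K where rays: "geodesic_ray c" "geodesic_ray c'" and K: "\<And>t. t \<ge> 0 \<Longrightarrow> dist (c t) (c' t) \<le> K"
    using asy by (auto simp: asymptotic_def)
  \<comment> \<open>From this time on \<open>c'\<close> has height at least
    \<open>240 * D + K\<close>, so a geodesic of length at most \<open>K\<close> ending on it stays
    at height at least \<open>240 * D\<close>.\<close>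
  define t0 where "t0 = 240 * D + K + dist (c' 0) y + r"
  show ?thesis
    using ev eventually_ge_at_top[of "max 0 t0"]
  proof eventually_elim
    case (elim t)
    then have t: "0 \<le> t" "t0 \<le> t" by auto
    obtain e where e: "geodesic_between (c t) (c' t) e" by (rule geodesic_between_exists)
    have "t \<le> height (c' t) + r + dist (c' 0) y"
      using geodesic_ray_dist[OF rays(2), of 0 t] t elim dist_proj[of "c' t"]
        dist_triangle[of "c' 0" "c' t" y] dist_triangle[of y "c' t" "proj (c' t)"]
      by (simp add: dist_commute)
    then have high: "240 * D + K \<le> height (c' t)" using t by (simp add: t0_def)
    have "dist (proj (c t)) (proj (c' t)) < 48 * D"
    proof (rule proj_of_high_geodesic[OF e])
      fix u assume u: "0 \<le> u" "u \<le> dist (c t) (c' t)"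
      have "dist (e u) (c' t) \<le> K" using geodesic_between_dist_right[OF e u] u K[OF t(1)] by simp
      then show "240 * D \<le> height (e u)"
        using high height_lipschitz[of "c' t" "e u"] by (simp add: dist_commute)
    qed
    then show ?case using elim dist_triangle[of "proj (c t)" y "proj (c' t)"] by simp
  qed
qed

text \<open>Once above its initial value, the height grows at least linearly by convexity; beyond
  \<open>240 * D\<close> the projection moves by less than \<open>48 * D\<close> for all remaining
  time.\<close>

lemma proj_escaping_ray:
  assumes c: "geodesic_ray c" and s: "0 \<le> s" "height (c 0) < height (c s)"
  shows "\<exists>y\<in>C. eventually (\<lambda>t. dist (proj (c t)) y \<le> 48 * D) at_top"
proof -
  define \<Delta> where "\<Delta> = height (c s) - height (c 0)"
  have \<Delta>: "\<Delta> > 0" using s by (simp add: \<Delta>_def)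
  have s0: "s > 0" using s by (cases "s = 0") auto
  define t0 where "t0 = max s (s * (240 * D) / \<Delta>)"
  have high: "240 * D \<le> height (c t)" if "t0 \<le> t" for t
  proof -
    have t: "s \<le> t" "t > 0" "s * (240 * D) / \<Delta> \<le> t" using that s0 by (auto simp: t0_def)
    have "height (c s) \<le> (1 - s / t) * height (c 0) + s / t * height (c t)"
      by (rule height_convex_ray[OF c s(1) t(1,2)])
    also have "\<dots> \<le> 1 * height (c 0) + s / t * height (c t)"
      using s0 t by (intro add_mono mult_right_mono) (auto simp: infdist_nonneg)
    finally have "\<Delta> * t \<le> s * height (c t)" using t by (simp add: \<Delta>_def field_simps)
    moreover have "s * (240 * D) \<le> \<Delta> * t" using t(3) \<Delta> by (simp add: field_simps)
    ultimately have "s * (240 * D) \<le> s * height (c t)" by linarith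
    then show ?thesis using s0 by simp
  qed
  have "eventually (\<lambda>t. dist (proj (c t)) (proj (c t0)) \<le> 48 * D) at_top"
    using eventually_ge_at_top[of t0]
  proof (rule eventually_mono)
    fix t assume t: "t0 \<le> t"
    have t0: "0 \<le> t0" using s0 by (simp add: t0_def)
    have "dist (proj (c t0)) (proj (c t)) < 48 * D"
    proof (rule proj_of_high_geodesic[OF geodesic_ray_segment[OF c t0 t]])
      fix u assume "0 \<le> u" "u \<le> dist (c t0) (c t)"
      then show "240 * D \<le> height (c (t0 + u))" by (intro high) simp
    qed
    then show "dist (proj (c t)) (proj (c t0)) \<le> 48 * D" by (simp add: dist_commute)
  qed
  then show ?thesis using proj_in by blast
qed

end

locale cocompact_morse = cocompact_convex C G p d + morse_convex C D
  for C :: "'a::{heine_borel, cat0_space} set" and G :: "('a \<Rightarrow> 'a) set" and p d D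
begin

text \<open>The rays at bounded distance from \<open>C\<close>: by convexity such a ray never rises
  above its initial height. In this form membership is a closed condition at each time.\<close>

definition limit_set :: "(real \<Rightarrow> 'a) set set" where
  "limit_set = {\<xi> \<in> boundary. \<forall>t\<in>{0..}. ray_to p \<xi> t \<in> {x. height x \<le> height p}}"

text \<open>The natural number \<open>n\<close> makes this a countable union of sets given by closed
  conditions.\<close>

definition exit_set :: "real \<Rightarrow> (real \<Rightarrow> 'a) set set" where
  "exit_set r = {\<xi> \<in> boundary. \<exists>n. \<forall>t\<in>{real n..}. ray_to p \<xi> t \<in> {x. dist (proj x) p \<le> r}}"

lemma exit_set_iff:
  "\<xi> \<in> exit_set r \<longleftrightarrow> \<xi> \<in> boundary \<and> eventually (\<lambda>t. dist (proj (ray_to p \<xi> t)) p \<le> r) at_top"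
proof -
  have "(\<exists>n. \<forall>t\<in>{real n..}. P t) \<longleftrightarrow> eventually P at_top" for P :: "real \<Rightarrow> bool"
    unfolding eventually_at_top_linorder
    by (metis atLeast_iff order_trans real_arch_simple)
  then show ?thesis by (simp add: exit_set_def)
qed

text \<open>The projection of a ray leaving \<open>C\<close> settles within \<open>48 * D\<close> of
  some \<open>y\<close>, and moving \<open>y\<close> to \<open>p\<close> by \<open>G\<close> costs
  \<open>d\<close>. The translated ray need not start at \<open>p\<close>; replacing it by the
  asymptotic ray from \<open>p\<close> costs another \<open>48 * D\<close>.\<close>

lemma boundary_cover:
  assumes \<xi>: "\<xi> \<in> boundary" "\<xi> \<notin> limit_set"
  shows "\<exists>g\<in>G. \<xi> \<in> boundary_action g ` exit_set (96 * D + d)"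
proof -
  note ray = ray_to[OF \<xi>(1), of p]
  obtain s where "0 \<le> s" "height (ray_to p \<xi> 0) < height (ray_to p \<xi> s)"
    using \<xi> ray(2) by (auto simp: limit_set_def not_le)
  from proj_escaping_ray[OF ray(3) this] obtain y where y: "y \<in> C"
    and ev: "eventually (\<lambda>t. dist (proj (ray_to p \<xi> t)) y \<le> 48 * D) at_top" by blast
  obtain g where g: "g \<in> G" "dist (g p) y \<le> d" using cobounded[OF y] by blast
  define h where "h = inv_map g"
  have h: "h \<in> G" unfolding h_def by (rule subgroup_inv[OF subgroup_G g(1)])
  have hg: "h (g x) = x" for x by (simp add: h_def isometries_inv_f[OF G_isometry[OF g(1)]])
  define \<zeta> where "\<zeta> = boundary_action h \<xi>"
  have \<zeta>: "\<zeta> \<in> boundary" unfolding \<zeta>_def by (rule boundary_action_in[OF G_isometry[OF h] \<xi>(1)])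
  have "h \<circ> ray_to p \<xi> \<in> \<zeta>" unfolding \<zeta>_def by (rule boundary_action_mem[OF ray(1)])
  then have asy: "(ray_to p \<zeta>, h \<circ> ray_to p \<xi>) \<in> asymptotic"
    using boundary_asymptotic[OF \<zeta> ray_to(1)[OF \<zeta>]] by blast
  have "eventually (\<lambda>t. dist (proj ((h \<circ> ray_to p \<xi>) t)) p \<le> 48 * D + d) at_top"
    using ev
  proof (rule eventually_mono)
    fix t assume "dist (proj (ray_to p \<xi> t)) y \<le> 48 * D"
    moreover have "dist (proj ((h \<circ> ray_to p \<xi>) t)) p = dist (proj (ray_to p \<xi> t)) (g p)"
      using isometries_dist[OF G_isometry[OF h], of "proj (ray_to p \<xi> t)" "g p"]
      by (simp add: proj_equivariant[OF h] hg)
    ultimately show "dist (proj ((h \<circ> ray_to p \<xi>) t)) p \<le> 48 * D + d"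
      using g dist_triangle[of "proj (ray_to p \<xi> t)" "g p" y] by (simp add: dist_commute)
  qed
  from proj_asymptotic_ray[OF asy this] have "\<zeta> \<in> exit_set (96 * D + d)"
    using \<zeta> by (simp add: exit_set_iff algebra_simps)
  moreover have "\<xi> = boundary_action g \<zeta>"
    unfolding \<zeta>_def h_def by (rule boundary_action_inverse(2)[OF G_isometry[OF g(1)], symmetric])
  ultimately show ?thesis using g by blast
qed

lemma limit_set_orbit:
  assumes "\<xi> \<in> limit_set" "0 \<le> t"
  shows "\<exists>g\<in>G. dist (g p) (ray_to p \<xi> t) \<le> d + height p"
proof -
  let ?x = "ray_to p \<xi> t"
  obtain g where "g \<in> G" "dist (g p) (proj ?x) \<le> d" using cobounded[OF proj_in] by blast
  moreover have "dist ?x (proj ?x) \<le> height p" using assms by (auto simp: limit_set_def dist_proj)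
  ultimately show ?thesis
    using dist_triangle[of "g p" ?x "proj ?x"] by (intro bexI[of _ g]) (auto simp: dist_commute)
qed

text \<open>A common point of the limit sets of \<open>C\<close> and its translate gives orbit points \<open>\<gamma> (g n p)\<close> and
  \<open>k n p\<close> tracking the same ray.  By discreteness one element \<open>w\<close> relates infinitely many of them,
  which produces infinitely many elements of \<open>\<gamma> G \<gamma>\<inverse> \<inter> G\<close>.\<close>

lemma limit_set_translate_disjoint:
  assumes subgroup_\<Gamma>: "subgroup \<Gamma> isom_group" and G_sub: "G \<subseteq> \<Gamma>"
    and fin: "\<And>r. finite {g \<in> \<Gamma>. dist p (g p) \<le> r}"
    and malnormal: "almost_malnormal G \<Gamma>"
    and \<gamma>: "\<gamma> \<in> \<Gamma>" "\<gamma> \<notin> G" and \<xi>: "\<xi> \<in> limit_set"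
  shows "boundary_action \<gamma> \<xi> \<notin> limit_set"
proof
  define \<eta> where "\<eta> = boundary_action \<gamma> \<xi>"
  assume "boundary_action \<gamma> \<xi> \<in> limit_set"
  then have \<eta>: "\<eta> \<in> limit_set" by (simp add: \<eta>_def)
  have bd: "\<xi> \<in> boundary" "\<eta> \<in> boundary" using \<xi> \<eta> by (auto simp: limit_set_def)
  have iso\<gamma>: "\<gamma> \<in> isometries" by (rule subgroup_isometries[OF subgroup_\<Gamma> \<gamma>(1)])
  define B where "B = d + height p"
  define P where "P n g \<longleftrightarrow> g \<in> G \<and> dist (g p) (ray_to p \<xi> (real n)) \<le> B" for n and g :: "'a \<Rightarrow> 'a"
  have "\<forall>n. \<exists>g. P n g" using limit_set_orbit[OF \<xi>] unfolding P_def B_def by (meson of_nat_0_le_iff)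
  from choice[OF this] obtain g where g: "\<And>n. P n (g n)" by blast
  define P' where "P' n k \<longleftrightarrow> k \<in> G \<and> dist (k p) (ray_to p \<eta> (real n)) \<le> B" for n and k :: "'a \<Rightarrow> 'a"
  have "\<forall>n. \<exists>k. P' n k" using limit_set_orbit[OF \<eta>] unfolding P'_def B_def by (meson of_nat_0_le_iff)
  from choice[OF this] obtain k where k: "\<And>n. P' n (k n)" by blast
  have gG: "g n \<in> G" and kG: "k n \<in> G" for n using g[of n] k[of n] by (auto simp: P_def P'_def)
  have inv_kG: "inv_map (k n) \<in> G" for n by (rule subgroup_inv[OF subgroup_G kG])
  \<comment> \<open>The element relating the two orbit points at time \<open>n\<close>; it moves
    \<open>p\<close> by a bounded amount because both points follow the ray to
    \<open>\<eta>\<close>.\<close>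
  define w where "w n = inv_map (k n) \<circ> (\<gamma> \<circ> g n)" for n
  have wk: "k n \<circ> w n = \<gamma> \<circ> g n" for n
    by (rule ext) (simp add: w_def isometries_f_inv[OF G_isometry[OF kG]])
  have w\<Gamma>: "w n \<in> \<Gamma>" for n
    unfolding w_def using inv_kG gG \<gamma> G_sub by (intro subgroup_comp[OF subgroup_\<Gamma>]) auto
  have w_le: "dist p (w n p) \<le> 2 * B + dist p (\<gamma> p)" for n
  proof -
    have "dist p (w n p) = dist (k n p) (k n (w n p))"
      by (simp add: isometries_dist[OF G_isometry[OF kG]])
    also have "k n (w n p) = \<gamma> (g n p)" using fun_cong[OF wk[of n], of p] by simp
    also have "dist (k n p) (\<gamma> (g n p)) \<le> 2 * B + dist p (\<gamma> p)"
    proof -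
      have "dist (\<gamma> (g n p)) (\<gamma> (ray_to p \<xi> (real n))) \<le> B"
        using g[of n] by (simp add: P_def isometries_dist[OF iso\<gamma>])
      moreover have "dist (k n p) (ray_to p \<eta> (real n)) \<le> B" using k[of n] by (simp add: P'_def)
      moreover have "dist (ray_to p \<eta> (real n)) (\<gamma> (ray_to p \<xi> (real n))) \<le> dist p (\<gamma> p)"
        using ray_to_asymptotic[OF bd(2), of "\<gamma> \<circ> ray_to p \<xi>" "real n" p]
          boundary_action_mem[OF ray_to(1)[OF bd(1)]] ray_to(2)[OF bd(1)]
        by (simp add: \<eta>_def)
      ultimately show ?thesis
        using dist_triangle[of "k n p" "\<gamma> (g n p)" "ray_to p \<eta> (real n)"]
          dist_triangle[of "ray_to p \<eta> (real n)" "\<gamma> (g n p)" "\<gamma> (ray_to p \<xi> (real n))"]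
        by (simp add: dist_commute)
    qed
    finally show ?thesis .
  qed
  have "range w \<subseteq> {g \<in> \<Gamma>. dist p (g p) \<le> 2 * B + dist p (\<gamma> p)}" using w\<Gamma> w_le by auto
  then have "finite (range w)" using fin finite_subset by blast
  then obtain n0 where inf: "infinite {n. w n = w n0}"
    using pigeonhole_infinite[of UNIV w] by auto
  define N where "N = {n. w n = w n0}"
  let ?M = "(\<gamma> <#\<^bsub>isom_group\<^esub> G #>\<^bsub>isom_group\<^esub> inv\<^bsub>isom_group\<^esub> \<gamma>) \<inter> G"
  have finM: "finite ?M" using malnormal \<gamma> unfolding almost_malnormal_def by blast
  \<comment> \<open>When \<open>w n = w n0\<close>, the factor \<open>w n0\<close> cancels, so this
    quotient of elements of \<open>G\<close> is also the conjugate by \<open>\<gamma>\<close> of the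
    quotient of \<open>g n\<close> and \<open>g n0\<close>.\<close>
  define h where "h n = k n \<circ> inv_map (k n0)" for n
  have hM: "h n \<in> ?M" if "n \<in> N" for n
  proof -
    have wn: "w n = w n0" using that by (simp add: N_def)
    have e: "k n (w n0 x) = \<gamma> (g n x)" "k n0 (w n0 x) = \<gamma> (g n0 x)" for x
      using fun_cong[OF wk[of n], of x] fun_cong[OF wk[of n0], of x] by (simp_all add: wn)
    have "h n = \<gamma> \<circ> (g n \<circ> inv_map (g n0)) \<circ> inv_map \<gamma>"
    proof
      fix x
      define u where "u = inv_map (g n0) (inv_map \<gamma> x)"
      have "x = \<gamma> (g n0 u)"
        by (simp add: u_def isometries_f_inv[OF iso\<gamma>] isometries_f_inv[OF G_isometry[OF gG]])
      then have "inv_map (k n0) x = w n0 u"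
        using isometries_inv_f[OF G_isometry[OF kG[of n0]], of "w n0 u"] by (simp add: e)
      then show "h n x = (\<gamma> \<circ> (g n \<circ> inv_map (g n0)) \<circ> inv_map \<gamma>) x"
        by (simp add: h_def e u_def)
    qed
    moreover have "g n \<circ> inv_map (g n0) \<in> G"
      by (intro subgroup_comp[OF subgroup_G] gG subgroup_inv[OF subgroup_G])
    ultimately have "h n \<in> \<gamma> <#\<^bsub>isom_group\<^esub> G #>\<^bsub>isom_group\<^esub> inv\<^bsub>isom_group\<^esub> \<gamma>"
      unfolding l_coset_def r_coset_def m_inv_isom_group[OF iso\<gamma>]
      by (auto simp: isom_group_def)
    moreover have "h n \<in> G" unfolding h_def by (intro subgroup_comp[OF subgroup_G] kG inv_kG)
    ultimately show ?thesis by blast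
  qed
  have kh: "k n = h n \<circ> k n0" for n
    by (rule ext) (simp add: h_def isometries_inv_f[OF G_isometry[OF kG]])
  have "k ` N \<subseteq> (\<lambda>f. f \<circ> k n0) ` ?M"
  proof (rule image_subsetI)
    fix n assume "n \<in> N"
    from hM[OF this] show "k n \<in> (\<lambda>f. f \<circ> k n0) ` ?M" by (rule image_eqI[rotated]) (rule kh)
  qed
  then have fk: "finite (k ` N)" by (rule finite_surj[OF finM])
  have "finite ((\<lambda>f. dist p (f p)) ` k ` N)" using fk by (rule finite_imageI)
  then obtain R where "\<forall>x\<in>(\<lambda>f. dist p (f p)) ` k ` N. x \<le> R"
    using bdd_above_finite unfolding bdd_above_def by blast
  then have R: "dist p (k n p) \<le> R" if "n \<in> N" for n using that by blast
  \<comment> \<open>Finitely many values of \<open>k\<close> have bounded orbit points, but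
    \<open>k n p\<close> follows the ray at time \<open>n\<close>; this bounds
    \<open>n\<close>.\<close>
  have "real n \<le> R + B" if "n \<in> N" for n
    using R[OF that] k[of n] ray_to_dist[OF bd(2), of "real n" p]
      dist_triangle[of p "ray_to p \<eta> (real n)" "k n p"]
    by (simp add: P'_def)
  then have "N \<subseteq> {..nat \<lfloor>R + B\<rfloor>}" by (auto intro: le_nat_floor)
  then have "finite N" by (rule finite_subset) simp
  then show False using inf by (simp add: N_def)
qed

text \<open>\<open>geodesic_near_proj\<close>, used from both ends, brings the ray within
  \<open>482 * D\<close> of \<open>C\<close> near both feet, and convexity keeps it there in
  between; discarding \<open>L0\<close> at either end leaves an \<open>e\<close>-close part. In
  \<open>L\<close> the constant is 1012 = 2 * 482 + 48, where 48 covers the hypothesis of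
  \<open>geodesic_near_proj\<close>.\<close>

lemma ray_follows_set:
  assumes par: "contains_parallel_lines C" and e: "e > 0" and r: "0 \<le> r"
  shows "\<exists>L\<ge>0. \<forall>c T y. geodesic_ray c \<longrightarrow> 0 \<le> T \<longrightarrow>
           eventually (\<lambda>t. dist (proj (c t)) y \<le> r) at_top \<longrightarrow> T + L \<le> dist (proj (c 0)) y \<longrightarrow>
           (\<exists>a b. 0 \<le> a \<and> a \<le> b \<and> T \<le> b - a \<and> (\<forall>t\<in>{a..b}. height (c t) < e))"
proof -
  obtain L0 :: real where L0: "L0 \<ge> 0" and close: "\<And>c. isometric_on {-L0..L0} c \<Longrightarrow>
      (\<forall>t\<in>{-L0..L0}. height (c t) \<le> 482 * D) \<Longrightarrow> height (c 0) < e"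
    using long_bounded_geodesic_near_set[OF par e, of "482 * D"] by blast
  define L where "L = 2 * L0 + r + 1012 * D"
  have "\<exists>a b. 0 \<le> a \<and> a \<le> b \<and> T \<le> b - a \<and> (\<forall>t\<in>{a..b}. height (c t) < e)"
    if c: "geodesic_ray c" and T: "0 \<le> T" and ev: "eventually (\<lambda>t. dist (proj (c t)) y \<le> r) at_top"
      and far: "T + L \<le> dist (proj (c 0)) y" for c T y
  proof -
    have "eventually (\<lambda>t. 0 \<le> t \<and> dist (proj (c t)) y \<le> r) at_top"
      using ev eventually_ge_at_top[of 0] by eventually_elim auto
    then obtain t where t: "0 \<le> t" "dist (proj (c t)) y \<le> r"
      using eventually_happens[of _ at_top] by (metis (mono_tags, lifting) trivial_limit_at_top_linorder)
    have len: "dist (c 0) (c t) = t" using geodesic_ray_dist[OF c, of 0 t] t by simp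
    have seg: "geodesic_between (c 0) (c t) c" using geodesic_ray_segment[OF c, of 0 t] t by simp
    have far': "T + 2 * L0 + 1012 * D \<le> dist (proj (c 0)) (proj (c t))"
      using far t dist_triangle[of "proj (c 0)" y "proj (c t)"] by (simp add: L_def)
    obtain t1 where t1: "0 \<le> t1" "t1 \<le> t" "dist (proj (c 0)) (c t1) \<le> 482 * D"
      using geodesic_near_proj[OF seg] far' T L0 D_pos len by auto
    obtain u where u: "0 \<le> u" "u \<le> t" "dist (proj (c t)) (c (t - u)) \<le> 482 * D"
      using geodesic_near_proj[OF geodesic_between_reverse[OF seg]] far' T L0 D_pos len
      by (auto simp: dist_commute)
    define t2 where "t2 = t - u"
    have t2: "0 \<le> t2" "t2 \<le> t" "dist (proj (c t)) (c t2) \<le> 482 * D" using u by (auto simp: t2_def)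
    \<comment> \<open>The order of the two passages near \<open>C\<close> is not known in advance;
      only the time between them matters.\<close>
    define lo hi where "lo = min t1 t2" and "hi = max t1 t2"
    have lohi: "0 \<le> lo" "lo \<le> hi" using t1 t2 by (auto simp: lo_def hi_def)
    have "hi - lo = dist (c t1) (c t2)"
      using geodesic_ray_dist[OF c t1(1) t2(1)] by (simp add: lo_def hi_def)
    also have "\<dots> \<ge> T + 2 * L0"
      using far' t1(3) t2(3) D_pos dist_triangle[of "proj (c 0)" "proj (c t)" "c t1"]
        dist_triangle[of "c t1" "proj (c t)" "c t2"] by (simp add: dist_commute)
    finally have long: "T + 2 * L0 \<le> hi - lo" .
    have hlo: "height (c lo) \<le> 482 * D" "height (c hi) \<le> 482 * D"
      using height_le_dist[OF proj_in[of "c 0"], of "c t1"] height_le_dist[OF proj_in[of "c t"], of "c t2"]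
        t1(3) t2(3) by (auto simp: lo_def hi_def min_def max_def dist_commute)
    have low: "height (c s) \<le> 482 * D" if "lo \<le> s" "s \<le> hi" for s
      using height_bounded_on_geodesic[OF geodesic_ray_segment[OF c lohi], of "s - lo" "482 * D"]
        hlo that lohi geodesic_ray_dist[OF c, of lo hi] by simp
    have "height (c s) < e" if "s \<in> {lo + L0..hi - L0}" for s
    proof -
      have "isometric_on {-L0..L0} (\<lambda>v. c (s + v))"
        using c that lohi unfolding geodesic_ray_def isometric_on_def by (auto simp: dist_real_def)
      moreover have "\<forall>v\<in>{-L0..L0}. height (c (s + v)) \<le> 482 * D"
        using that by (auto intro!: low)
      ultimately show ?thesis using close[of "\<lambda>v. c (s + v)"] by simp
    qed
    moreover have "0 \<le> lo + L0" "lo + L0 \<le> hi - L0" "T \<le> (hi - L0) - (lo + L0)"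
      using lohi L0 long T by auto
    ultimately show ?thesis by blast
  qed
  moreover have "L \<ge> 0" using L0 r D_pos by (simp add: L_def)
  ultimately show ?thesis by blast
qed

text \<open>The ray passes the foot of its starting point at about time
  \<open>height (c 0) - D\<close> and is still near \<open>C\<close> at time \<open>b\<close>. By
  convexity it is near \<open>C\<close> a time \<open>T\<close> after the first passage, where an
  orbit point is within reach. Both times are cut off at \<open>b\<close>; as
  \<open>height (c 0) \<le> a + e\<close>, each cut loses at most \<open>e\<close>.\<close>

lemma ray_near_set_orbit_point:
  assumes c: "geodesic_ray c" and ab: "0 \<le> a" "a \<le> b" "T \<le> b - a" and T: "0 \<le> T"
    and near: "height (c a) < e" "height (c b) < e"
  shows "\<exists>g\<in>G. \<exists>t\<ge>0. dist (c t) (g p) \<le> d + 2 * e + 2 * D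
           \<and> \<bar>dist (proj (c 0)) (g p) - T\<bar> \<le> d + 5 * e + 4 * D \<and> height (c 0) + T - (D + 2 * e) \<le> t"
proof -
  define x R where "x = c 0" and "R = height x"
  have e: "e > 0" using near(1) infdist_nonneg[of "c a" C] by linarith
  have b: "0 \<le> b" using ab by simp
  have xc: "dist x (c t) = t" if "0 \<le> t" for t using geodesic_ray_dist[OF c, of 0 t] that by (simp add: x_def)
  have Ra: "R \<le> a + e" using height_lipschitz[of x "c a"] xc[OF ab(1)] near by (simp add: R_def)
  define y where "y = proj (c b)"
  have y: "y \<in> C" "dist (c b) y < e" using near by (auto simp: y_def proj_in dist_proj)
  obtain f where f: "geodesic_between x y f" by (rule geodesic_between_exists)
  define \<tau> where "\<tau> = max (R - D) 0"
  have R0: "0 \<le> R" by (simp add: R_def infdist_nonneg)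
  have Ry: "R \<le> dist x y" unfolding R_def by (rule height_le_dist[OF y(1)])
  have \<tau>: "0 \<le> \<tau>" "\<tau> \<le> R" "R - D \<le> \<tau>" "\<tau> \<le> dist x y"
    using R0 D_pos Ry by (auto simp: \<tau>_def)
  define \<tau>1 where "\<tau>1 = min \<tau> b"
  have \<tau>1: "0 \<le> \<tau>1" "\<tau>1 \<le> b" "\<tau>1 \<le> \<tau>" "\<tau> - e \<le> \<tau>1" using \<tau> b e Ra ab by (auto simp: \<tau>1_def)
  have "geodesic_between x (c b) c" using geodesic_ray_segment[OF c, of 0 b] b by (simp add: x_def)
  then have "dist (c \<tau>1) (f \<tau>1) \<le> dist (c b) y"
    using \<tau>1 \<tau> xc[OF b] by (intro fan_unit_speed[OF _ f]) auto
  moreover have "dist (f \<tau>1) (f \<tau>) \<le> e" using geodesic_between_dist[OF f] \<tau> \<tau>1 by auto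
  moreover have "dist (proj x) (f \<tau>) \<le> 2 * D"
    using geodesic_to_set_near_proj[OF f y(1)] by (simp add: \<tau>_def R_def)
  ultimately have \<tau>1_near: "dist (c \<tau>1) (proj x) \<le> 2 * e + 2 * D"
    using y dist_triangle[of "c \<tau>1" "proj x" "f \<tau>1"] dist_triangle[of "f \<tau>1" "proj x" "f \<tau>"]
    by (simp add: dist_commute)
  define t where "t = min b (\<tau>1 + T)"
  have t: "\<tau>1 \<le> t" "t \<le> b" "t \<le> \<tau>1 + T" "\<tau>1 + T - e \<le> t"
    using \<tau>1 T ab Ra \<tau> e by (auto simp: t_def)
  have "height (c t) \<le> 2 * e + 2 * D"
  proof -
    have seg: "geodesic_between (c \<tau>1) (c b) (\<lambda>u. c (\<tau>1 + u))"
      by (rule geodesic_ray_segment[OF c \<tau>1(1,2)])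
    have "height (c (\<tau>1 + (t - \<tau>1))) \<le> 2 * e + 2 * D"
      by (rule height_bounded_on_geodesic[OF seg])
        (use t \<tau>1 geodesic_ray_dist[OF c \<tau>1(1) b] near e D_pos \<tau>1_near
          height_le_dist[OF proj_in[of x], of "c \<tau>1"] in auto)
    then show ?thesis by simp
  qed
  moreover obtain g where g: "g \<in> G" "dist (g p) (proj (c t)) \<le> d"
    using cobounded[OF proj_in] by blast
  ultimately have gt: "dist (c t) (g p) \<le> d + 2 * e + 2 * D"
    using dist_triangle[of "c t" "g p" "proj (c t)"] dist_proj[of "c t"] by (simp add: dist_commute)
  have "dist (c \<tau>1) (c t) = t - \<tau>1" using geodesic_ray_dist[OF c, of \<tau>1 t] t \<tau>1 by simp
  then have "\<bar>dist (proj x) (g p) - (t - \<tau>1)\<bar> \<le> d + 4 * e + 4 * D"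
    using gt \<tau>1_near dist_triangle[of "c \<tau>1" "c t" "proj x"] dist_triangle[of "proj x" "c t" "g p"]
      dist_triangle[of "proj x" "g p" "c \<tau>1"] dist_triangle[of "c \<tau>1" "g p" "c t"]
    by (simp add: dist_commute abs_le_iff)
  then have "\<bar>dist (proj x) (g p) - T\<bar> \<le> d + 5 * e + 4 * D" using t by (simp add: abs_le_iff)
  moreover have "R + T - (D + 2 * e) \<le> t" using t \<tau> \<tau>1 by linarith
  moreover have "0 \<le> t" using t \<tau>1 by linarith
  ultimately show ?thesis using g gt by (intro bexI[of _ g] exI[of _ t]) (auto simp: x_def R_def)
qed

end


section \<open>Measures of shadows\<close>

locale conformal_morse = conformal_measure p \<Gamma> \<delta> \<mu> + cocompact_morse C G p d D
  for p :: "'a::{heine_borel, cat0_space}" and \<Gamma> \<delta> \<mu> C G d D +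
  assumes G_sub: "G \<subseteq> \<Gamma>" and proper: "G \<noteq> \<Gamma>"
    and fin: "\<And>r. finite {g \<in> \<Gamma>. dist p (g p) \<le> r}"
    and malnormal: "almost_malnormal G \<Gamma>"
    and par: "contains_parallel_lines C"
begin

section \<open>Measurability and positive mass of the exit set\<close>

lemma sets_limit_set: "limit_set \<in> sets \<mu>"
  unfolding limit_set_def
  by (intro sets_ray_closed closed_Collect_le continuous_intros) auto

lemma sets_exit_set: "exit_set r \<in> sets \<mu>"
proof -
  have "exit_set r = (\<Union>n. {\<xi> \<in> boundary. \<forall>t\<in>{real n..}. ray_to p \<xi> t \<in> {x. dist (proj x) p \<le> r}})"
    by (auto simp: exit_set_def)
  also have "\<dots> \<in> sets \<mu>"
  proof (intro sets.countable_nat_UN image_subsetI)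
    fix n :: nat
    show "{\<xi> \<in> boundary. \<forall>t\<in>{real n..}. ray_to p \<xi> t \<in> {x. dist (proj x) p \<le> r}} \<in> sets \<mu>"
      by (intro sets_ray_closed closed_Collect_le continuous_intros continuous_on_proj)
        (metis atLeast_iff of_nat_0_le_iff order_trans)
  qed
  finally show ?thesis .
qed

lemma countable_G: "countable G"
proof -
  have "\<exists>n::nat. dist p (g p) \<le> real n" for g by (rule real_arch_simple)
  then have "\<Gamma> = (\<Union>n::nat. {g \<in> \<Gamma>. dist p (g p) \<le> real n})" by blast
  moreover have "countable (\<Union>n::nat. {g \<in> \<Gamma>. dist p (g p) \<le> real n})"
    by (rule countable_UN) (auto intro: countable_finite fin)
  ultimately have "countable \<Gamma>" by metis
  then show ?thesis using G_sub countable_subset by blast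
qed

text \<open>Otherwise \<open>\<mu>\<close> would be concentrated on the limit set of \<open>C\<close> and, by quasi-invariance, on its
  translate, but these are disjoint.\<close>

lemma exit_set_pos: "0 < measure \<mu> (exit_set (96 * D + d))"
proof (rule ccontr)
  let ?V = "exit_set (96 * D + d)"
  assume "\<not> ?thesis"
  then have "measure \<mu> ?V = 0" using measure_nonneg[of \<mu> ?V] by linarith
  then have V: "?V \<in> null_sets \<mu>"
    using sets_exit_set by (simp add: null_sets_def emeasure_eq_measure)
  have U: "(\<Union>g\<in>G. boundary_action g ` ?V) \<in> null_sets \<mu>"
    using countable_G V G_sub by (intro null_sets_UN' null_boundary_action_image) auto
  have "boundary - limit_set \<subseteq> (\<Union>g\<in>G. boundary_action g ` ?V)"
    using boundary_cover by blast
  moreover have "boundary - limit_set \<in> sets \<mu>"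
    using sets_limit_set by (metis sets.compl_sets space_\<mu>)
  ultimately have N: "boundary - limit_set \<in> null_sets \<mu>" using null_sets_subset[OF U] by blast
  obtain \<gamma> where \<gamma>: "\<gamma> \<in> \<Gamma>" "\<gamma> \<notin> G" using proper G_sub by blast
  have iso: "\<gamma> \<in> isometries" by (rule \<Gamma>_isometry[OF \<gamma>(1)])
  have N': "boundary_action (inv_map \<gamma>) ` (boundary - limit_set) \<in> null_sets \<mu>"
    by (rule null_boundary_action_image[OF subgroup_inv[OF subgroup_\<Gamma> \<gamma>(1)] N])
  have "limit_set \<subseteq> boundary_action (inv_map \<gamma>) ` (boundary - limit_set)"
  proof
    fix \<xi> assume \<xi>: "\<xi> \<in> limit_set"
    have "boundary_action \<gamma> \<xi> \<notin> limit_set"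
      by (rule limit_set_translate_disjoint[OF subgroup_\<Gamma> G_sub fin malnormal \<gamma> \<xi>])
    moreover have "boundary_action \<gamma> \<xi> \<in> boundary"
      using \<xi> by (intro boundary_action_in[OF iso]) (simp add: limit_set_def)
    ultimately show "\<xi> \<in> boundary_action (inv_map \<gamma>) ` (boundary - limit_set)"
      using boundary_action_inverse(1)[OF iso, of \<xi>] by (metis Diff_iff image_eqI)
  qed
  then have "limit_set \<in> null_sets \<mu>" using null_sets_subset[OF N' sets_limit_set] by blast
  then have "(boundary - limit_set) \<union> limit_set \<in> null_sets \<mu>" using N by (rule null_sets.Un[rotated])
  moreover have "(boundary - limit_set) \<union> limit_set = space \<mu>"
    unfolding space_\<mu> by (auto simp: limit_set_def)
  ultimately have "emeasure \<mu> (space \<mu>) = 0" by auto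
  then show False by (simp add: emeasure_space_1)
qed

text \<open>After pulling back by \<open>\<alpha>\<close>, the element \<open>g\<close> has moved
  the exit point from \<open>p\<close> to \<open>g p\<close>; passing from the ray that starts at
  \<open>g p\<close> to the one that starts at \<open>inv_map \<alpha> p\<close> costs
  \<open>48 * D\<close>.\<close>

lemma translate_exit_set_ray:
  assumes \<alpha>: "\<alpha> \<in> \<Gamma>" and g: "g \<in> G" and \<eta>: "\<eta> \<in> boundary_action (\<alpha> \<circ> g) ` exit_set r"
  shows "\<eta> \<in> boundary"
    and "eventually (\<lambda>t. dist (proj ((inv_map \<alpha> \<circ> ray_to p \<eta>) t)) (g p) \<le> r + 48 * D) at_top"
proof -
  have iso: "\<alpha> \<in> isometries" "g \<in> isometries" using \<Gamma>_isometry[OF \<alpha>] G_isometry[OF g] by auto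
  have iso': "inv_map \<alpha> \<in> isometries" using subgroup_inv[OF subgroup_\<Gamma> \<alpha>] by (rule \<Gamma>_isometry)
  obtain \<zeta> where \<zeta>: "\<zeta> \<in> exit_set r" "\<eta> = boundary_action \<alpha> (boundary_action g \<zeta>)"
    using \<eta> by (auto simp: boundary_action_comp)
  define \<xi> where "\<xi> = boundary_action g \<zeta>"
  have \<zeta>b: "\<zeta> \<in> boundary" using \<zeta> by (simp add: exit_set_iff)
  have \<xi>b: "\<xi> \<in> boundary" unfolding \<xi>_def by (rule boundary_action_in[OF iso(2) \<zeta>b])
  then show \<eta>b: "\<eta> \<in> boundary" unfolding \<zeta>(2) \<xi>_def[symmetric] by (rule boundary_action_in[OF iso(1)])
  have "\<xi> = boundary_action (inv_map \<alpha>) \<eta>"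
    unfolding \<zeta>(2) \<xi>_def[symmetric] by (simp add: boundary_action_inverse(1)[OF iso(1)])
  then have "inv_map \<alpha> \<circ> ray_to p \<eta> \<in> \<xi>" using boundary_action_mem[OF ray_to(1)[OF \<eta>b]] by metis
  moreover have "g \<circ> ray_to p \<zeta> \<in> \<xi>" unfolding \<xi>_def by (rule boundary_action_mem[OF ray_to(1)[OF \<zeta>b]])
  ultimately have asy: "(inv_map \<alpha> \<circ> ray_to p \<eta>, g \<circ> ray_to p \<zeta>) \<in> asymptotic"
    using boundary_asymptotic[OF \<xi>b] by blast
  have "eventually (\<lambda>t. dist (proj (ray_to p \<zeta> t)) p \<le> r) at_top" using \<zeta> by (simp add: exit_set_iff)
  then have "eventually (\<lambda>t. dist (proj ((g \<circ> ray_to p \<zeta>) t)) (g p) \<le> r) at_top"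
    by (simp add: proj_equivariant[OF g] isometries_dist[OF iso(2)])
  from proj_asymptotic_ray[OF asy this]
  show "eventually (\<lambda>t. dist (proj ((inv_map \<alpha> \<circ> ray_to p \<eta>) t)) (g p) \<le> r + 48 * D) at_top" .
qed

section \<open>Translates of \<open>C\<close> and their shadows, seen from the preimage of
  \<open>p\<close>\<close>

lemma infdist_translate:
  assumes "\<alpha> \<in> \<Gamma>"
  shows "infdist p (\<alpha> ` C) = height (inv_map \<alpha> p)"
  using infdist_isometry[OF \<Gamma>_isometry[OF assms], of "inv_map \<alpha> p" C]
  by (simp add: isometries_f_inv[OF \<Gamma>_isometry[OF assms]])

lemma dist_translate:
  assumes "\<alpha> \<in> \<Gamma>"
  shows "dist p (\<alpha> y) = dist (inv_map \<alpha> p) y"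
  using isometries_dist[OF \<Gamma>_isometry[OF assms], of "inv_map \<alpha> p" y]
  by (simp add: isometries_f_inv[OF \<Gamma>_isometry[OF assms]])

text \<open>Pulling back by \<open>\<alpha>\<close> leaves one set \<open>C\<close> and moves the
  origin of the rays instead. The infimum in \<open>height\<close> is attained, so the open
  neighbourhood consists of the points of height less than \<open>e\<close>.\<close>

lemma shadow_translate:
  assumes \<alpha>: "\<alpha> \<in> \<Gamma>"
  shows "shadow p T e (\<alpha> ` C) = {\<eta> \<in> boundary. \<exists>a b. 0 \<le> a \<and> a \<le> b \<and> T \<le> b - a \<and>
           (\<forall>t\<in>{a..b}. height ((inv_map \<alpha> \<circ> ray_to p \<eta>) t) < e)}"
proof -
  have iso: "\<alpha> \<in> isometries" by (rule \<Gamma>_isometry[OF \<alpha>])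
  have "x \<in> nbhd e (\<alpha> ` C) \<longleftrightarrow> height (inv_map \<alpha> x) < e" for x
  proof -
    have d: "dist (\<alpha> y) x = dist (inv_map \<alpha> x) y" for y
      using isometries_dist[OF iso, of y "inv_map \<alpha> x"] by (simp add: isometries_f_inv[OF iso] dist_commute)
    have "x \<in> nbhd e (\<alpha> ` C) \<longleftrightarrow> (\<exists>y\<in>C. dist (inv_map \<alpha> x) y < e)"
      by (auto simp: nbhd_def d)
    also have "\<dots> \<longleftrightarrow> height (inv_map \<alpha> x) < e"
      using height_le_dist[of _ "inv_map \<alpha> x"] proj_in[of "inv_map \<alpha> x"] dist_proj[of "inv_map \<alpha> x"]
      by (metis le_less_trans)
    finally show ?thesis .
  qed
  then show ?thesis by (auto simp: shadow_def image_subset_iff)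
qed

text \<open>\<open>I\<close> and \<open>M\<close> are left arbitrary so that the choice of an
  annulus can wait until the elements of \<open>G\<close> are counted.\<close>

lemma measure_shadow_ge:
  assumes e: "e > 0"
  shows "\<exists>L\<ge>0. \<exists>c>0. \<forall>T\<ge>0. \<forall>\<alpha>\<in>\<Gamma>. \<forall>M I. finite I \<longrightarrow> I \<subseteq> G \<longrightarrow>
     (\<forall>g\<in>I. T + L \<le> dist (proj (inv_map \<alpha> p)) (g p) \<and> dist (proj (inv_map \<alpha> p)) (g p) \<le> T + M) \<longrightarrow>
     c * (real (card I) * exp (- \<delta> * (infdist p (\<alpha> ` C) + T + M))) \<le> measure \<mu> (shadow p T e (\<alpha> ` C))"
proof -
  define r R where "r = 96 * D + d" and "R = r + 48 * D"
  note d0 = d_nonneg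
  have R0: "0 \<le> R" using D_pos d0 by (simp add: R_def r_def)
  obtain L where L: "L \<ge> 0" and follow: "\<And>c T y. geodesic_ray c \<Longrightarrow> 0 \<le> T \<Longrightarrow>
      eventually (\<lambda>t. dist (proj (c t)) y \<le> R) at_top \<Longrightarrow> T + L \<le> dist (proj (c 0)) y \<Longrightarrow>
      \<exists>a b. 0 \<le> a \<and> a \<le> b \<and> T \<le> b - a \<and> (\<forall>t\<in>{a..b}. height (c t) < e)"
    using ray_follows_set[OF par e R0] by blast
  let ?V = "exit_set r"
  \<comment> \<open>If a boundary point lies in the translates for \<open>g\<close> and
    \<open>h\<close>, then \<open>g p\<close> and \<open>h p\<close> are within \<open>R\<close> of
    a common projection, so \<open>inv_map h \<circ> g\<close> is one of these \<open>N\<close>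
    elements.\<close>
  define N where "N = card {g \<in> \<Gamma>. dist p (g p) \<le> 2 * R}"
  have Vpos: "0 < measure \<mu> ?V" unfolding r_def by (rule exit_set_pos)
  have "id \<in> {g \<in> \<Gamma>. dist p (g p) \<le> 2 * R}" using subgroup_id[OF subgroup_\<Gamma>] R0 by simp
  then have N: "N > 0" unfolding N_def using fin[of "2 * R"] card_gt_0_iff by blast
  define c where "c = measure \<mu> ?V / real N"
  have c: "c > 0" using Vpos N by (simp add: c_def)
  have main: "c * (real (card I) * exp (- \<delta> * (infdist p (\<alpha> ` C) + T + M))) \<le> measure \<mu> (shadow p T e (\<alpha> ` C))"
    if T: "T \<ge> 0" and \<alpha>: "\<alpha> \<in> \<Gamma>" and I: "finite I" "I \<subseteq> G"
      and far: "\<And>g. g \<in> I \<Longrightarrow> T + L \<le> dist (proj (inv_map \<alpha> p)) (g p)"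
      and close: "\<And>g. g \<in> I \<Longrightarrow> dist (proj (inv_map \<alpha> p)) (g p) \<le> T + M"
    for T \<alpha> M I
  proof -
    define S where "S = shadow p T e (\<alpha> ` C)"
    define A where "A g = boundary_action (\<alpha> \<circ> g) ` ?V" for g :: "'a \<Rightarrow> 'a"
    define x where "x = inv_map \<alpha> p"
    have \<alpha>g: "\<alpha> \<circ> g \<in> \<Gamma>" if "g \<in> I" for g
      using that I G_sub by (intro subgroup_comp[OF subgroup_\<Gamma> \<alpha>]) auto
    have S: "S \<in> sets \<mu>" unfolding S_def by (rule sets_shadow[OF T])
    have A: "A g \<in> sets \<mu>" if "g \<in> I" for g
      unfolding A_def by (rule sets_boundary_action_image[OF \<alpha>g[OF that] sets_exit_set])
    have ray: "\<eta> \<in> boundary" "eventually (\<lambda>t. dist (proj ((inv_map \<alpha> \<circ> ray_to p \<eta>) t)) (g p) \<le> R) at_top"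
      if "g \<in> I" "\<eta> \<in> A g" for g \<eta>
      using translate_exit_set_ray[OF \<alpha>, of g \<eta> r] that I unfolding A_def R_def by auto
    have A_sub: "A g \<subseteq> S" if g: "g \<in> I" for g
    proof
      fix \<eta> assume \<eta>: "\<eta> \<in> A g"
      have "geodesic_ray (inv_map \<alpha> \<circ> ray_to p \<eta>)"
        by (rule isometry_ray[OF \<Gamma>_isometry[OF subgroup_inv[OF subgroup_\<Gamma> \<alpha>]] ray_to(3)[OF ray(1)[OF g \<eta>]]])
      from follow[OF this T ray(2)[OF g \<eta>]] show "\<eta> \<in> S"
        unfolding S_def shadow_translate[OF \<alpha>] using far[OF g] ray(1)[OF g \<eta>] by (simp add: ray_to(2))
    qed
    have mult: "card {g \<in> I. \<eta> \<in> A g} \<le> N" for \<eta>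
    proof (cases "{g \<in> I. \<eta> \<in> A g} = {}")
      case True
      then show ?thesis by (simp only: card.empty)
    next
      case False
      then obtain h where h: "h \<in> I" "\<eta> \<in> A h" by blast
      have hG: "h \<in> G" using h I by blast
      show ?thesis
        unfolding N_def
      proof (rule card_inj_on_le[of "\<lambda>g. inv_map h \<circ> g"])
        show "inj_on (\<lambda>g. inv_map h \<circ> g) {g \<in> I. \<eta> \<in> A g}"
          by (rule inj_on_comp_isometry[OF G_isometry[OF subgroup_inv[OF subgroup_G hG]]])
        show "(\<lambda>g. inv_map h \<circ> g) ` {g \<in> I. \<eta> \<in> A g} \<subseteq> {g \<in> \<Gamma>. dist p (g p) \<le> 2 * R}"
        proof (rule image_subsetI)
          fix g assume g: "g \<in> {g \<in> I. \<eta> \<in> A g}"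
          then have gI: "g \<in> I" "\<eta> \<in> A g" by auto
          obtain t where "dist (proj ((inv_map \<alpha> \<circ> ray_to p \<eta>) t)) (h p) \<le> R"
              "dist (proj ((inv_map \<alpha> \<circ> ray_to p \<eta>) t)) (g p) \<le> R"
            using eventually_happens'[OF trivial_limit_at_top_linorder
                eventually_conj[OF ray(2)[OF h] ray(2)[OF gI]]] by blast
          then have "dist (h p) (g p) \<le> 2 * R"
            using dist_triangle2[of "h p" "g p" "proj ((inv_map \<alpha> \<circ> ray_to p \<eta>) t)"]
            by (simp add: dist_commute)
          moreover have "dist p ((inv_map h \<circ> g) p) = dist (h p) (g p)"
            using isometries_dist[OF G_isometry[OF hG], of p "inv_map h (g p)"]
            by (simp add: isometries_f_inv[OF G_isometry[OF hG]])
          moreover have "inv_map h \<circ> g \<in> \<Gamma>"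
            using g I hG G_sub by (intro subgroup_comp[OF subgroup_\<Gamma>] subgroup_inv[OF subgroup_\<Gamma>]) auto
          ultimately show "inv_map h \<circ> g \<in> {g \<in> \<Gamma>. dist p (g p) \<le> 2 * R}" by simp
        qed
      qed (rule fin)
    qed
    have each: "exp (- \<delta> * (infdist p (\<alpha> ` C) + T + M)) * measure \<mu> ?V \<le> measure \<mu> (A g)" if g: "g \<in> I" for g
    proof -
      have "dist p (\<alpha> (g p)) \<le> infdist p (\<alpha> ` C) + T + M"
        using dist_triangle[of x "g p" "proj x"] close[OF g] dist_proj[of x]
        by (simp add: dist_translate[OF \<alpha>] infdist_translate[OF \<alpha>] x_def)
      then have "\<delta> * dist p (\<alpha> (g p)) \<le> \<delta> * (infdist p (\<alpha> ` C) + T + M)"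
        using \<delta>_nonneg by (rule mult_left_mono)
      then have "exp (- \<delta> * (infdist p (\<alpha> ` C) + T + M)) \<le> exp (- \<delta> * dist p ((\<alpha> \<circ> g) p))" by simp
      then have "exp (- \<delta> * (infdist p (\<alpha> ` C) + T + M)) * measure \<mu> ?V
          \<le> exp (- \<delta> * dist p ((\<alpha> \<circ> g) p)) * measure \<mu> ?V"
        by (intro mult_right_mono) auto
      also have "\<dots> \<le> measure \<mu> (A g)"
        unfolding A_def by (rule measure_boundary_action_image_ge[OF \<alpha>g[OF g] sets_exit_set])
      finally show ?thesis .
    qed
    have "real (card I) * (exp (- \<delta> * (infdist p (\<alpha> ` C) + T + M)) * measure \<mu> ?V) \<le> (\<Sum>g\<in>I. measure \<mu> (A g))"
      using sum_mono[OF each] by simp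
    also have "\<dots> \<le> real N * measure \<mu> S"
      by (rule sum_measure_le_multiplicity[OF I(1) A A_sub S mult])
    finally show ?thesis
      using N by (simp add: c_def S_def field_simps)
  qed
  show ?thesis
    using L c main by (intro exI[of _ L] conjI exI[of _ c] allI ballI impI) auto
qed

lemma measure_shadow_le_count:
  assumes e: "e > 0"
  shows "\<exists>w\<ge>0. \<exists>E>0. \<forall>T\<ge>0. \<forall>\<alpha>\<in>\<Gamma>. measure \<mu> (shadow p T e (\<alpha> ` C))
      \<le> E * (real (card {g \<in> G. \<bar>dist (proj (inv_map \<alpha> p)) (g p) - T\<bar> \<le> w})
              * exp (- \<delta> * (infdist p (\<alpha> ` C) + T)))"
proof -
  note d0 = d_nonneg
  define w s where "w = d + 5 * e + 4 * D" and "s = d + 2 * e + 2 * D"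
  define D' where "D' = D + 2 * e + s"
  define E where "E = exp (2 * (s + 1) * \<delta>) * exp (\<delta> * D')"
  have main: "measure \<mu> (shadow p T e (\<alpha> ` C))
      \<le> E * (real (card {g \<in> G. \<bar>dist (proj (inv_map \<alpha> p)) (g p) - T\<bar> \<le> w})
              * exp (- \<delta> * (infdist p (\<alpha> ` C) + T)))" if T: "T \<ge> 0" and \<alpha>: "\<alpha> \<in> \<Gamma>" for T \<alpha>
  proof -
    define x H where "x = inv_map \<alpha> p" and "H = infdist p (\<alpha> ` C)"
    have H: "H = height x" by (simp add: H_def x_def infdist_translate[OF \<alpha>])
    define J0 where "J0 = {g \<in> G. \<bar>dist (proj x) (g p) - T\<bar> \<le> w}"
    \<comment> \<open>The mass bound needs orbit points far from \<open>x\<close>. The ray passes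
      within \<open>s\<close> of its orbit point at a time at least H + T - (D + 2 e), so
      restricting to these points loses no part of the shadow.\<close>
    define J where "J = {g \<in> J0. H + T - D' \<le> dist x (g p)}"
    have "J0 \<subseteq> {g \<in> \<Gamma>. dist p (g p) \<le> dist p (proj x) + T + w}"
    proof
      fix g assume g: "g \<in> J0"
      then show "g \<in> {g \<in> \<Gamma>. dist p (g p) \<le> dist p (proj x) + T + w}"
        using dist_triangle[of p "g p" "proj x"] G_sub by (auto simp: J0_def abs_le_iff)
    qed
    then have finJ0: "finite J0" using fin finite_subset by blast
    then have finJ: "finite J" by (simp add: J_def)
    \<comment> \<open>Enlarging \<open>s\<close> by 1 allows open balls, which make these sets
      measurable.\<close>
    define O' where "O' g = {\<eta> \<in> boundary. \<exists>t\<in>{0..}. ray_to p \<eta> t \<in> ball (\<alpha> (g p)) (s + 1)}" for g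
    have O': "O' g \<in> sets \<mu>" for g
      unfolding O'_def by (rule sets_ray_open) auto
    have "shadow p T e (\<alpha> ` C) \<subseteq> (\<Union>g\<in>J. O' g)"
    proof
      fix \<eta> assume "\<eta> \<in> shadow p T e (\<alpha> ` C)"
      then obtain a b where \<eta>: "\<eta> \<in> boundary" and ab: "0 \<le> a" "a \<le> b" "T \<le> b - a"
        and near: "\<And>t. t \<in> {a..b} \<Longrightarrow> height ((inv_map \<alpha> \<circ> ray_to p \<eta>) t) < e"
        unfolding shadow_translate[OF \<alpha>] by blast
      define c where "c = inv_map \<alpha> \<circ> ray_to p \<eta>"
      have c: "geodesic_ray c"
        unfolding c_def by (rule isometry_ray[OF \<Gamma>_isometry[OF subgroup_inv[OF subgroup_\<Gamma> \<alpha>]] ray_to(3)[OF \<eta>]])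
      have c0: "c 0 = x" by (simp add: c_def x_def ray_to(2)[OF \<eta>])
      obtain g t where g: "g \<in> G" and t: "0 \<le> t" "dist (c t) (g p) \<le> s"
        "\<bar>dist (proj x) (g p) - T\<bar> \<le> w" "H + T - (D + 2 * e) \<le> t"
        using ray_near_set_orbit_point[OF c ab T, of e] near[of a] near[of b] ab
        unfolding c_def[symmetric] c0 H[symmetric] s_def w_def by auto
      have "dist x (c t) = t" using geodesic_ray_dist[OF c, of 0 t] t c0 by simp
      then have "H + T - D' \<le> dist x (g p)"
        using t dist_triangle[of x "c t" "g p"] by (simp add: D'_def dist_commute)
      then have "g \<in> J" using g t by (simp add: J_def J0_def)
      moreover have "dist (\<alpha> (g p)) (ray_to p \<eta> t) \<le> s"
      proof -
        have "ray_to p \<eta> t = \<alpha> (c t)" by (simp add: c_def isometries_f_inv[OF \<Gamma>_isometry[OF \<alpha>]])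
        then show ?thesis using t by (simp add: isometries_dist[OF \<Gamma>_isometry[OF \<alpha>]] dist_commute)
      qed
      then have "\<eta> \<in> O' g" unfolding O'_def using \<eta> t by (intro CollectI conjI bexI[of _ t]) auto
      ultimately show "\<eta> \<in> (\<Union>g\<in>J. O' g)" by blast
    qed
    then have "measure \<mu> (shadow p T e (\<alpha> ` C)) \<le> measure \<mu> (\<Union>g\<in>J. O' g)"
      using O' finJ by (intro finite_measure_mono sets.finite_UN) auto
    also have "\<dots> \<le> (\<Sum>g\<in>J. measure \<mu> (O' g))"
      using O' finJ by (intro finite_measure_subadditive_finite) auto
    also have "\<dots> \<le> (\<Sum>g\<in>J. E * exp (- \<delta> * (H + T)))"
    proof (rule sum_mono)
      fix g assume g: "g \<in> J"
      then have "\<alpha> \<circ> g \<in> \<Gamma>"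
        using G_sub by (intro subgroup_comp[OF subgroup_\<Gamma> \<alpha>]) (auto simp: J_def J0_def)
      then have "measure \<mu> (O' g) \<le> exp (2 * (s + 1) * \<delta>) * exp (- \<delta> * dist p ((\<alpha> \<circ> g) p))"
      proof (rule measure_shadow_le[OF _ O'])
        fix \<xi> assume "\<xi> \<in> O' g"
        then show "\<exists>t\<ge>0. dist (ray_to p \<xi> t) ((\<alpha> \<circ> g) p) \<le> s + 1"
          by (auto simp: O'_def dist_commute intro: less_imp_le)
      qed
      also have "\<dots> \<le> exp (2 * (s + 1) * \<delta>) * exp (\<delta> * D' - \<delta> * (H + T))"
      proof -
        have "\<delta> * (H + T - D') \<le> \<delta> * dist p (\<alpha> (g p))"
          using g \<delta>_nonneg by (intro mult_left_mono) (auto simp: J_def dist_translate[OF \<alpha>] x_def)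
        then show ?thesis by (intro mult_left_mono) (auto simp: algebra_simps)
      qed
      also have "\<dots> = E * exp (- \<delta> * (H + T))"
        unfolding E_def mult.assoc by (simp flip: exp_add)
      finally show "measure \<mu> (O' g) \<le> E * exp (- \<delta> * (H + T))" .
    qed
    also have "\<dots> = real (card J) * (E * exp (- \<delta> * (H + T)))" by simp
    also have "\<dots> \<le> real (card J0) * (E * exp (- \<delta> * (H + T)))"
      using finJ0 by (intro mult_right_mono of_nat_mono card_mono) (auto simp: J_def E_def)
    finally show ?thesis by (simp add: J0_def x_def H_def mult_ac)
  qed
  have "w \<ge> 0" "E > 0" using d0 e D_pos by (auto simp: w_def E_def)
  with main show ?thesis by (intro exI[of _ w] conjI exI[of _ E] allI ballI impI) auto
qed

text \<open>It remains to pass from counting around the projection of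
  \<open>inv_map \<alpha> p\<close> to counting around \<open>p\<close>: some \<open>h\<close> in
  \<open>G\<close> carries \<open>p\<close> to within \<open>d\<close> of this projection, so
  translating by \<open>h\<close> changes the distances by at most \<open>d\<close>.\<close>

lemma measure_shadow_comparable:
  assumes growth: "growth_polynomial p G Q" and e: "e > 0"
  shows "\<exists>K>1. \<forall>T\<ge>0. \<forall>\<alpha>\<in>\<Gamma>.
           (let B = poly Q T * exp (- \<delta> * (infdist p (\<alpha> ` C) + T) + critexp p G * T)
            in 1 / K * B \<le> measure \<mu> (shadow p T e (\<alpha> ` C)) \<and> measure \<mu> (shadow p T e (\<alpha> ` C)) \<le> K * B)"
proof -
  note d0 = d_nonneg
  have finG: "finite {g \<in> G. dist p (g p) \<le> r}" for r
    by (rule finite_subset[OF _ fin[of r]]) (use G_sub in auto)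
  have pos: "poly Q x > 0" for x using growth by (simp add: growth_polynomial_def)
  obtain w E where w: "w \<ge> 0" and E: "E > 0" and upper: "\<And>T \<alpha>. T \<ge> 0 \<Longrightarrow> \<alpha> \<in> \<Gamma> \<Longrightarrow>
      measure \<mu> (shadow p T e (\<alpha> ` C))
      \<le> E * (real (card {g \<in> G. \<bar>dist (proj (inv_map \<alpha> p)) (g p) - T\<bar> \<le> w})
              * exp (- \<delta> * (infdist p (\<alpha> ` C) + T)))"
    using measure_shadow_le_count[OF e] by blast
  obtain U where U: "U > 0" and count_up: "\<And>T. T \<ge> 0 \<Longrightarrow>
      real (card {g \<in> G. \<bar>dist p (g p) - T\<bar> \<le> w + d}) \<le> U * (poly Q T * exp (critexp p G * T))"
    using count_annulus_upper[OF growth finG, of "w + d"] w d0 by auto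
  obtain L c where L: "L \<ge> 0" and c: "c > 0" and lower: "\<forall>T\<ge>0. \<forall>\<alpha>\<in>\<Gamma>. \<forall>M I. finite I \<longrightarrow> I \<subseteq> G \<longrightarrow>
     (\<forall>g\<in>I. T + L \<le> dist (proj (inv_map \<alpha> p)) (g p) \<and> dist (proj (inv_map \<alpha> p)) (g p) \<le> T + M) \<longrightarrow>
     c * (real (card I) * exp (- \<delta> * (infdist p (\<alpha> ` C) + T + M))) \<le> measure \<mu> (shadow p T e (\<alpha> ` C))"
    using measure_shadow_ge[OF e] by (elim exE conjE) (rule that)
  obtain c' M where c': "c' > 0" and M: "M \<ge> 0" and count_low: "\<And>T. T \<ge> 0 \<Longrightarrow>
      c' * (poly Q T * exp (critexp p G * T))
        \<le> real (card {g \<in> G. T + (L + d) \<le> dist p (g p) \<and> dist p (g p) \<le> T + (L + d) + M})"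
    using count_annulus_lower[OF growth finG, of "L + d"] L d0 by auto
  \<comment> \<open>The annulus around \<open>p\<close> starts at \<open>T + L + d\<close>; after
    translation by \<open>h\<close> its points are between \<open>T + L\<close> and
    \<open>T + L + 2 * d + M\<close> from the projection.\<close>
  define M' where "M' = L + 2 * d + M"
  define lo where "lo = c * c' * exp (- \<delta> * M')"
  have lo: "lo > 0" using c c' by (simp add: lo_def)
  define K where "K = 2 + E * U + 1 / lo"
  have K: "K > 1" "E * U \<le> K" "1 / K \<le> lo"
  proof -
    have "E * U > 0" "1 / lo > 0" using E U lo by auto
    then show "K > 1" "E * U \<le> K" unfolding K_def by linarith+
    have "1 / lo \<le> K" using \<open>E * U > 0\<close> unfolding K_def by linarith
    then show "1 / K \<le> lo" using lo \<open>K > 1\<close> by (simp add: field_simps)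
  qed
  have main: "1 / K * B \<le> measure \<mu> (shadow p T e (\<alpha> ` C)) \<and> measure \<mu> (shadow p T e (\<alpha> ` C)) \<le> K * B"
    if T: "T \<ge> 0" and \<alpha>: "\<alpha> \<in> \<Gamma>"
      and B: "B = poly Q T * exp (- \<delta> * (infdist p (\<alpha> ` C) + T) + critexp p G * T)" for T \<alpha> B
  proof -
    define x where "x = inv_map \<alpha> p"
    define F where "F = exp (- \<delta> * (infdist p (\<alpha> ` C) + T))"
    have F: "F > 0" by (simp add: F_def)
    define q where "q = poly Q T * exp (critexp p G * T)"
    have B_eq: "B = q * F" by (simp only: B q_def F_def exp_add mult_ac)
    have B0: "B > 0" using pos[of T] F by (simp add: B_eq q_def)
    obtain h where h: "h \<in> G" "dist (h p) (proj x) \<le> d" using cobounded[OF proj_in] by blast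
    have isoh: "h \<in> isometries" by (rule G_isometry[OF h(1)])
    have move: "\<bar>dist (proj x) y - dist (h p) y\<bar> \<le> d" for y
      using h(2) dist_triangle[of "proj x" y "h p"] dist_triangle[of "h p" y "proj x"]
      by (simp add: dist_commute abs_le_iff)
    have "card {g \<in> G. \<bar>dist (proj x) (g p) - T\<bar> \<le> w} \<le> card {g \<in> G. \<bar>dist p (g p) - T\<bar> \<le> w + d}"
    proof (rule card_inj_on_le[of "\<lambda>g. inv_map h \<circ> g"])
      show "inj_on (\<lambda>g. inv_map h \<circ> g) {g \<in> G. \<bar>dist (proj x) (g p) - T\<bar> \<le> w}"
        by (rule inj_on_comp_isometry[OF G_isometry[OF subgroup_inv[OF subgroup_G h(1)]]])
      show "(\<lambda>g. inv_map h \<circ> g) ` {g \<in> G. \<bar>dist (proj x) (g p) - T\<bar> \<le> w}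
          \<subseteq> {g \<in> G. \<bar>dist p (g p) - T\<bar> \<le> w + d}"
      proof (rule image_subsetI)
        fix g assume g: "g \<in> {g \<in> G. \<bar>dist (proj x) (g p) - T\<bar> \<le> w}"
        have "dist p ((inv_map h \<circ> g) p) = dist (h p) (g p)"
          using isometries_dist[OF isoh, of p "inv_map h (g p)"] by (simp add: isometries_f_inv[OF isoh])
        then show "inv_map h \<circ> g \<in> {g \<in> G. \<bar>dist p (g p) - T\<bar> \<le> w + d}"
          using g move[of "g p"] subgroup_comp[OF subgroup_G subgroup_inv[OF subgroup_G h(1)], of g]
          by (simp add: abs_le_iff)
      qed
      show "finite {g \<in> G. \<bar>dist p (g p) - T\<bar> \<le> w + d}"
        by (rule finite_subset[OF _ finG[of "T + w + d"]]) auto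
    qed
    then have "real (card {g \<in> G. \<bar>dist (proj x) (g p) - T\<bar> \<le> w}) \<le> U * q"
      using count_up[OF T] unfolding q_def by linarith
    then have "E * (real (card {g \<in> G. \<bar>dist (proj x) (g p) - T\<bar> \<le> w}) * F) \<le> E * (U * q * F)"
      using E F by (intro mult_left_mono mult_right_mono) auto
    then have "measure \<mu> (shadow p T e (\<alpha> ` C)) \<le> E * U * B"
      using upper[OF T \<alpha>] by (simp add: x_def F_def B_eq mult_ac)
    also have "\<dots> \<le> K * B" using K B0 by (intro mult_right_mono) auto
    finally have up: "measure \<mu> (shadow p T e (\<alpha> ` C)) \<le> K * B" .
    define I0 where "I0 = {g \<in> G. T + (L + d) \<le> dist p (g p) \<and> dist p (g p) \<le> T + (L + d) + M}"
    define I where "I = (\<lambda>g. h \<circ> g) ` I0"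
    have finI0: "finite I0" by (rule finite_subset[OF _ finG[of "T + (L + d) + M"]]) (auto simp: I0_def)
    have cardI: "card I = card I0"
      unfolding I_def by (rule card_image[OF inj_on_comp_isometry[OF isoh]])
    have "c * (real (card I) * exp (- \<delta> * (infdist p (\<alpha> ` C) + T + M'))) \<le> measure \<mu> (shadow p T e (\<alpha> ` C))"
    proof (rule lower[THEN spec, THEN mp, OF T, THEN bspec, OF \<alpha>, THEN spec, THEN spec, THEN mp, THEN mp, THEN mp])
      show "finite I" using finI0 by (simp add: I_def)
      show "I \<subseteq> G" using subgroup_comp[OF subgroup_G h(1)] by (auto simp: I_def I0_def)
      show "\<forall>g\<in>I. T + L \<le> dist (proj (inv_map \<alpha> p)) (g p) \<and> dist (proj (inv_map \<alpha> p)) (g p) \<le> T + M'"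
      proof
        fix g assume "g \<in> I"
        then obtain f where f: "f \<in> I0" "g = h \<circ> f" by (auto simp: I_def)
        then show "T + L \<le> dist (proj (inv_map \<alpha> p)) (g p) \<and> dist (proj (inv_map \<alpha> p)) (g p) \<le> T + M'"
          using move[of "g p"] isometries_dist[OF isoh, of p "f p"]
          by (auto simp: I0_def M'_def x_def abs_le_iff)
      qed
    qed
    moreover have "exp (- \<delta> * (infdist p (\<alpha> ` C) + T + M')) = F * exp (- \<delta> * M')"
      unfolding F_def exp_add[symmetric] by (simp add: algebra_simps)
    ultimately have low1: "c * (real (card I0) * (F * exp (- \<delta> * M'))) \<le> measure \<mu> (shadow p T e (\<alpha> ` C))"
      by (simp add: cardI)
    have "c' * q \<le> real (card I0)" using count_low[OF T] by (simp add: q_def I0_def)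
    then have "c * (c' * q * (F * exp (- \<delta> * M'))) \<le> c * (real (card I0) * (F * exp (- \<delta> * M')))"
      using c F by (intro mult_left_mono mult_right_mono) auto
    then have "lo * B \<le> measure \<mu> (shadow p T e (\<alpha> ` C))"
      using low1 by (simp add: lo_def B_eq mult_ac)
    moreover have "1 / K * B \<le> lo * B" using K B0 by (intro mult_right_mono) auto
    ultimately show ?thesis using up by linarith
  qed
  show ?thesis
    unfolding Let_def using K(1) main by (intro exI[of _ K] conjI allI impI ballI) auto
qed

end


section \<open>The hypotheses of the theorem\<close>

text \<open>Since \<open>card\<close> is \<open>0\<close> on infinite sets, the lower growth bound forces the balls to be finite.\<close>

lemma purely_exponential_growth_finite:
  fixes p :: "'a::metric_space"
  assumes "purely_exponential_growth p \<Gamma>"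
  shows "finite {g \<in> \<Gamma>. dist p (g p) \<le> r}"
proof -
  define n where "n = nat \<lceil>r\<rceil> + 1"
  have n: "1 \<le> n" by (simp add: n_def)
  obtain K where K: "K > 1" and "1 / K * exp (critexp p \<Gamma> * real n) \<le> real (card {g \<in> \<Gamma>. dist p (g p) \<le> real n})"
    using assms n unfolding purely_exponential_growth_def Let_def by blast
  moreover have "1 / K * exp (critexp p \<Gamma> * real n) > 0" using K by simp
  ultimately have "0 < card {g \<in> \<Gamma>. dist p (g p) \<le> real n}" by linarith
  then have "finite {g \<in> \<Gamma>. dist p (g p) \<le> real n}" by (rule card_ge_0_finite)
  moreover have "r \<le> real n" using real_nat_ceiling_ge[of r] by (simp add: n_def)
  then have "{g \<in> \<Gamma>. dist p (g p) \<le> r} \<subseteq> {g \<in> \<Gamma>. dist p (g p) \<le> real n}" by auto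
  ultimately show ?thesis by (rule finite_subset[rotated])
qed

text \<open>The identity is always counted, so no logarithm is negative. The mass estimates multiply
  inequalities by this exponent.\<close>

lemma critexp_nonneg:
  fixes p :: "'a::metric_space"
  assumes "id \<in> \<Gamma>"
  shows "0 \<le> critexp p \<Gamma>"
proof -
  have "eventually (\<lambda>t::real. 0 \<le> (let N = {g \<in> \<Gamma>. dist p (g p) \<le> t} in
       if finite N then ereal (ln (real (card N)) / t) else \<infinity>)) at_top"
    using eventually_gt_at_top[of 0]
  proof (rule eventually_mono)
    fix t :: real assume t: "0 < t"
    let ?N = "{g \<in> \<Gamma>. dist p (g p) \<le> t}"
    have "0 \<le> ln (real (card ?N)) / t" if "finite ?N"
    proof -
      have "?N \<noteq> {}" using assms t by (auto intro: exI[of _ id])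
      then have "1 \<le> card ?N" using that by (simp add: Suc_le_eq card_gt_0_iff)
      then show ?thesis using t by simp
    qed
    then show "0 \<le> (let N = ?N in if finite N then ereal (ln (real (card N)) / t) else \<infinity>)"
      by (simp add: Let_def)
  qed
  then have "0 \<le> critical_exponent p \<Gamma>"
    unfolding critical_exponent_def by (intro le_Limsup) auto
  then show ?thesis by (rule real_of_ereal_pos)
qed

text \<open>Local finiteness: only finitely many translates of \<open>K\<close> meet a given unit
  ball.\<close>

lemma closed_orbit_of_compact:
  fixes p :: "'a::metric_space"
  assumes fin: "\<And>r. finite {g \<in> G. dist p (g p) \<le> r}" and iso: "\<And>g. g \<in> G \<Longrightarrow> g \<in> isometries"
    and K: "compact K"
  shows "closed (\<Union>g\<in>G. g ` K)"
proof -
  obtain d where d: "\<And>k. k \<in> K \<Longrightarrow> dist p k \<le> d"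
    using compact_imp_bounded[OF K] bounded_any_center[of K p] by auto
  let ?S = "\<Union>g\<in>G. g ` K"
  have "x \<in> ?S" if x: "x \<in> closure ?S" for x
  proof -
    define F where "F = {g \<in> G. g ` K \<inter> ball x 1 \<noteq> {}}"
    have "F \<subseteq> {g \<in> G. dist p (g p) \<le> dist p x + 1 + d}"
    proof
      fix g assume g: "g \<in> F"
      then obtain k where k: "k \<in> K" "dist x (g k) < 1" by (auto simp: F_def)
      have "dist (g k) (g p) \<le> d"
        using d[OF k(1)] g isometries_dist[OF iso, of g k p] by (simp add: F_def dist_commute)
      then show "g \<in> {g \<in> G. dist p (g p) \<le> dist p x + 1 + d}"
        using g k dist_triangle[of p "g p" x] dist_triangle[of x "g p" "g k"] by (simp add: F_def)
    qed
    then have "finite F" using fin finite_subset by blast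
    moreover have "compact (g ` K)" if "g \<in> F" for g
    proof (rule compact_continuous_image[OF _ K])
      have "g \<in> isometries" using that iso by (simp add: F_def)
      then show "continuous_on K g"
        unfolding continuous_on_iff by (metis isometries_dist)
    qed
    ultimately have "closed (\<Union>g\<in>F. g ` K)" by (intro compact_imp_closed compact_UN) auto
    moreover have "ball x 1 \<inter> ?S \<subseteq> (\<Union>g\<in>F. g ` K)" by (auto simp: F_def)
    ultimately have "closure (ball x 1 \<inter> ?S) \<subseteq> (\<Union>g\<in>F. g ` K)" by (rule closure_minimal[rotated])
    moreover have "x \<in> closure (ball x 1 \<inter> ?S)"
      using open_Int_closure_subset[OF open_ball[of x 1], of ?S] x by auto
    ultimately have "x \<in> (\<Union>g\<in>F. g ` K)" by blast
    then show ?thesis by (auto simp: F_def)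
  qed
  then show ?thesis using closure_subset_eq by blast
qed

lemma infinite_index_proper:
  assumes "subgroup \<Gamma> isom_group" "infinite_index H \<Gamma>"
  shows "H \<noteq> \<Gamma>"
proof
  assume H: "H = \<Gamma>"
  have "\<Gamma> #>\<^bsub>isom_group\<lparr>carrier := \<Gamma>\<rparr>\<^esub> a = \<Gamma>" if a: "a \<in> \<Gamma>" for a
  proof -
    have "g \<in> (\<lambda>h. h \<circ> a) ` \<Gamma>" if g: "g \<in> \<Gamma>" for g
    proof (rule image_eqI)
      show "g = (g \<circ> inv_map a) \<circ> a"
        by (rule ext) (simp add: isometries_inv_f[OF subgroup_isometries[OF assms(1) a]])
      show "g \<circ> inv_map a \<in> \<Gamma>"
        by (intro subgroup_comp[OF assms(1)] subgroup_inv[OF assms(1)] g a)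
    qed
    moreover have "h \<circ> a \<in> \<Gamma>" if "h \<in> \<Gamma>" for h by (rule subgroup_comp[OF assms(1) that a])
    ultimately have "(\<lambda>h. h \<circ> a) ` \<Gamma> = \<Gamma>" by blast
    then show ?thesis by (auto simp: r_coset_def isom_group_def)
  qed
  then have "rcosets\<^bsub>isom_group\<lparr>carrier := \<Gamma>\<rparr>\<^esub> \<Gamma> \<subseteq> {\<Gamma>}" by (auto simp: RCOSETS_def)
  then have "finite (rcosets\<^bsub>isom_group\<lparr>carrier := \<Gamma>\<rparr>\<^esub> \<Gamma>)" by (rule finite_subset) simp
  then show False using assms(2) by (simp add: infinite_index_def H)
qed

theorem theorem1p8:
  fixes p :: "'a::{heine_borel, cat0_space}"
    and \<Gamma> \<Gamma>\<^sub>0 :: "('a \<Rightarrow> 'a) set"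
    and C :: "'a set"
    and Q :: "real poly"
    and \<mu> :: "(real \<Rightarrow> 'a) set measure"
  assumes "subgroup \<Gamma> isom_group"
    and "discrete_isometries \<Gamma>"
    and "\<forall>x. critical_exponent x \<Gamma> < \<infinity>"
    and "\<exists>g\<in>\<Gamma>. rank_one_isometry g"
    and "C \<noteq> {}"
    and "geodesically_convex C"
    and "subgroup \<Gamma>\<^sub>0 isom_group"
    and "\<Gamma>\<^sub>0 \<subseteq> \<Gamma>"
    and "acts_cocompactly \<Gamma>\<^sub>0 C"
    and "Morse_subset C"
    and "contains_parallel_lines C"
    and "infinite_index \<Gamma>\<^sub>0 \<Gamma>"
    and "almost_malnormal \<Gamma>\<^sub>0 \<Gamma>"
    and "\<forall>x. \<exists>P. growth_polynomial x \<Gamma>\<^sub>0 P"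
    and "\<forall>x. purely_exponential_growth x \<Gamma>"
    and "growth_polynomial p \<Gamma>\<^sub>0 Q"
    and "Patterson_Sullivan p \<Gamma> (critexp p \<Gamma>) \<mu>"
  shows "\<forall>\<epsilon>>0. \<exists>K>1. \<forall>T\<ge>0. \<forall>\<alpha>\<in>\<Gamma>.
           (let B = poly Q T *
                  exp (- critexp p \<Gamma> * (infdist p (\<alpha> ` C) + T) + critexp p \<Gamma>\<^sub>0 * T)
            in 1 / K * B \<le> measure \<mu> (shadow p T \<epsilon> (\<alpha> ` C)) \<and>
               measure \<mu> (shadow p T \<epsilon> (\<alpha> ` C)) \<le> K * B)"
proof (intro allI impI)
  fix \<epsilon> :: real assume \<epsilon>: "0 < \<epsilon>"
  note sub = assms(1) and sub0 = assms(7) and sub_le = assms(8)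
  have fin: "finite {g \<in> \<Gamma>. dist p (g p) \<le> r}" for r
    using assms(15) by (intro purely_exponential_growth_finite) blast
  have fin0: "finite {g \<in> \<Gamma>\<^sub>0. dist p (g p) \<le> r}" for r
    by (rule finite_subset[OF _ fin[of r]]) (use sub_le in auto)
  obtain S where S: "compact S" "(\<Union>g\<in>\<Gamma>\<^sub>0. g ` S) = C"
    using assms(9) unfolding acts_cocompactly_def by blast
  have iso0: "g \<in> isometries" if "g \<in> \<Gamma>\<^sub>0" for g by (rule subgroup_isometries[OF sub0 that])
  \<comment> \<open>Closedness, which the projection to \<open>C\<close> requires, is a consequence
    of cocompactness.\<close>
  have "closed C" using closed_orbit_of_compact[OF fin0 iso0 S(1)] S(2) by simp
  obtain d where d: "\<And>s. s \<in> S \<Longrightarrow> dist p s \<le> d"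
    using compact_imp_bounded[OF S(1)] bounded_any_center[of S p] by auto
  have maps: "g y \<in> C" if g: "g \<in> \<Gamma>\<^sub>0" and y: "y \<in> C" for g y
  proof -
    obtain h s where hs: "h \<in> \<Gamma>\<^sub>0" "s \<in> S" "y = h s" using y S(2) by blast
    have "(g \<circ> h) s \<in> (\<Union>g\<in>\<Gamma>\<^sub>0. g ` S)" using subgroup_comp[OF sub0 g hs(1)] hs(2) by blast
    then show ?thesis using S(2) hs(3) by simp
  qed
  have preserves: "g ` C = C" if g: "g \<in> \<Gamma>\<^sub>0" for g
  proof
    show "g ` C \<subseteq> C" using maps[OF g] by blast
    show "C \<subseteq> g ` C"
    proof
      fix y assume "y \<in> C"
      then have "inv_map g y \<in> C" using maps subgroup_inv[OF sub0 g] by blast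
      moreover have "y = g (inv_map g y)" by (simp add: isometries_f_inv[OF iso0[OF g]])
      ultimately show "y \<in> g ` C" by blast
    qed
  qed
  have cobounded: "\<exists>g\<in>\<Gamma>\<^sub>0. dist (g p) y \<le> d" if "y \<in> C" for y
  proof -
    from that obtain g s where "g \<in> \<Gamma>\<^sub>0" "s \<in> S" "y = g s" unfolding S(2)[symmetric] by blast
    then show ?thesis using d isometries_dist[OF iso0, of g p s] by (intro bexI[of _ g]) auto
  qed
  have "\<exists>D>0. \<forall>a b f. a \<le> b \<longrightarrow> quasi_geodesic 4 0 a b f \<longrightarrow> f a \<in> C \<longrightarrow> f b \<in> C \<longrightarrow> f ` {a..b} \<subseteq> nbhd D C"
    using assms(10) unfolding Morse_subset_def by simp
  then obtain D where D: "D > 0" "\<And>a b f. a \<le> b \<Longrightarrow> quasi_geodesic 4 0 a b f \<Longrightarrow> f a \<in> C \<Longrightarrow> f b \<in> C \<Longrightarrow>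
      f ` {a..b} \<subseteq> nbhd D C"
    by blast
  interpret conformal_morse p \<Gamma> "critexp p \<Gamma>" \<mu> C \<Gamma>\<^sub>0 d D
  proof (intro conformal_morse.intro conformal_morse_axioms.intro conformal_measure.intro
      cocompact_morse.intro cocompact_convex.intro cocompact_convex_axioms.intro closed_convex.intro
      morse_convex.intro morse_convex_axioms.intro)
    show "0 \<le> critexp p \<Gamma>" by (rule critexp_nonneg[OF subgroup_id[OF sub]])
    show "\<Gamma>\<^sub>0 \<noteq> \<Gamma>" by (rule infinite_index_proper[OF sub assms(12)])
  qed (use assms \<open>closed C\<close> preserves cobounded D fin in auto)
  show "\<exists>K>1. \<forall>T\<ge>0. \<forall>\<alpha>\<in>\<Gamma>.
           (let B = poly Q T *
                  exp (- critexp p \<Gamma> * (infdist p (\<alpha> ` C) + T) + critexp p \<Gamma>\<^sub>0 * T)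
            in 1 / K * B \<le> measure \<mu> (shadow p T \<epsilon> (\<alpha> ` C)) \<and>
               measure \<mu> (shadow p T \<epsilon> (\<alpha> ` C)) \<le> K * B)"
    by (rule measure_shadow_comparable[OF assms(16) \<epsilon>])
qed

end
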